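(* Let $\mathcal{P}$ be a property of $\Sigma$-edge-colored ordered graphs, or a property of images (viewed as ordered graphs as described in the context), and let $\delta\colon(0,1)\to(0,1)$ and $\eta\colon(0,1)\to(0,1)$ satisfy $\eta(\epsilon)<\epsilon$ for every $\epsilon\in(0,1)$. (1) Suppose $\mathcal{P}$ is $\delta$-earthmover resilient and $\eta$-tolerantly testable, where for every $\epsilon$ the corresponding non-adaptive $(\epsilon,\eta)$-tolerant test makes $q(\epsilon)$ queries. Then $\mathcal{P}$ is canonically testable. Moreover, if $q(\epsilon)$, $1/\eta(\epsilon)$ and $1/\delta(\epsilon)$ are bounded by polynomials in $\epsilon^{-1}$, then the number of queries of the canonical $\epsilon$-test is also polynomial in $\epsilon^{-1}$. (2) Suppose $\mathcal{P}$ is canonically testable, where the canonical (non-adaptive) $\epsilon$-test queries $q'(\epsilon)$ vertices. Then there is $\delta'\colon(0,1)\to(0,1)$, where $\delta'(\epsilon)$ depends only on $q'$ and $\epsilon$, such that $\mathcal{P}$ is both $\delta'$-earthmover resilient and $\delta'$-tolerantly testable. Moreover, if $q'$ is polynomial in $\epsilon^{-1}$, then $\delta'$ is polynomial in $\epsilon$.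
   Context: $\Sigma$ is a finite alphabet. A $\Sigma$-edge-colored ordered graph on $n$ vertices is a function $G\colon\binom{[n]}{2}\to\Sigma$ (vertex set $[n]$ with its natural order). A property is any set of such functions (over all $n$). The (relative Hamming) distance is $d_H(G,G')=|\{e: G(e)\ne G'(e)\}|/\binom{n}{2}$ for graphs on the same $n$; $d_H(G,\mathcal{P})=\min_{G'\in\mathcal{P}} d_H(G,G')$ over $G'\in\mathcal{P}$ on $n$ vertices; $G$ is $\epsilon$-far from $\mathcal{P}$ if $d_H(G,\mathcal{P})>\epsilon$ and $\epsilon$-close otherwise. An image $f\colon[n]\times[n]\to\Sigma$ is identified with the ordered graph $g\colon\binom{[2n]}{2}\to\Sigma\cup\{\sigma^*\}$ ($\sigma^*\notin\Sigma$) with $g(x,y)=\sigma^*$ whenever $x\neq y$ both lie in $[n]$ or both lie in $\{n+1,\dots,2n\}$, and $g(x,n+y)=f(x,y)$ for $x,y\in[n]$; all notions below for images are the corresponding notions for these representing graphs. Earthmover distance: for $x\in[n-1]$ let $\sigma_x$ be the transposition of $x,x+1$; a basic move turns $G$ into $G'$ with $G'(\{a,b\})=G(\{\sigma_x(a),\sigma_x(b)\})$. $D_e(G,G')$ is the minimum number of basic moves turning $G$ into $G'$ ($+\infty$ if impossible), and $d_e(G,G')=D_e(G,G')/\binom{n}{2}$. $\mathcal{P}$ is $\delta$-earthmover resilient if for every $\epsilon\in(0,1)$, every $G\in\mathcal{P}$ and every $G'$ with $d_e(G,G')\le\delta(\epsilon)$, $G'$ is $\epsilon$-close to $\mathcal{P}$;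 it is earthmover resilient if it is $\delta$-earthmover resilient for some $\delta$. Tests: an algorithm given $n$ and query access to the values of the unknown $G$. An $\epsilon$-test accepts every $G\in\mathcal{P}$ with probability $\ge 2/3$ and rejects every $G$ that is $\epsilon$-far from $\mathcal{P}$ with probability $\ge2/3$. An $(\epsilon,\eta)$-tolerant test accepts every $G$ that is $\eta(\epsilon)$-close to $\mathcal{P}$ with probability $\ge2/3$ and rejects every $\epsilon$-far $G$ with probability $\ge 2/3$. A canonical test with $q$ vertex queries picks a uniformly random $q$-subset $v_1<\dots<v_q$ of $[n]$, queries all values $G(v_iv_j)$, and accepts or rejects (possibly randomly) based only on the ordered tuple $(G(v_iv_j))_{i<j}$. $\mathcal{P}$ is canonically testable if for every $\epsilon>0$ it has a canonical $\epsilon$-test whose number of queries depends only on $\epsilon$ (not on $n$); it is $\eta$-tolerantly testable if for every $\epsilon$ it has an $(\epsilon,\eta)$-tolerant test whose number of queries depends only on $\epsilon$. *)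

theory Defs
  imports
    "HOL-Probability.Probability"
    "HOL-Combinatorics.Transposition"
    "HOL-Computational_Algebra.Polynomial"
    "HOL-Library.Ramsey"
    "HOL-Library.Extended_Nat"
begin

section \<open>Edge-colored ordered graphs and images\<close>

text \<open>
  A graph on \<open>n\<close> vertices is an extensional function on the \<open>2\<close>-subsets of \<open>{1..n}\<close>.
  A graph as a function does not determine \<open>n\<close> when \<open>n \<le> 1\<close>, so collections of graphs, such as
  properties, are families indexed by the number of vertices.
\<close>

type_synonym 'c graph = "nat set \<Rightarrow> 'c"
type_synonym 'c graph_family = "nat \<Rightarrow> 'c graph set"

definition edges :: "nat \<Rightarrow> nat set set" where
  "edges n = nsets {1..n} 2"

definition ordered_graphs :: "'c set \<Rightarrow> 'c graph_family" where
  "ordered_graphs \<Sigma> n = (edges n \<rightarrow>\<^sub>E \<Sigma>)"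

definition images :: "'c set \<Rightarrow> nat \<Rightarrow> (nat \<times> nat \<Rightarrow> 'c) set" where
  "images \<Sigma> m = ({1..m} \<times> {1..m} \<rightarrow>\<^sub>E \<Sigma>)"

text \<open>The color \<open>s\<close> is the additional color marking pairs of rows and pairs of columns.\<close>

definition graph_of_image :: "'c \<Rightarrow> nat \<Rightarrow> (nat \<times> nat \<Rightarrow> 'c) \<Rightarrow> 'c graph" where
  "graph_of_image s m f = (\<lambda>e\<in>edges (2 * m).
     if e \<subseteq> {1..m} \<or> e \<subseteq> {m + 1..2 * m} then s else f (Min e, Max e - m))"

definition image_graphs :: "'c \<Rightarrow> 'c set \<Rightarrow> 'c graph_family" where
  "image_graphs s \<Sigma> N = {graph_of_image s m f | m f. N = 2 * m \<and> f \<in> images \<Sigma> m}"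

text \<open>
  The class \<open>U\<close> of admissible inputs: all graphs over \<open>\<Sigma>\<close>, or the graphs representing images
  over \<open>\<Sigma>\<close>. Properties are subfamilies of \<open>U\<close>, and unknown inputs range over \<open>U\<close>.
\<close>

definition input_class :: "'c set \<Rightarrow> 'c graph_family \<Rightarrow> bool" where
  "input_class \<Sigma> U \<longleftrightarrow> U = ordered_graphs \<Sigma> \<or> (\<exists>s. s \<notin> \<Sigma> \<and> U = image_graphs s \<Sigma>)"

definition property_of :: "'c graph_family \<Rightarrow> 'c graph_family \<Rightarrow> bool" where
  "property_of U P \<longleftrightarrow> (\<forall>n. P n \<subseteq> U n)"


section \<open>Hamming and earthmover distance\<close>

definition hamming_dist :: "nat \<Rightarrow> 'c graph \<Rightarrow> 'c graph \<Rightarrow> real" where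
  "hamming_dist n G G' = real (card {e \<in> edges n. G e \<noteq> G' e}) / real (n choose 2)"

text \<open>The distance is \<open>\<infinity>\<close> if the property contains no graph on \<open>n\<close> vertices.\<close>

definition hamming_dist_to :: "nat \<Rightarrow> 'c graph \<Rightarrow> 'c graph_family \<Rightarrow> ereal" where
  "hamming_dist_to n G P = (INF G'\<in>P n. ereal (hamming_dist n G G'))"

definition far :: "real \<Rightarrow> nat \<Rightarrow> 'c graph \<Rightarrow> 'c graph_family \<Rightarrow> bool" where
  "far \<epsilon> n G P \<longleftrightarrow> hamming_dist_to n G P > ereal \<epsilon>"

abbreviation close :: "real \<Rightarrow> nat \<Rightarrow> 'c graph \<Rightarrow> 'c graph_family \<Rightarrow> bool" where
  "close \<epsilon> n G P \<equiv> \<not> far \<epsilon> n G P"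

definition basic_move :: "nat \<Rightarrow> 'c graph \<Rightarrow> 'c graph \<Rightarrow> bool" where
  "basic_move n G G' \<longleftrightarrow> (\<exists>x\<in>{1..<n}. G' = (\<lambda>e. G (Transposition.transpose x (x + 1) ` e)))"

definition min_moves :: "nat \<Rightarrow> 'c graph \<Rightarrow> 'c graph \<Rightarrow> enat" where
  "min_moves n G G' = (INF k\<in>{k. (basic_move n ^^ k) G G'}. enat k)"

definition earthmover_dist :: "nat \<Rightarrow> 'c graph \<Rightarrow> 'c graph \<Rightarrow> ereal" where
  "earthmover_dist n G G' = ereal_of_enat (min_moves n G G') / ereal (real (n choose 2))"

definition earthmover_resilient ::
    "'c graph_family \<Rightarrow> (real \<Rightarrow> real) \<Rightarrow> 'c graph_family \<Rightarrow> bool" where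
  "earthmover_resilient U \<delta> P \<longleftrightarrow>
     (\<forall>\<epsilon>\<in>{0<..<1}. \<forall>n. \<forall>G\<in>P n. \<forall>G'\<in>U n.
        earthmover_dist n G G' \<le> ereal (\<delta> \<epsilon>) \<longrightarrow> close \<epsilon> n G' P)"


section \<open>Tests\<close>

text \<open>
  The output distribution of a randomized algorithm, as a function of \<open>n\<close> and the input graph;
  \<open>True\<close> means accept.
\<close>

type_synonym 'c algorithm = "nat \<Rightarrow> 'c graph \<Rightarrow> bool pmf"

definition is_test :: "'c graph_family \<Rightarrow> 'c graph_family \<Rightarrow> real \<Rightarrow> 'c algorithm \<Rightarrow> bool" where
  "is_test U P \<epsilon> A \<longleftrightarrow> (\<forall>n. \<forall>G\<in>U n.
     (G \<in> P n \<longrightarrow> pmf (A n G) True \<ge> 2/3) \<and>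
     (far \<epsilon> n G P \<longrightarrow> pmf (A n G) False \<ge> 2/3))"

definition is_tolerant_test ::
    "'c graph_family \<Rightarrow> 'c graph_family \<Rightarrow> real \<Rightarrow> (real \<Rightarrow> real) \<Rightarrow> 'c algorithm \<Rightarrow> bool" where
  "is_tolerant_test U P \<epsilon> \<eta> A \<longleftrightarrow> (\<forall>n. \<forall>G\<in>U n.
     (close (\<eta> \<epsilon>) n G P \<longrightarrow> pmf (A n G) True \<ge> 2/3) \<and>
     (far \<epsilon> n G P \<longrightarrow> pmf (A n G) False \<ge> 2/3))"

text \<open>
  A deterministic adaptive query algorithm is a decision tree, and a randomized one is a
  distribution over decision trees, for each \<open>n\<close>. Querying a set that is not an edge yields no
  information, since graphs are extensional.
\<close>

datatype 'c query_tree = Decide bool | Query "nat set" "'c \<Rightarrow> 'c query_tree"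

primrec run_tree :: "'c graph \<Rightarrow> 'c query_tree \<Rightarrow> bool" where
  "run_tree G (Decide b) = b"
| "run_tree G (Query e k) = run_tree G (k (G e))"

primrec queries_at_most :: "'c query_tree \<Rightarrow> nat \<Rightarrow> bool" where
  "queries_at_most (Decide b) q \<longleftrightarrow> True"
| "queries_at_most (Query e k) q \<longleftrightarrow> q > 0 \<and> (\<forall>c. queries_at_most (k c) (q - 1))"

text \<open>Whatever the answers are, exactly the edges in the list are queried, in this order.\<close>

primrec queries_exactly :: "'c query_tree \<Rightarrow> nat set list \<Rightarrow> bool" where
  "queries_exactly (Decide b) es \<longleftrightarrow> es = []"
| "queries_exactly (Query e k) es \<longleftrightarrow>
     (\<exists>es'. es = e # es' \<and> (\<forall>c. queries_exactly (k c) es'))"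

definition run :: "(nat \<Rightarrow> 'c query_tree pmf) \<Rightarrow> 'c algorithm" where
  "run T n G = map_pmf (run_tree G) (T n)"

definition query_bound :: "(nat \<Rightarrow> 'c query_tree pmf) \<Rightarrow> nat \<Rightarrow> bool" where
  "query_bound T q \<longleftrightarrow> (\<forall>n. \<forall>t\<in>set_pmf (T n). queries_at_most t q)"

definition nonadaptive :: "(nat \<Rightarrow> 'c query_tree pmf) \<Rightarrow> bool" where
  "nonadaptive T \<longleftrightarrow> (\<forall>n. \<forall>t\<in>set_pmf (T n). \<exists>es. queries_exactly t es)"

definition tolerantly_testable ::
    "'c graph_family \<Rightarrow> (real \<Rightarrow> real) \<Rightarrow> 'c graph_family \<Rightarrow> bool" where
  "tolerantly_testable U \<eta> P \<longleftrightarrow>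
     (\<forall>\<epsilon>\<in>{0<..<1}. \<exists>q T. query_bound T q \<and> is_tolerant_test U P \<epsilon> \<eta> (run T))"

definition nonadaptively_tolerantly_testable_with ::
    "'c graph_family \<Rightarrow> (real \<Rightarrow> real) \<Rightarrow> (real \<Rightarrow> nat) \<Rightarrow> 'c graph_family \<Rightarrow> bool" where
  "nonadaptively_tolerantly_testable_with U \<eta> q P \<longleftrightarrow>
     (\<forall>\<epsilon>\<in>{0<..<1}. \<exists>T. nonadaptive T \<and> query_bound T (q \<epsilon>) \<and> is_tolerant_test U P \<epsilon> \<eta> (run T))"

text \<open>
  The tuple of the values \<open>G {v\<^sub>i, v\<^sub>j}\<close> for \<open>V = {v\<^sub>1 < \<dots> < v\<^sub>q}\<close>, as a graph on \<open>q\<close> vertices.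
\<close>

definition induced_tuple :: "nat set \<Rightarrow> 'c graph \<Rightarrow> 'c graph" where
  "induced_tuple V G = (\<lambda>e\<in>edges (card V). G ((\<lambda>i. sorted_list_of_set V ! (i - 1)) ` e))"

text \<open>
  The decision rule \<open>D\<close> maps \<open>n\<close> and the observed tuple to a possibly random verdict. All of the
  graph is read if \<open>n < q\<close>.
\<close>

definition canonical_algorithm :: "nat \<Rightarrow> (nat \<Rightarrow> 'c graph \<Rightarrow> bool pmf) \<Rightarrow> 'c algorithm" where
  "canonical_algorithm q D n G =
     bind_pmf (pmf_of_set (nsets {1..n} (min q n))) (\<lambda>V. D n (induced_tuple V G))"

definition canonically_testable_with ::
    "'c graph_family \<Rightarrow> (real \<Rightarrow> nat) \<Rightarrow> 'c graph_family \<Rightarrow> bool" where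
  "canonically_testable_with U q P \<longleftrightarrow>
     (\<forall>\<epsilon>>0. \<exists>D. is_test U P \<epsilon> (canonical_algorithm (q \<epsilon>) D))"

definition canonically_testable :: "'c graph_family \<Rightarrow> 'c graph_family \<Rightarrow> bool" where
  "canonically_testable U P \<longleftrightarrow> (\<exists>q. canonically_testable_with U q P)"


section \<open>Growth conditions\<close>

definition maps_unit_interval :: "(real \<Rightarrow> real) \<Rightarrow> bool" where
  "maps_unit_interval f \<longleftrightarrow> (\<forall>\<epsilon>\<in>{0<..<1}. f \<epsilon> \<in> {0<..<1})"

definition poly_bounded_in_inverse :: "(real \<Rightarrow> real) \<Rightarrow> bool" where
  "poly_bounded_in_inverse f \<longleftrightarrow> (\<exists>p :: real poly. \<forall>\<epsilon>\<in>{0<..<1}. f \<epsilon> \<le> poly p (1 / \<epsilon>))"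

end

theory Submission
  imports Defs "HOL-Combinatorics.Permutations"
begin

text \<open>
  From tolerant to canonical tests: let \<open>\<rho>\<close> be a uniformly random permutation of the
    vertices and let
  \<open>\<pi>\<close> be obtained by sorting \<open>\<rho>\<close> within each residue class modulo
    \<open>m = n div k\<close>. A second moment
  bound shows that for large \<open>k\<close>, independently of \<open>n\<close>, almost all vertices
    move only a short
  distance, so \<open>\<pi>\<close> has few inversions and \<open>G \<circ> \<pi>\<close> is
    earthmover-close to \<open>G\<close>. By resilience the
  tolerant test decides \<open>G \<circ> \<pi>\<close> correctly as a test
    for \<open>G\<close>. It only looks at boundedly many
  vertices, and \<open>\<pi>\<close> on these is determined
    by \<open>\<rho>\<close> on the union \<open>R\<close> of their residue classes. The
  image of \<open>R\<close> is a uniformly random vertex set of bounded size, independent of the order pattern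
  of \<open>\<rho>\<close> on \<open>R\<close>, so a canonical test simulates the whole process exactly.
    For images, \<open>G \<circ> \<pi>\<close> is
  first repaired at the few vertices that change between rows and columns.

  From canonical to tolerant tests: a basic move, or a change of one color, alters the tuple seen by
  a canonical test only if the sampled set contains a particular pair of vertices, so the acceptance
  probability changes by at most \<open>(q choose 2) / (n choose 2)\<close>. Majority of three runs restores
  the error bound.
\<close>


section \<open>Relabelings and inversions\<close>

text \<open>The obstacle: a uniform vertex sample shows relative order but no absolute positions,
  whereas a query algorithm chooses the positions that it reads. Positions are therefore recovered
  from ranks. A residue class modulo \<open>m\<close> is spread evenly over \<open>{1..n}\<close>
  and has about \<open>k\<close> elements, so in its random image the element of rank
  \<open>r\<close> lies near \<open>r * n / k\<close>, up to an error of order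
  \<open>n / sqrt k\<close>. Sorting each class separately keeps this local: the value at
  \<open>u\<close> involves only the class of \<open>u\<close>. Resilience speaks only of graphs
  that start in the property. For soundness it is thus applied to a member near the relabeled graph,
  which is moved back along the inverse permutation. For images two permutations are in play: the
  simulation can only repair colors edge by edge, while the analysis compares the result with a
  permutation that keeps rows and columns apart. A majority of three lifts \<open>2/3\<close> to
  \<open>20/27\<close>, which pays for the \<open>3/100\<close> of permutations that displace too
  many vertices.\<close>

lemma finite_edges [simp]: "finite (edges n)"
  by (simp add: edges_def finite_imp_finite_nsets)

lemma card_edges: "card (edges n) = n choose 2"
proof -
  have "edges n = {e. e \<subseteq> {1..n} \<and> card e = 2}"
    by (auto simp: edges_def nsets_def intro: finite_subset)
  then show ?thesis by (simp add: n_subsets)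
qed

lemma edges_iff: "e \<in> edges n \<longleftrightarrow> (\<exists>u v. e = {u, v} \<and> u \<in> {1..n}
  \<and> v \<in> {1..n} \<and> u < v)"
  by (auto simp: edges_def ordered_nsets_2_eq)

lemma edges_image:
  assumes "inj_on f V" "f ` V \<subseteq> {1..n}" "e \<subseteq> V" "e \<in> edges m"
  shows "f ` e \<in> edges n"
  using assms by (auto simp: edges_def nsets_def card_image inj_on_subset)

lemma edges_permute: "p permutes {1..n} \<Longrightarrow> p ` e \<in> edges n \<longleftrightarrow> e
  \<in> edges n"
proof -
  have *: "p ` e \<in> edges n" if "p permutes {1..n}" "e \<in> edges n" for p e
    using that by (intro edges_image[of p "{1..n}"])
      (auto simp: permutes_inj_on permutes_image edges_def nsets_def)
  assume p: "p permutes {1..n}"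
  have "inv p ` (p ` e) = e" by (simp add: image_comp permutes_inv_o[OF p])
  then show ?thesis using *[OF p, of e] *[OF permutes_inv[OF p], of "p ` e"] by auto
qed

lemma sorted_list_nth:
  fixes A :: "nat set"
  assumes "finite A" "i < card A"
  shows "sorted_list_of_set A ! i \<in> A" "card {y\<in>A. y < sorted_list_of_set A ! i} = i"
proof -
  let ?l = "sorted_list_of_set A"
  have len: "length ?l = card A" by simp
  have set: "set ?l = A" using assms by simp
  have srt: "sorted_wrt (<) ?l" by simp
  show "?l ! i \<in> A" using assms len set nth_mem by metis
  have "{y\<in>A. y < ?l ! i} = (!) ?l ` {..<i}"
  proof (intro set_eqI iffI)
    fix y assume y: "y \<in> {y\<in>A. y < ?l ! i}"
    then obtain j where j: "j < card A" "y = ?l ! j" using set len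
      by (metis (no_types, lifting) in_set_conv_nth mem_Collect_eq)
    have "j < i"
    proof (rule ccontr)
      assume "\<not> j < i"
      then have "?l ! i \<le> ?l ! j" using j len by (intro sorted_nth_mono) auto
      then show False using y j by auto
    qed
    then show "y \<in> (!) ?l ` {..<i}" using j by auto
  next
    fix y assume "y \<in> (!) ?l ` {..<i}"
    then obtain j where j: "j < i" "y = ?l ! j" by auto
    have "?l ! j < ?l ! i" using sorted_wrt_nth_less[OF srt j(1)] assms len by simp
    moreover have "?l ! j \<in> A" using j assms len set nth_mem by (metis less_trans)
    ultimately show "y \<in> {y\<in>A. y < ?l ! i}" using j by auto
  qed
  moreover have "inj_on ((!) ?l) {..<i}"
    using assms len by (intro inj_on_nth) auto
  ultimately show "card {y\<in>A. y < ?l ! i} = i" by (simp add: card_image)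
qed

lemma sorted_list_nth_rank:
  fixes A :: "nat set"
  assumes "finite A" "x \<in> A"
  shows "sorted_list_of_set A ! card {y\<in>A. y < x} = x"
proof -
  obtain j where j: "j < card A" "x = sorted_list_of_set A ! j"
    using assms by (metis in_set_conv_nth length_sorted_list_of_set set_sorted_list_of_set)
  show ?thesis using sorted_list_nth(2)[OF assms(1) j(1)] j by simp
qed

lemma rank_less_card: "finite A \<Longrightarrow> (x::nat) \<in> A \<Longrightarrow> card {y\<in>A. y <
  x} < card A"
  by (intro psubset_card_mono) auto

lemma sorted_list_nth_image:
  fixes A :: "nat set" and f :: "nat \<Rightarrow> nat"
  assumes "finite A" "strict_mono_on A f" "i < card A"
  shows "sorted_list_of_set (f ` A) ! i = f (sorted_list_of_set A ! i)"
proof -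
  let ?x = "sorted_list_of_set A ! i"
  note x = sorted_list_nth[OF assms(1,3)]
  have inj: "inj_on f A" using assms(2) by (rule strict_mono_on_imp_inj_on)
  have "{y\<in>f ` A. y < f ?x} = f ` {y\<in>A. y < ?x}"
    using x(1) strict_mono_on_less[OF assms(2)] by auto
  then have "card {y\<in>f ` A. y < f ?x} = i"
    using x(2) inj by (simp add: card_image inj_on_subset)
  then show ?thesis
    using sorted_list_nth_rank[of "f ` A" "f ?x"] assms(1) x(1) by simp
qed

section \<open>The cost of a permutation in basic moves\<close>

definition relabel :: "(nat \<Rightarrow> nat) \<Rightarrow> 'c graph \<Rightarrow> 'c graph" where
  "relabel p G = (\<lambda>e. G (p ` e))"

lemma relabel_comp: "relabel q (relabel p G) = relabel (p \<circ> q) G"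
  by (simp add: relabel_def image_comp)

lemma relabel_id [simp]: "relabel id G = G"
  by (simp add: relabel_def)

definition inversions :: "nat \<Rightarrow> (nat \<Rightarrow> nat) \<Rightarrow> (nat \<times> nat) set"
  where
  "inversions n p = {(u, v). u \<in> {1..n} \<and> v \<in> {1..n} \<and> u < v \<and> p v < p u}"

lemma finite_inversions [simp]: "finite (inversions n p)"
  by (rule finite_subset[of _ "{1..n} \<times> {1..n}"]) (auto simp: inversions_def)

lemma no_descent_imp_id:
  fixes p :: "nat \<Rightarrow> nat"
  assumes p: "p permutes {1..n}" and "\<And>x. x \<in> {1..<n} \<Longrightarrow> p x < p (x + 1)"
  shows "p = id"
proof (rule permutes_natset_ge[OF p])
  have "x \<in> {1..n} \<Longrightarrow> x \<le> p x" for x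
  proof (induction x)
    case (Suc x)
    show ?case
    proof (cases "x = 0")
      case True
      then show ?thesis using permutes_in_image[OF p, of "Suc x"] Suc.prems by auto
    next
      case False
      then show ?thesis using Suc assms(2)[of x] by auto
    qed
  qed simp
  then show "\<forall>x\<in>{1..n}. x \<le> p x" by blast
qed

text \<open>Bubble sort: composing \<open>p\<close> with the transposition at a descent gives
  \<open>q\<close>, whose inversions embed into those of \<open>p\<close> other than the descent
  itself. So the inversion number pays for every move.\<close>

lemma relabel_moves:
  assumes "p permutes {1..n}"
  shows "\<exists>k \<le> card (inversions n p). (basic_move n ^^ k) G (relabel p G)"
  using assms
proof (induction "card (inversions n p)" arbitrary: p rule: less_induct)
  case less
  note p = less.prems
  show ?case
  proof (cases "\<forall>x\<in>{1..<n}. p x < p (x + 1)")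
    case True
    then have "p = id" using no_descent_imp_id[OF p] by blast
    then show ?thesis by (intro exI[of _ 0]) auto
  next
    case False
    then obtain x where x: "x \<in> {1..<n}" "\<not> p x < p (x + 1)" by blast
    define s where "s = Transposition.transpose x (x + 1)"
    have s: "s permutes {1..n}" using x by (auto simp: s_def intro: permutes_swap_id)
    have ss: "s \<circ> s = id" by (simp add: s_def)
    have sss: "s (s y) = y" for y using ss by (metis comp_apply id_apply)
    have desc: "p (x + 1) < p x"
      using x(2) permutes_inj[OF p] by (metis add_eq_self_zero inj_eq linorder_neqE_nat zero_neq_one)
    define q where "q = p \<circ> s"
    have q: "q permutes {1..n}" using p s by (auto simp: q_def intro: permutes_compose)
    let ?I = "inversions n p - {(x, x + 1)}"
    have "map_prod s s ` inversions n q \<subseteq> ?I"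
    proof
      fix z assume "z \<in> map_prod s s ` inversions n q"
      then obtain a b where ab: "z = (s a, s b)" "a \<in> {1..n}" "b \<in> {1..n}" "a < b" "p (s b) < p (s a)"
        by (auto simp: inversions_def q_def)
      have ne: "(a, b) \<noteq> (x, x + 1)" using ab(5) desc by (auto simp: s_def)
      \<comment> \<open>An adjacent swap reverses the order of no pair except
        \<open>(x, x + 1)\<close>.\<close>
      have "s a < s b" using ab(4) ne unfolding s_def Transposition.transpose_def by (auto split: if_splits)
      moreover have "s a \<in> {1..n}" "s b \<in> {1..n}" using ab permutes_in_image[OF s] by auto
      moreover have "(s a, s b) \<noteq> (x, x + 1)"
        using ab(4) by (auto simp: s_def Transposition.transpose_def split: if_splits)
      ultimately show "z \<in> ?I" using ab by (auto simp: inversions_def)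
    qed
    moreover have "inj s" using s by (rule permutes_inj)
    then have "card (map_prod s s ` inversions n q) = card (inversions n q)"
      by (intro card_image inj_on_subset[OF prod.inj_map]) auto
    ultimately have "card (inversions n q) \<le> card ?I"
      by (metis card_mono finite_Diff finite_inversions)
    moreover have "(x, x + 1) \<in> inversions n p" using x desc by (auto simp: inversions_def)
    ultimately have lt: "card (inversions n q) < card (inversions n p)"
      by (metis card_Diff1_less finite_inversions le_less_trans)
    from less.hyps[OF lt q] obtain k where
      k: "k \<le> card (inversions n q)" "(basic_move n ^^ k) G (relabel q G)" by blast
    have "basic_move n (relabel q G) (relabel p G)"
      unfolding basic_move_def
    proof (intro bexI[of _ x])
      have "p = q \<circ> s" by (simp add: q_def comp_assoc ss)
      then show "relabel p G = (\<lambda>e. relabel q G (Transposition.transpose x (x + 1) ` e))"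
        by (simp add: relabel_def image_comp s_def)
    qed (use x in auto)
    then have "(basic_move n ^^ Suc k) G (relabel p G)" using k(2) by auto
    then show ?thesis using k(1) lt by (intro exI[of _ "Suc k"]) auto
  qed
qed

lemma earthmover_dist_relabel:
  assumes "p permutes {1..n}" "n \<ge> 2"
  shows "earthmover_dist n G (relabel p G) \<le> ereal (card (inversions n p) / (n choose 2))"
proof -
  obtain k where k: "k \<le> card (inversions n p)" "(basic_move n ^^ k) G (relabel p G)"
    using relabel_moves[OF assms(1)] by blast
  have "min_moves n G (relabel p G) \<le> enat k"
    unfolding min_moves_def using k(2) by (intro INF_lower) auto
  also have "\<dots> \<le> enat (card (inversions n p))" using k by simp
  finally have "ereal_of_enat (min_moves n G (relabel p G)) \<le> ereal_of_enat (enat (card (inversions n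
    p)))"
    by (simp only: ereal_of_enat_le_iff)
  moreover have "(n choose 2) > 0" using assms(2) by simp
  ultimately have "earthmover_dist n G (relabel p G) \<le> ereal_of_enat (enat (card (inversions n p))) /
    ereal (n choose 2)"
    unfolding earthmover_dist_def by (intro ereal_divide_right_mono) auto
  then show ?thesis using \<open>(n choose 2) > 0\<close> by simp
qed

definition displaced :: "nat \<Rightarrow> nat \<Rightarrow> (nat \<Rightarrow> nat) \<Rightarrow> nat
  set" where
  "displaced n d p = {u\<in>{1..n}. u + d < p u \<or> p u + d < u}"

lemma finite_displaced [simp]: "finite (displaced n d p)"
  by (simp add: displaced_def)

text \<open>If neither end of an inversion \<open>(u, v)\<close> is displaced, then
  \<open>v - d \<le> p v < p u \<le> u + d\<close>, which leaves at most \<open>2 * d\<close>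
  choices of \<open>v\<close> for each \<open>u\<close>.\<close>

lemma card_inversions_le: "card (inversions n p) \<le> 2 * n * card (displaced n d p) + 2 * d * n"
proof -
  let ?B = "displaced n d p"
  have "inversions n p \<subseteq> (?B \<times> {1..n}) \<union> ({1..n} \<times> ?B) \<union> (SIGMA
    u:{1..n}. {u<..<u + 2 * d + 1})"
    by (auto simp: inversions_def displaced_def)
  then have "card (inversions n p) \<le> card ((?B \<times> {1..n}) \<union> ({1..n} \<times> ?B)
    \<union> (SIGMA u:{1..n}. {u<..<u + 2 * d + 1}))"
    by (intro card_mono) auto
  also have "\<dots> \<le> card (?B \<times> {1..n}) + card ({1..n} \<times> ?B) + card (SIGMA u:{1..n}.
    {u<..<u + 2 * d + 1})"
    by (meson add_mono card_Un_le order.trans order_refl)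
  also have "\<dots> = 2 * n * card ?B + 2 * d * n"
    by (simp add: card_cartesian_product)
  finally show ?thesis .
qed

text \<open>\<open>p\<close> carries its own displaced vertices onto those of \<open>inv p\<close>.
  This makes the way back from a relabeled graph as cheap as the way there.\<close>

lemma card_displaced_inv:
  assumes p: "p permutes {1..n}"
  shows "card (displaced n d (inv p)) = card (displaced n d p)"
proof -
  have "displaced n d (inv p) = p ` displaced n d p"
  proof (intro set_eqI iffI)
    fix x assume "x \<in> displaced n d (inv p)"
    then have "inv p x \<in> displaced n d p" "x = p (inv p x)"
      using permutes_in_image[OF permutes_inv[OF p], of x] permutes_inverses[OF p]
      by (auto simp: displaced_def)
    then show "x \<in> p ` displaced n d p" by blast
  next
    fix x assume "x \<in> p ` displaced n d p"
    then show "x \<in> displaced n d (inv p)"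
      using permutes_in_image[OF p] permutes_inverses[OF p] by (auto simp: displaced_def)
  qed
  then show ?thesis by (simp add: card_image permutes_inj_on[OF p])
qed

lemma extend_to_permutation:
  assumes "finite X" "inj_on f A" "A \<subseteq> X" "f ` A \<subseteq> X"
  obtains p where "p permutes X" "\<And>a. a \<in> A \<Longrightarrow> p a = f a"
proof -
  have "card (X - A) = card (X - f ` A)"
    using assms by (simp add: card_Diff_subset finite_subset card_image)
  then obtain g where g: "bij_betw g (X - A) (X - f ` A)"
    using assms(1) finite_same_card_bij by (metis finite_Diff)
  define p where "p = (\<lambda>x. if x \<in> A then f x else if x \<in> X then g x else x)"
  have "bij_betw p (A \<union> (X - A)) (f ` A \<union> (X - f ` A))"
  proof (rule bij_betw_combine)
    have "bij_betw f A (f ` A)" using assms by (simp add: bij_betw_def)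
    then show "bij_betw p A (f ` A)" by (rule bij_betw_cong[THEN iffD1, rotated]) (auto simp: p_def)
    show "bij_betw p (X - A) (X - f ` A)"
      using g by (rule bij_betw_cong[THEN iffD1, rotated]) (auto simp: p_def)
  qed auto
  moreover have "A \<union> (X - A) = X" "f ` A \<union> (X - f ` A) = X" using assms by auto
  ultimately have "bij_betw p X X" by simp
  then have "p permutes X" using assms by (intro bij_imp_permutes) (auto simp: p_def)
  then show ?thesis by (rule that) (auto simp: p_def)
qed

text \<open>For images \<open>M\<close> is the number of rows, so these vertices move between rows
  and columns. For plain graphs \<open>M = n\<close> makes the set empty.\<close>

definition crossing :: "nat \<Rightarrow> nat \<Rightarrow> (nat \<Rightarrow> nat) \<Rightarrow> nat
  set" where
  "crossing n M p = {u\<in>{1..n}. (p u \<le> M) \<noteq> (u \<le> M)}"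

lemma finite_crossing [simp]: "finite (crossing n M p)"
  by (simp add: crossing_def)

text \<open>A crossing vertex that moves by at most \<open>d\<close> lies within \<open>d\<close> of
  the threshold, on one of its two sides.\<close>

lemma card_crossing_le: "card (crossing n M p) \<le> card (displaced n d p) + 2 * d"
proof -
  have "crossing n M p \<subseteq> displaced n d p \<union> ({M<..M + d} \<union> {M - d<..M})"
    by (auto simp: crossing_def displaced_def)
  then have "card (crossing n M p) \<le> card (displaced n d p \<union> ({M<..M + d} \<union> {M - d<..M}))"
    by (intro card_mono) auto
  also have "\<dots> \<le> card (displaced n d p) + (card {M<..M + d} + card {M - d<..M})"
    by (meson add_mono card_Un_le order.trans order_refl)
  finally show ?thesis by simp
qed

text \<open>On each side of \<open>M\<close>, the restriction of \<open>p\<close> to the vertices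
  that stay on that side is injective and extends to a permutation of the side. The two extensions
  act on disjoint sets and are composed.\<close>

lemma uncross_permutation:
  assumes p: "p permutes {1..n}"
  obtains p' where "p' permutes {1..n}" "\<And>u. u \<in> {1..n} \<Longrightarrow> p' u \<le> M
    \<longleftrightarrow> u \<le> M"
    "\<And>u. u \<in> {1..n} - crossing n M p \<Longrightarrow> p' u = p u"
proof -
  let ?L = "{u\<in>{1..n}. u \<le> M}" and ?H = "{u\<in>{1..n}. \<not> u \<le> M}"
  have in_n: "p u \<in> {1..n} \<longleftrightarrow> u \<in> {1..n}" for u by (rule permutes_in_image[OF p])
  obtain q where q: "q permutes ?L" "\<And>u. u \<in> {u\<in>?L. p u \<le> M} \<Longrightarrow> q u = p u"
    by (rule extend_to_permutation[of ?L p "{u\<in>?L. p u \<le> M}"])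
       (use in_n permutes_inj_on[OF p] in \<open>auto simp del: atLeastAtMost_iff\<close>)
  obtain r where r: "r permutes ?H" "\<And>u. u \<in> {u\<in>?H. \<not> p u \<le> M} \<Longrightarrow> r
    u = p u"
    by (rule extend_to_permutation[of ?H p "{u\<in>?H. \<not> p u \<le> M}"])
       (use in_n permutes_inj_on[OF p] in \<open>auto simp del: atLeastAtMost_iff\<close>)
  have "q permutes {1..n}" "r permutes {1..n}"
    by (auto intro: permutes_subset[OF q(1)] permutes_subset[OF r(1)])
  then have "q \<circ> r permutes {1..n}" by (intro permutes_compose)
  have low: "(q \<circ> r) u = q u \<and> q u \<le> M" if "u \<in> ?L" for u
    using that permutes_not_in[OF r(1), of u] permutes_in_image[OF q(1), of u] by auto
  have high: "(q \<circ> r) u = r u \<and> \<not> r u \<le> M" if "u \<in> ?H" for u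
  proof -
    have "r u \<in> ?H" using that permutes_in_image[OF r(1), of u] by simp
    then show ?thesis using permutes_not_in[OF q(1), of "r u"] by auto
  qed
  show ?thesis
  proof (rule that[OF \<open>q \<circ> r permutes {1..n}\<close>])
    fix u assume u: "u \<in> {1..n}"
    then show "(q \<circ> r) u \<le> M \<longleftrightarrow> u \<le> M" using low[of u] high[of u]
      by (cases "u \<le> M") auto
  next
    fix u assume u: "u \<in> {1..n} - crossing n M p"
    then show "(q \<circ> r) u = p u"
      using low[of u] high[of u] q(2)[of u] r(2)[of u] by (cases "u \<le> M") (auto simp: crossing_def)
  qed
qed


section \<open>Sorting a random permutation within residue classes\<close>

lemma card_residue_class:
  fixes m a N :: nat
  assumes "a < m"
  defines "c \<equiv> card {v\<in>{1..N}. v mod m = a}"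
  shows "real c \<le> real N / m + 1" "real N / m \<le> real c + 1"
proof -
  let ?C = "{v\<in>{1..N}. v mod m = a}"
  have m: "m > 0" using assms by simp
  have *: "real (N div m) \<le> real N / m" "real N / m \<le> real (N div m) + 1"
    using floor_divide_of_nat_eq[of N m, where 'a = real] by linarith+
  have "inj_on (\<lambda>v. v div m) ?C"
  proof (rule inj_onI)
    fix x y assume "x \<in> ?C" "y \<in> ?C" "x div m = y div m"
    then have "x div m * m + x mod m = y div m * m + y mod m" by simp
    then show "x = y" by simp
  qed
  moreover have "(\<lambda>v. v div m) ` ?C \<subseteq> {..N div m}" by (auto intro: div_le_mono)
  ultimately have "c \<le> card {..N div m}" unfolding c_def by (intro card_inj_on_le) auto
  then show "real c \<le> real N / m + 1" using * by simp
  \<comment> \<open>The least positive member of the residue class: vertices start at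
    \<open>1\<close>, so residue \<open>0\<close> is represented by \<open>m\<close>.\<close>
  let ?b = "if a = 0 then m else a"
  have b: "?b mod m = a" "1 \<le> ?b" "?b \<le> m" using assms by auto
  have "(\<lambda>i. i * m + ?b) ` {..<N div m} \<subseteq> ?C"
  proof
    fix v assume "v \<in> (\<lambda>i. i * m + ?b) ` {..<N div m}"
    then obtain i where i: "i < N div m" "v = i * m + ?b" by blast
    have "v \<le> (i + 1) * m" using i b by simp
    also have "\<dots> \<le> (N div m) * m" using i by (intro mult_le_mono1) simp
    also have "\<dots> \<le> N" by simp
    finally show "v \<in> ?C" using i b by (auto simp del: One_nat_def)
  qed
  moreover have "inj_on (\<lambda>i. i * m + ?b) {..<N div m}" using m by (auto simp: inj_on_def)
  ultimately have "card {..<N div m} \<le> c" unfolding c_def by (intro card_inj_on_le) auto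
  then show "real N / m \<le> real c + 1" using * by simp
qed

section \<open>Uniformly random permutations, handled as sums over \<open>perms n\<close>\<close>

definition perms :: "nat \<Rightarrow> (nat \<Rightarrow> nat) set" where
  "perms n = {p. p permutes {1..n}}"

lemma mem_perms [simp]: "p \<in> perms n \<longleftrightarrow> p permutes {1..n}"
  by (simp add: perms_def)

lemma finite_perms [simp]: "finite (perms n)"
  unfolding perms_def by (rule finite_permutations) simp

lemma card_perms: "card (perms n) = fact n"
  unfolding perms_def by (rule card_permutations) auto

lemma perms_nonempty [simp]: "perms n \<noteq> {}"
proof -
  have "id \<in> perms n" by (simp add: permutes_id)
  then show ?thesis by blast
qed

lemma sum_perms_compose_right:
  assumes "q permutes {1..n}"
  shows "(\<Sum>p\<in>perms n. f (p \<circ> q)) = (\<Sum>p\<in>perms n. f p)"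
proof (rule sum.reindex_bij_witness[of _ "\<lambda>p. p \<circ> inv q" "\<lambda>p. p \<circ> q"])
  note q' = permutes_inv[OF assms]
  fix p assume p: "p \<in> perms n"
  show "p \<circ> q \<circ> inv q = p" "p \<circ> inv q \<circ> q = p"
    by (simp_all add: comp_assoc permutes_inv_o[OF assms])
  show "p \<circ> q \<in> perms n" "p \<circ> inv q \<in> perms n"
    using p assms q' by (auto intro: permutes_compose)
qed simp

text \<open>
  The indicators of \<open>p c \<in> X\<close> have a constant sum over all \<open>c\<close> and are
    exchangeable,
  hence negatively correlated: the variance of a partial sum is at most the sum of the variances.
\<close>

lemma second_moment_hits:
  assumes "C \<subseteq> {1..n}" "X \<subseteq> {1..n}"
  shows "(\<Sum>p\<in>perms n. (real (card {c\<in>C. p c \<in> X}) - real (card C) * real (card X) / real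
    n)\<^sup>2)
    \<le> real (card C) * fact n"
proof (cases "n = 0")
  case True
  then show ?thesis using assms by simp
next
  case False
  define x where "x = real (card X) / real n"
  have x: "0 \<le> x" "x \<le> 1"
    using False card_mono[OF _ assms(2)] by (auto simp: x_def)
  define Y where "Y p c = (if p c \<in> X then 1 else 0) - x" for p :: "nat \<Rightarrow> nat" and c
  define e where "e c c' = (\<Sum>p\<in>perms n. Y p c * Y p c')" for c c'
  have finC: "finite C" using assms(1) finite_subset by blast
  have sumY: "(\<Sum>c\<in>D. Y p c) = real (card {c\<in>D. p c \<in> X}) - real (card D) * x"
    if "finite D" for p D
  proof -
    have "(\<Sum>c\<in>D. if p c \<in> X then 1 else 0 :: real) = real (card {c\<in>D. p c \<in> X})"
      using that by (simp add: sum.If_cases Int_def)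
    then show ?thesis by (simp add: Y_def sum_subtractf)
  qed
  have sum0: "(\<Sum>c\<in>{1..n}. Y p c) = 0" if "p \<in> perms n" for p
  proof -
    have p: "p permutes {1..n}" using that by simp
    have "p ` {c\<in>{1..n}. p c \<in> X} = p ` {1..n} \<inter> X" by blast
    also have "\<dots> = X" using assms(2) by (simp only: permutes_image[OF p] Int_absorb1)
    finally have "p ` {c\<in>{1..n}. p c \<in> X} = X" .
    then have "card {c\<in>{1..n}. p c \<in> X} = card X"
      using card_image[OF permutes_inj_on[OF p], of "{c\<in>{1..n}. p c \<in> X}"] by simp
    then show ?thesis using sumY[of "{1..n}" p] False by (simp add: x_def)
  qed
  have exch: "e c c' = e c d'" if "c \<in> {1..n}" "c' \<in> {1..n}" "d' \<in> {1..n}" "c' \<noteq> c"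
    "d' \<noteq> c" for c c' d'
  proof -
    let ?q = "Transposition.transpose c' d'"
    have "e c c' = (\<Sum>p\<in>perms n. Y (p \<circ> ?q) c * Y (p \<circ> ?q) d')"
      unfolding e_def using that by (intro sum.cong) (auto simp: Y_def transpose_apply_other)
    also have "\<dots> = e c d'"
      unfolding e_def using that by (intro sum_perms_compose_right permutes_swap_id) auto
    finally show ?thesis .
  qed
  \<comment> \<open>Multiplying the zero total by \<open>Y p c\<close> and summing gives
    \<open>e c c + (n - 1) * e c c' = 0\<close>, since all off-diagonal terms agree by
    \<open>exch\<close>.\<close>
  have neg: "e c c' \<le> 0" if c: "c \<in> {1..n}" "c' \<in> {1..n}" "c' \<noteq> c" for c c'
  proof -
    have "0 = (\<Sum>p\<in>perms n. Y p c * (\<Sum>d\<in>{1..n}. Y p d))" using sum0 by simp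
    also have "\<dots> = (\<Sum>d\<in>{1..n}. e c d)"
      unfolding e_def sum_distrib_left by (rule sum.swap)
    also have "\<dots> = e c c + (\<Sum>d\<in>{1..n} - {c}. e c d)"
      using c by (intro sum.remove) auto
    also have "(\<Sum>d\<in>{1..n} - {c}. e c d) = (\<Sum>d\<in>{1..n} - {c}. e c c')"
      using c by (intro sum.cong exch) auto
    also have "\<dots> = real (card ({1..n} - {c})) * e c c'" by simp
    finally have "real (card ({1..n} - {c})) * e c c' = - e c c" by simp
    moreover have "e c c \<ge> 0" unfolding e_def by (intro sum_nonneg) simp
    moreover have "card ({1..n} - {c}) > 0" using c by (auto simp: card_gt_0_iff)
    ultimately show ?thesis
      by (metis mult_pos_pos neg_le_0_iff_le not_less of_nat_0_less_iff)
  qed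
  have diag: "e c c \<le> fact n" for c
  proof -
    have "Y p c * Y p c \<le> 1" for p
    proof -
      have "\<bar>Y p c\<bar> \<le> 1" using x by (auto simp: Y_def)
      then show ?thesis by (metis abs_le_square_iff abs_one one_power2 power2_eq_square)
    qed
    then have "e c c \<le> (\<Sum>p\<in>perms n. 1)" unfolding e_def by (intro sum_mono)
    then show ?thesis by (simp add: card_perms)
  qed
  have "(\<Sum>p\<in>perms n. (real (card {c\<in>C. p c \<in> X}) - real (card C) * real (card X) / real
    n)\<^sup>2)
      = (\<Sum>p\<in>perms n. (\<Sum>c\<in>C. Y p c) * (\<Sum>c\<in>C. Y p c))"
    using sumY[OF finC] by (simp add: x_def power2_eq_square)
  also have "\<dots> = (\<Sum>p\<in>perms n. \<Sum>c\<in>C. \<Sum>c'\<in>C. Y p c * Y p c')"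
    by (simp add: sum_product)
  also have "\<dots> = (\<Sum>c\<in>C. \<Sum>c'\<in>C. e c c')"
    unfolding e_def by (subst sum.swap, rule sum.cong, simp, rule sum.swap)
  also have "\<dots> \<le> (\<Sum>c\<in>C. \<Sum>c'\<in>C. if c' = c then fact n else 0)"
  proof (intro sum_mono)
    fix c c' assume "c \<in> C" "c' \<in> C"
    then show "e c c' \<le> (if c' = c then fact n else 0)"
      using diag neg[of c c'] subsetD[OF assms(1)] by (cases "c' = c") auto
  qed
  also have "\<dots> = real (card C) * fact n"
    using finC by simp
  finally show ?thesis .
qed

section \<open>Sorting within residue classes\<close>

definition residue_class :: "nat \<Rightarrow> nat \<Rightarrow> nat \<Rightarrow> nat set" where
  "residue_class n m u = {v\<in>{1..n}. v mod m = u mod m}"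

text \<open>The rearrangement of \<open>p\<close> that increases along each residue class:
  \<open>u\<close> receives the value whose rank in the image of its class equals the rank of
  \<open>u\<close> in the class. Of \<open>p\<close> only the image set of the class enters.\<close>

definition sort_residues :: "nat \<Rightarrow> nat \<Rightarrow> (nat \<Rightarrow> nat) \<Rightarrow>
  nat \<Rightarrow> nat" where
  "sort_residues n m p u = (if u \<in> {1..n}
     then sorted_list_of_set (p ` residue_class n m u) ! card {v\<in>residue_class n m u. v < u}
     else u)"

lemma finite_residue_class [simp]: "finite (residue_class n m u)"
  by (simp add: residue_class_def)

lemma residue_class_self: "u \<in> {1..n} \<Longrightarrow> u \<in> residue_class n m u"
  by (simp add: residue_class_def)

lemma residue_class_eq: "v \<in> residue_class n m u \<Longrightarrow> residue_class n m v =
  residue_class n m u"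
  by (simp add: residue_class_def)

lemma sort_residues_rank:
  assumes p: "inj p" and u: "u \<in> {1..n}"
  shows "sort_residues n m p u \<in> p ` residue_class n m u"
    "card {y\<in>p ` residue_class n m u. y < sort_residues n m p u} = card {v\<in>residue_class n m u. v
      < u}"
proof -
  have "card {v\<in>residue_class n m u. v < u} < card (p ` residue_class n m u)"
    using rank_less_card[OF _ residue_class_self[OF u]] card_image[OF inj_on_subset[OF p subset_UNIV]] by simp
  note * = sorted_list_nth[OF _ this]
  show "sort_residues n m p u \<in> p ` residue_class n m u"
    "card {y\<in>p ` residue_class n m u. y < sort_residues n m p u} = card {v\<in>residue_class n m u. v
      < u}"
    using u * by (simp_all add: sort_residues_def)
qed

text \<open>Different classes have disjoint images, and within a class the rank determines the
  vertex.\<close>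

lemma sort_residues_permutes:
  assumes p: "p permutes {1..n}"
  shows "sort_residues n m p permutes {1..n}"
proof (rule bij_imp_permutes)
  let ?s = "sort_residues n m p"
  note r = sort_residues_rank[OF permutes_inj[OF p]]
  have sub: "?s ` {1..n} \<subseteq> {1..n}"
  proof
    fix x assume "x \<in> ?s ` {1..n}"
    then obtain u where "u \<in> {1..n}" "x = ?s u" by blast
    then obtain v where "x = p v" "v \<in> {1..n}" using r(1)[of u] by (auto simp: residue_class_def)
    then show "x \<in> {1..n}" using permutes_in_image[OF p] by simp
  qed
  have "inj_on ?s {1..n}"
  proof (rule inj_onI)
    fix u v assume uv: "u \<in> {1..n}" "v \<in> {1..n}" "?s u = ?s v"
    have "residue_class n m u \<inter> residue_class n m v \<noteq> {}"
      using r(1)[OF uv(1), of m] r(1)[OF uv(2), of m] uv(3) permutes_inj[OF p]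
      by (metis (no_types, opaque_lifting) disjoint_iff_not_equal imageE injD)
    then have eq: "residue_class n m v = residue_class n m u"
      using residue_class_eq by blast
    have "card {w\<in>residue_class n m u. w < u} = card {w\<in>residue_class n m u. w < v}"
      using r(2)[OF uv(1), of m] r(2)[OF uv(2), of m] uv(3) eq by simp
    then show "u = v"
      using sorted_list_nth_rank[of "residue_class n m u"] residue_class_self[OF uv(1)]
        residue_class_self[OF uv(2)] eq finite_residue_class by metis
  qed
  then show "bij_betw ?s {1..n} {1..n}"
    using sub by (simp add: bij_betw_def endo_inj_surj)
qed (simp only: sort_residues_def if_False)

text \<open>Sorting depends on order alone, so it commutes with maps that are increasing on the
  image of the class. With \<open>k\<close> the enumeration of a sampled set, this lets a test that
  sees only ranks carry out the sorting.\<close>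

lemma sort_residues_compose:
  assumes "inj p" "u \<in> {1..n}" "strict_mono_on (p ` residue_class n m u) k"
  shows "sort_residues n m (k \<circ> p) u = k (sort_residues n m p u)"
proof -
  have "card {v\<in>residue_class n m u. v < u} < card (p ` residue_class n m u)"
    using rank_less_card[OF _ residue_class_self[OF assms(2)]]
      card_image[OF inj_on_subset[OF assms(1) subset_UNIV]] by simp
  then show ?thesis
    using sorted_list_nth_image[OF _ assms(3)] assms(2)
    unfolding sort_residues_def image_comp[symmetric] by simp
qed

text \<open>Chebyshev's inequality in counting form. If \<open>u\<close> lands too high, an initial
  segment contains too few images of its class; if it lands too low, too many. The \<open>2\<close>
  in the bound on \<open>D\<close> absorbs two roundings, one in the rank of \<open>u\<close> and
  one in the expected number of hits.\<close>

lemma card_sort_residues_displaced: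
  assumes n: "n > 0" and m: "0 < m" "m \<le> n" and u: "u \<in> {1..n}"
    and D: "0 < D" "D \<le> (real d + 1) / m - 2"
  shows "real (card {p\<in>perms n. u \<in> displaced n d (sort_residues n m p)})
    \<le> 2 * (real n / m + 1) / D\<^sup>2 * fact n"
proof -
  define C where "C = residue_class n m u"
  have C: "C \<subseteq> {1..n}" by (auto simp: C_def residue_class_def)
  have finC: "finite C" by (simp add: C_def)
  define r where "r = card {v\<in>C. v < u}"
  have um: "u mod m < m" using m by simp
  have c: "real (card C) \<le> real n / m + 1" "real n / m \<le> real (card C) + 1"
    using card_residue_class[OF um, of n] by (simp_all add: C_def residue_class_def)
  have "{v\<in>C. v < u} = {v\<in>{1..u - 1}. v mod m = u mod m}"
    using u by (auto simp: C_def residue_class_def)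
  then have r: "real r \<le> (real u - 1) / m + 1" "(real u - 1) / m \<le> real r + 1"
    using card_residue_class[OF um, of "u - 1"] u by (auto simp: r_def of_nat_diff)
  define hit where "hit p X = real (card {c\<in>C. p c \<in> X})" for p :: "nat \<Rightarrow> nat" and X
  have cheb: "real (card {p\<in>perms n. Q p}) \<le> (real n / m + 1) / D\<^sup>2 * fact n"
    if X: "X \<subseteq> {1..n}" and
      Q: "\<And>p. p \<in> perms n \<Longrightarrow> Q p \<Longrightarrow> D \<le> \<bar>hit p X - real
        (card C) * real (card X) / n\<bar>" for X Q
  proof -
    have "real (card {p\<in>perms n. Q p}) * D\<^sup>2 = (\<Sum>p\<in>{p\<in>perms n. Q p}. D\<^sup>2)"
      by simp
    also have "\<dots> \<le> (\<Sum>p\<in>{p\<in>perms n. Q p}. (hit p X - real (card C) * real (card X)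
      / n)\<^sup>2)"
    proof (rule sum_mono)
      fix p assume "p \<in> {p\<in>perms n. Q p}"
      then have "D \<le> \<bar>hit p X - real (card C) * real (card X) / n\<bar>" using Q by blast
      then have "D\<^sup>2 \<le> \<bar>hit p X - real (card C) * real (card X) / n\<bar>\<^sup>2"
        using D(1) by (intro power_mono) auto
      then show "D\<^sup>2 \<le> (hit p X - real (card C) * real (card X) / n)\<^sup>2" by simp
    qed
    also have "\<dots> \<le> (\<Sum>p\<in>perms n. (hit p X - real (card C) * real (card X) / n)\<^sup>2)"
      by (intro sum_mono2) auto
    also have "\<dots> \<le> real (card C) * fact n"
      unfolding hit_def by (rule second_moment_hits[OF C X])
    also have "\<dots> \<le> (real n / m + 1) * fact n" using c by (intro mult_right_mono) auto
    finally show ?thesis using D(1) by (simp add: field_simps)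
  qed
  let ?s = "sort_residues n m"
  have rank: "?s p u \<in> p ` C" "card {y\<in>p ` C. y < ?s p u} = r" if "p \<in> perms n" for p
    using sort_residues_rank[OF permutes_inj u, of p "{1..n}" m] that by (auto simp: C_def r_def)
  have hit_eq: "hit p X = card (p ` C \<inter> X)" if "p \<in> perms n" for p X
  proof -
    have "p ` {c\<in>C. p c \<in> X} = p ` C \<inter> X" by auto
    then show ?thesis
      using card_image[OF permutes_inj_on, of p "{1..n}" "{c\<in>C. p c \<in> X}"] that by (simp add: hit_def)
  qed
  \<comment> \<open>\<open>card C / n\<close> differs from \<open>1 / m\<close> by at most
    \<open>1 / n\<close>, so the expected number of hits in a segment of \<open>y\<close> vertices
    is \<open>y / m\<close> up to \<open>1\<close>.\<close>
  have frac: "real (card C) * y / n \<ge> y / m - 1" "real (card C) * y / n \<le> y / m + 1"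
    if y: "0 \<le> y" "y \<le> real n" for y
  proof -
    have yn: "0 \<le> y / n" "y / n \<le> 1" using y n by auto
    have "y / m - 1 \<le> y / m - y / n" using yn by simp
    also have "\<dots> = (real n / m - 1) * (y / n)" using n m by (simp add: field_simps)
    also have "\<dots> \<le> real (card C) * (y / n)" using c yn by (intro mult_right_mono) auto
    finally show "real (card C) * y / n \<ge> y / m - 1" by simp
    have "real (card C) * (y / n) \<le> (real n / m + 1) * (y / n)" using c yn by (intro mult_right_mono) auto
    also have "\<dots> = y / m + y / n" using n m by (simp add: field_simps)
    also have "\<dots> \<le> y / m + 1" using yn by simp
    finally show "real (card C) * y / n \<le> y / m + 1" by simp
  qed
  \<comment> \<open>Images of the class inside \<open>{1..u + d}\<close> all lie below the value at
    \<open>u\<close>, so there are at most \<open>r\<close> of them, where about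
    \<open>(u + d) / m\<close> are expected.\<close>
  have up: "real (card {p\<in>perms n. u + d < ?s p u}) \<le> (real n / m + 1) / D\<^sup>2 * fact n"
  proof (cases "u + d \<le> n")
    case False
    have "\<not> u + d < ?s p u" if "p \<in> perms n" for p
    proof -
      have "?s p u \<in> {1..n}"
        using permutes_in_image[OF sort_residues_permutes, of p n m u] that u by simp
      then show ?thesis using False by simp
    qed
    then have "{p\<in>perms n. u + d < ?s p u} = {}" by blast
    then show ?thesis by (simp only: card.empty) (simp add: divide_nonneg_nonneg)
  next
    case True
    show ?thesis
    proof (rule cheb[of "{1..u + d}"])
      fix p assume p: "p \<in> perms n" "u + d < ?s p u"
      have "p ` C \<inter> {1..u + d} \<subseteq> {y\<in>p ` C. y < ?s p u}" using p(2) by auto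
      then have "card (p ` C \<inter> {1..u + d}) \<le> r"
        unfolding rank(2)[OF p(1), symmetric] using finC by (intro card_mono) auto
      then have 1: "hit p {1..u + d} \<le> (real u - 1) / m + 1" using hit_eq[OF p(1)] r by simp
      have 2: "real (u + d) / m - 1 \<le> real (card C) * real (u + d) / n"
        using frac(1)[of "real (u + d)"] True by linarith
      have "(real u - 1) / m = real (u + d) / m - (real d + 1) / m"
        by (simp add: diff_divide_distrib add_divide_distrib)
      then have "D \<le> real (card C) * real (u + d) / n - hit p {1..u + d}" using 1 2 D(2) by linarith
      then show "D \<le> \<bar>hit p {1..u + d} - real (card C) * real (card {1..u + d}) / n\<bar>" by simp
    qed (use True in auto)
  qed
  have down: "real (card {p\<in>perms n. ?s p u + d < u}) \<le> (real n / m + 1) / D\<^sup>2 * fact n"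
  proof (rule cheb[of "{1..u - d - 1}"])
    fix p assume p: "p \<in> perms n" "?s p u + d < u"
    have "?s p u \<in> {1..n}"
      using permutes_in_image[OF sort_residues_permutes, of p n m u] p(1) u by simp
    then have s1: "1 \<le> ?s p u" by simp
    have "p ` C \<subseteq> p ` {1..n}" using C by (rule image_mono)
    then have s2: "p ` C \<subseteq> {1..n}" using permutes_image[of p "{1..n}"] p(1) by simp
    \<comment> \<open>The value at \<open>u\<close> is itself a hit. The count is therefore
      \<open>r + 1\<close>, which cancels the rounding in the lower bound on
      \<open>r\<close>.\<close>
    have "insert (?s p u) {y\<in>p ` C. y < ?s p u} \<subseteq> p ` C \<inter> {1..u - d - 1}"
    proof
      fix y assume y: "y \<in> insert (?s p u) {y\<in>p ` C. y < ?s p u}"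
      then have "y \<in> p ` C" "y \<le> ?s p u" using rank(1)[OF p(1)] by auto
      then show "y \<in> p ` C \<inter> {1..u - d - 1}" using s2 p(2) by auto
    qed
    then have "card (insert (?s p u) {y\<in>p ` C. y < ?s p u}) \<le> card (p ` C \<inter> {1..u - d - 1})"
      by (intro card_mono) auto
    then have "r + 1 \<le> card (p ` C \<inter> {1..u - d - 1})" using rank(2)[OF p(1)] finC by simp
    then have 1: "(real u - 1) / m \<le> hit p {1..u - d - 1}"
      using hit_eq[OF p(1), of "{1..u - d - 1}"] r by linarith
    have "real (card C) * real (u - d - 1) / n \<le> real (u - d - 1) / m + 1"
      using frac(2)[of "real (u - d - 1)"] u by auto
    also have "real (u - d - 1) / m = (real u - 1) / m - real d / m"
      using p(2) by (simp add: of_nat_diff diff_divide_distrib add_divide_distrib)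
    finally have 2: "real (card C) * real (u - d - 1) / n \<le> (real u - 1) / m - real d / m + 1" .
    have "(real d + 1) / m \<le> real d / m + 1" using m by (simp add: add_divide_distrib)
    then have "D \<le> hit p {1..u - d - 1} - real (card C) * real (u - d - 1) / n" using 1 2 D(2) by linarith
    then show "D \<le> \<bar>hit p {1..u - d - 1} - real (card C) * real (card {1..u - d - 1}) / n\<bar>"
      by simp
  qed (use u in auto)
  have "{p\<in>perms n. u \<in> displaced n d (?s p)} = {p\<in>perms n. u + d < ?s p u} \<union>
    {p\<in>perms n. ?s p u + d < u}"
    using u by (auto simp: displaced_def)
  then have "card {p\<in>perms n. u \<in> displaced n d (?s p)}
      \<le> card {p\<in>perms n. u + d < ?s p u} + card {p\<in>perms n. ?s p u + d < u}"
    by (simp only: card_Un_le)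
  then have "real (card {p\<in>perms n. u \<in> displaced n d (?s p)})
      \<le> (real n / m + 1) / D\<^sup>2 * fact n + (real n / m + 1) / D\<^sup>2 * fact n"
    using up down by linarith
  also have "\<dots> = 2 * (real n / m + 1) / D\<^sup>2 * fact n" by simp
  finally show ?thesis .
qed

text \<open>Markov's inequality for the number of displaced vertices, whose mean is bounded by
  adding the single-vertex estimates.\<close>

lemma card_bad_perms:
  assumes \<beta>: "0 < \<beta>" "\<beta> \<le> 1" and m: "0 < m" and k: "real n / m \<ge> 600 / \<beta> ^ 3"
  shows "real (card {p\<in>perms n. \<beta> * n < real (card (displaced n (nat \<lfloor>\<beta> *
    n\<rfloor>) (sort_residues n m p)))})
    \<le> 3 / 100 * fact n"
proof -
  let ?d = "nat \<lfloor>\<beta> * n\<rfloor>" and ?s = "sort_residues n m"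
  define k where "k = real n / m"
  have b3: "\<beta> ^ 3 \<le> \<beta>" "\<beta> ^ 3 > 0"
    using \<beta> power_decreasing[of 1 3 \<beta>] by auto
  have k3: "k * \<beta> ^ 3 \<ge> 600" using assms(4) b3 by (simp add: k_def[symmetric] divide_le_eq)
  have k0: "k \<ge> 0" by (simp add: k_def)
  have kb: "\<beta> * k \<ge> 600" using k3 mult_left_mono[OF b3(1) k0] by (simp add: mult.commute)
  have k1: "k \<ge> 600" using kb mult_right_mono[OF \<beta>(2) k0] by simp
  have n: "n > 0" "m \<le> n" using k1 m by (auto simp: k_def field_simps intro!: Nat.gr0I)
  \<comment> \<open>Half of \<open>\<beta> * k\<close>; the other half exceeds the rounding loss of
    \<open>2\<close>.\<close>
  define D where "D = \<beta> * k / 2"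
  have D0: "D > 0" using kb by (simp add: D_def)
  have "\<beta> * n \<le> real ?d + 1" using \<beta> by linarith
  then have "\<beta> * n / m \<le> (real ?d + 1) / m" by (intro divide_right_mono) auto
  then have D: "D \<le> (real ?d + 1) / m - 2" using kb by (simp add: D_def k_def)
  have "real (card {p\<in>perms n. \<beta> * n < real (card (displaced n ?d (?s p)))}) * (\<beta> * n)
      = (\<Sum>p\<in>{p\<in>perms n. \<beta> * n < real (card (displaced n ?d (?s p)))}. \<beta> * n)" by simp
  also have "\<dots> \<le> (\<Sum>p\<in>{p\<in>perms n. \<beta> * n < real (card (displaced n ?d (?s
    p)))}. real (card (displaced n ?d (?s p))))"
    by (intro sum_mono) auto
  also have "\<dots> \<le> (\<Sum>p\<in>perms n. real (card (displaced n ?d (?s p))))"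
    by (intro sum_mono2) auto
  also have "\<dots> = (\<Sum>p\<in>perms n. \<Sum>u\<in>{1..n}. if u \<in> displaced n ?d (?s p) then 1
    else 0)"
  proof (intro sum.cong refl)
    fix p
    have "displaced n ?d (?s p) \<subseteq> {1..n}" by (auto simp: displaced_def)
    then have "{u\<in>{1..n}. u \<in> displaced n ?d (?s p)} = displaced n ?d (?s p)" by blast
    then show "real (card (displaced n ?d (?s p))) = (\<Sum>u\<in>{1..n}. if u \<in> displaced n ?d (?s
      p) then 1 else 0)"
      by (simp add: sum.If_cases Int_def)
  qed
  also have "\<dots> = (\<Sum>u\<in>{1..n}. \<Sum>p\<in>perms n. if u \<in> displaced n ?d (?s p) then 1
    else 0)"
    by (rule sum.swap)
  also have "\<dots> = (\<Sum>u\<in>{1..n}. real (card {p\<in>perms n. u \<in> displaced n ?d (?s p)}))"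
    by (simp add: sum.If_cases Int_def)
  also have "\<dots> \<le> (\<Sum>u\<in>{1..n}. 2 * (k + 1) / D\<^sup>2 * fact n)"
    unfolding k_def using n m D0 D by (intro sum_mono card_sort_residues_displaced) auto
  also have "\<dots> = real n * (2 * (k + 1) / D\<^sup>2 * fact n)" by simp
  finally have "real (card {p\<in>perms n. \<beta> * n < real (card (displaced n ?d (?s p)))}) * \<beta> * n
      \<le> (2 * (k + 1) / D\<^sup>2 * fact n) * n" by (simp add: mult_ac)
  then have "real (card {p\<in>perms n. \<beta> * n < real (card (displaced n ?d (?s p)))}) * \<beta>
    \<le> 2 * (k + 1) / D\<^sup>2 * fact n"
    by (rule mult_right_le_imp_le) (use n in simp)
  also have "2 * (k + 1) / D\<^sup>2 \<le> 3 / 100 * \<beta>"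
  proof -
    have "2 * (k + 1) \<le> 4 * k" using k1 by simp
    \<comment> \<open>Origin of \<open>600\<close>: the right-hand side below is
      \<open>3/400 * k^2 * \<beta>^3\<close>, and \<open>k * \<beta>^3 \<ge> 600\<close> makes it at
      least \<open>4.5 * k\<close>.\<close>
    also have "4 * k * 150 \<le> 4 * k * (k * \<beta> ^ 3 / 4)" using k3 k0 by (intro mult_left_mono) auto
    then have "4 * k \<le> 3 / 100 * \<beta> * D\<^sup>2"
      using k3 k0 by (simp add: D_def power2_eq_square power3_eq_cube mult_ac)
    finally show ?thesis using D0 by (simp add: divide_le_eq)
  qed
  finally have "real (card {p\<in>perms n. \<beta> * n < real (card (displaced n ?d (?s p)))}) * \<beta>
    \<le> 3 / 100 * fact n * \<beta>"
    by (simp add: mult_ac)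
  then show ?thesis using \<beta>(1) by simp
qed


section \<open>Input classes and distances\<close>

text \<open>An edgewise criterion, so that relabeled and recolored graphs can be recognized as
  images without exhibiting the pixel function each time.\<close>

lemma mem_image_graphs_iff:
  assumes "s \<notin> \<Sigma>"
  shows "G \<in> image_graphs s \<Sigma> (2 * M) \<longleftrightarrow>
    (\<forall>e. e \<notin> edges (2 * M) \<longrightarrow> G e = undefined) \<and>
    (\<forall>e\<in>edges (2 * M). if e \<subseteq> {1..M} \<or> e \<subseteq> {M + 1..2 * M} then G e =
      s else G e \<in> \<Sigma>)"
    (is "_ \<longleftrightarrow> ?R G")
proof
  assume "G \<in> image_graphs s \<Sigma> (2 * M)"
  then obtain f where f: "G = graph_of_image s M f" "f \<in> images \<Sigma> M"
    by (auto simp: image_graphs_def)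
  have "f (Min e, Max e - M) \<in> \<Sigma>" if e: "e \<in> edges (2 * M)" "\<not> e \<subseteq> {1..M}"
    "\<not> e \<subseteq> {M + 1..2 * M}" for e
  proof -
    obtain u v where uv: "e = {u, v}" "u \<in> {1..2 * M}" "v \<in> {1..2 * M}" "u < v"
      using e(1) by (auto simp: edges_iff)
    then have "Min e = u" "Max e = v" "u \<le> M" "M < v" using e by auto
    moreover have "(u, v - M) \<in> {1..M} \<times> {1..M}" using calculation uv by auto
    ultimately show ?thesis using f(2) unfolding images_def by (metis PiE_mem)
  qed
  then show "?R G" using f(1) by (auto simp: graph_of_image_def)
next
  assume R: "?R G"
  define f where "f = (\<lambda>(x, y)\<in>{1..M} \<times> {1..M}. G {x, M + y})"
  have "G {x, M + y} \<in> \<Sigma>" if "x \<in> {1..M}" "y \<in> {1..M}" for x y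
  proof -
    have "{x, M + y} \<in> edges (2 * M)" using that by (simp add: edges_def)
    moreover have "\<not> ({x, M + y} \<subseteq> {1..M} \<or> {x, M + y} \<subseteq> {M + 1..2 * M})"
      using that by auto
    ultimately show ?thesis using R by metis
  qed
  then have "f \<in> images \<Sigma> M" by (auto simp: f_def images_def)
  moreover have "G = graph_of_image s M f"
  proof
    fix e
    show "G e = graph_of_image s M f e"
    proof (cases "e \<in> edges (2 * M) \<and> \<not> (e \<subseteq> {1..M} \<or> e \<subseteq> {M + 1..2
      * M})")
      case True
      then obtain u v where uv: "e = {u, v}" "u \<in> {1..2 * M}" "v \<in> {1..2 * M}" "u < v"
        by (auto simp: edges_iff)
      then have "Min e = u" "Max e = v" "u \<le> M" "M < v" using True by auto
      then show ?thesis using True uv by (auto simp: graph_of_image_def f_def)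
    next
      case False
      then show ?thesis using R by (auto simp: graph_of_image_def)
    qed
  qed
  ultimately show "G \<in> image_graphs s \<Sigma> (2 * M)" by (auto simp: image_graphs_def)
qed

lemma input_class_colors:
  assumes "finite \<Sigma>" "input_class \<Sigma> U"
  obtains S where "finite S" "\<And>n. U n \<subseteq> edges n \<rightarrow>\<^sub>E S"
proof -
  from assms(2) consider "U = ordered_graphs \<Sigma>" | s where "s \<notin> \<Sigma>" "U = image_graphs
    s \<Sigma>"
    unfolding input_class_def by blast
  then show ?thesis
  proof cases
    case 1
    then show ?thesis using that[of \<Sigma>] assms(1) by (auto simp: ordered_graphs_def)
  next
    case (2 s)
    have "U n \<subseteq> edges n \<rightarrow>\<^sub>E insert s \<Sigma>" for n
    proof
      fix G assume G: "G \<in> U n"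
      then obtain M where M: "n = 2 * M" using 2 by (auto simp: image_graphs_def)
      show "G \<in> edges n \<rightarrow>\<^sub>E insert s \<Sigma>"
        using G mem_image_graphs_iff[OF 2(1), of G M] unfolding 2(2) M
        by (auto intro!: PiE_I split: if_splits)
    qed
    then show ?thesis using that[of "insert s \<Sigma>"] assms(1) by simp
  qed
qed

text \<open>
  For images \<open>M\<close> is the number of rows, and \<open>\<phi>\<close> repairs the colors at
    edges with a vertex
  that \<open>p\<close> moves between rows and columns.
\<close>

lemma input_class_relabel:
  assumes "input_class \<Sigma> U" "U n \<noteq> {}"
  obtains M \<phi> where
    "\<And>G p. G \<in> U n \<Longrightarrow> p permutes {1..n} \<Longrightarrow> (\<And>u. u \<in>
      {1..n} \<Longrightarrow> p u \<le> M \<longleftrightarrow> u \<le> M) \<Longrightarrow>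
       relabel p G \<in> U n"
    "\<And>G p. G \<in> U n \<Longrightarrow> p permutes {1..n} \<Longrightarrow> (\<lambda>e\<in>edges
      n. \<phi> e (relabel p G e)) \<in> U n"
    "\<And>G p e. G \<in> U n \<Longrightarrow> p permutes {1..n} \<Longrightarrow> e \<in> edges n
      \<Longrightarrow> e \<inter> crossing n M p = {} \<Longrightarrow>
       \<phi> e (relabel p G e) = relabel p G e"
proof -
  from assms(1) consider "U = ordered_graphs \<Sigma>" | s where "s \<notin> \<Sigma>" "U = image_graphs
    s \<Sigma>"
    unfolding input_class_def by blast
  then show ?thesis
  proof cases
    case 1
    have *: "relabel p G e \<in> \<Sigma>" if "G \<in> U n" "p permutes {1..n}" "e \<in> edges n" for G p e
      using that edges_permute[OF that(2)] unfolding 1 ordered_graphs_def relabel_def by blast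
    have "relabel p G e = undefined" if "G \<in> U n" "p permutes {1..n}" "e \<notin> edges n" for G p e
      using that edges_permute[OF that(2)] unfolding 1 ordered_graphs_def relabel_def by (metis PiE_arb)
    with * have "relabel p G \<in> U n" if "G \<in> U n" "p permutes {1..n}" for G p
      using that by (auto simp: 1 ordered_graphs_def intro!: PiE_I)
    moreover have "(\<lambda>e\<in>edges n. relabel p G e) \<in> U n"
      if "G \<in> U n" "p permutes {1..n}" for G p
      using that * by (auto simp: 1 ordered_graphs_def)
    \<comment> \<open>With threshold \<open>n\<close> nothing crosses, and the repair leaves every
      color alone.\<close>
    ultimately show ?thesis
      by (intro that[of n "\<lambda>_ c. c"]) simp_all
  next
    case (2 s)
    obtain G0 M where G0: "G0 \<in> U n" and n: "n = 2 * M" using assms(2) 2(2)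
      by (auto simp: image_graphs_def)
    note U = mem_image_graphs_iff[OF 2(1), of _ M, folded 2(2) n]
    define same where "same e \<longleftrightarrow> e \<subseteq> {1..M} \<or> e \<subseteq> {M + 1..n}" for e
    have U: "G \<in> U n \<longleftrightarrow> (\<forall>e. e \<notin> edges n \<longrightarrow> G e =
      undefined) \<and>
      (\<forall>e\<in>edges n. if same e then G e = s else G e \<in> \<Sigma>)" for G
      using U by (simp add: same_def)
    have same_iff: "same e \<longleftrightarrow> (\<forall>u\<in>e. \<forall>v\<in>e. u \<le> M
      \<longleftrightarrow> v \<le> M)" if "e \<in> edges n" for e
      using that by (auto simp: edges_iff same_def)
    have same_permute: "same (p ` e) \<longleftrightarrow> same e"
      if "p permutes {1..n}" "e \<in> edges n" "\<And>u. u \<in> e \<Longrightarrow> p u \<le> M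
        \<longleftrightarrow> u \<le> M" for p e
    proof -
      have "p ` e \<in> edges n" using that by (simp add: edges_permute)
      then show ?thesis using that by (simp add: same_iff)
    qed
    \<comment> \<open>A stand-in color for row-column edges. As soon as one such edge exists, the
      graph \<open>G0\<close> shows that \<open>\<Sigma>\<close> is nonempty.\<close>
    define \<sigma> where "\<sigma> = (SOME c. c \<in> \<Sigma>)"
    have \<sigma>: "\<sigma> \<in> \<Sigma>" if "e \<in> edges n" "\<not> same e" for e
    proof -
      have "G0 e \<in> \<Sigma>" using G0 that by (simp add: U)
      then show ?thesis unfolding \<sigma>_def by (rule someI)
    qed
    \<comment> \<open>The repair looks only at the edge and the color received there, so a
      simulation can apply it without knowing \<open>G\<close>. On a row-column edge the color
      \<open>s\<close> reveals that two rows or two columns were moved there.\<close>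
    define \<phi> where "\<phi> e c = (if same e then s else if c = s then \<sigma> else c)" for e c
    have in_edge: "u \<in> {1..n}" if "e \<in> edges n" "u \<in> e" for u e
      using that by (auto simp: edges_iff)
    show ?thesis
    proof (rule that[of M \<phi>])
      fix G p assume G: "G \<in> U n" and p: "p permutes {1..n}"
        and M: "\<And>u. u \<in> {1..n} \<Longrightarrow> p u \<le> M \<longleftrightarrow> u \<le> M"
      have "same (p ` e) \<longleftrightarrow> same e" if "e \<in> edges n" for e
        using same_permute[OF p that] M in_edge[OF that] by blast
      then show "relabel p G \<in> U n" using G edges_permute[OF p] by (simp add: U relabel_def)
    next
      fix G p assume G: "G \<in> U n" and p: "p permutes {1..n}"
      have "\<phi> e (relabel p G e) \<in> \<Sigma>" if e: "e \<in> edges n" "\<not> same e" for e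
      proof -
        have "p ` e \<in> edges n" using e edges_permute[OF p] by simp
        then have "if same (p ` e) then G (p ` e) = s else G (p ` e) \<in> \<Sigma>" using G
          unfolding U by blast
        then have "relabel p G e = s \<or> relabel p G e \<in> \<Sigma>"
          by (auto simp: relabel_def split: if_splits)
        then show ?thesis using \<sigma>[OF e] e by (auto simp: \<phi>_def)
      qed
      then show "(\<lambda>e\<in>edges n. \<phi> e (relabel p G e)) \<in> U n"
        by (auto simp: U) (simp add: \<phi>_def)
    next
      fix G p e assume G: "G \<in> U n" and p: "p permutes {1..n}" and e: "e \<in> edges n" "e \<inter>
        crossing n M p = {}"
      have "p u \<le> M \<longleftrightarrow> u \<le> M" if "u \<in> e" for u
        using in_edge[OF e(1) that] e(2) that by (auto simp: crossing_def)
      then have "same (p ` e) \<longleftrightarrow> same e" by (rule same_permute[OF p e(1)])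
      moreover have "p ` e \<in> edges n" using e edges_permute[OF p] by simp
      then have "if same (p ` e) then relabel p G e = s else relabel p G e \<in> \<Sigma>"
        using G unfolding U relabel_def by blast
      ultimately show "\<phi> e (relabel p G e) = relabel p G e" using 2(1)
        by (auto simp: \<phi>_def split: if_splits)
    qed
  qed
qed

section \<open>Hamming distance to a property\<close>

lemma card_differ_le:
  "card {e\<in>edges n. G e \<noteq> H e} \<le> card {e\<in>edges n. G e \<noteq> K e} + card
    {e\<in>edges n. K e \<noteq> H e}"
proof -
  have "card {e\<in>edges n. G e \<noteq> H e} \<le> card ({e\<in>edges n. G e \<noteq> K e} \<union>
    {e\<in>edges n. K e \<noteq> H e})"
    by (intro card_mono) auto
  then show ?thesis using card_Un_le le_trans by blast
qed

lemma hamming_dist_triangle: "hamming_dist n G H \<le> hamming_dist n G K + hamming_dist n K H"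
  unfolding hamming_dist_def add_divide_distrib[symmetric]
  using card_differ_le[of n G H K] by (intro divide_right_mono) (auto simp flip: of_nat_add)

lemma hamming_dist_commute: "hamming_dist n G H = hamming_dist n H G"
  by (simp add: hamming_dist_def eq_commute)

lemma hamming_dist_self [simp]: "hamming_dist n G G = 0"
  by (simp add: hamming_dist_def)

lemma hamming_dist_le_1: "hamming_dist n G H \<le> 1"
proof -
  have "card {e\<in>edges n. G e \<noteq> H e} \<le> n choose 2"
    unfolding card_edges[symmetric] by (intro card_mono) auto
  then show ?thesis unfolding hamming_dist_def by (cases "n choose 2 = 0") (simp_all add: divide_le_eq)
qed

lemma hamming_dist_relabel:
  assumes p: "p permutes {1..n}"
  shows "hamming_dist n (relabel p G) (relabel p H) = hamming_dist n G H"
proof -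
  have "bij_betw ((`) p) {e\<in>edges n. relabel p G e \<noteq> relabel p H e} {e\<in>edges n. G e
    \<noteq> H e}"
  proof (rule bij_betwI[where g = "(`) (inv p)"])
    show "inv p ` p ` e = e" "p ` inv p ` e = e" for e
      by (simp_all add: image_comp permutes_inv_o[OF p])
  qed (use edges_permute[OF p] edges_permute[OF permutes_inv[OF p]] in
      \<open>auto simp: relabel_def image_comp permutes_inv_o[OF p]\<close>)
  then show ?thesis by (simp add: hamming_dist_def bij_betw_same_card)
qed

lemma closeI:
  assumes "H \<in> P n" "hamming_dist n G H \<le> \<epsilon>"
  shows "close \<epsilon> n G P"
proof -
  have "hamming_dist_to n G P \<le> ereal (hamming_dist n G H)"
    unfolding hamming_dist_to_def using assms(1) by (rule INF_lower)
  also have "\<dots> \<le> ereal \<epsilon>" using assms(2) by simp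
  finally show ?thesis by (simp add: far_def)
qed

text \<open>A finite property attains the infimum, and an empty one has infinite distance, which
  closeness excludes.\<close>

lemma closeE:
  assumes "close \<epsilon> n G P" "finite (P n)"
  obtains H where "H \<in> P n" "hamming_dist n G H \<le> \<epsilon>"
proof -
  have ne: "P n \<noteq> {}" using assms(1) by (auto simp: far_def hamming_dist_to_def top_ereal_def)
  then have "hamming_dist_to n G P \<in> (\<lambda>H. ereal (hamming_dist n G H)) ` P n"
    unfolding hamming_dist_to_def using assms(2) by (simp flip: Min_Inf)
  then obtain H where "H \<in> P n" "hamming_dist_to n G P = ereal (hamming_dist n G H)" by blast
  then show ?thesis using that assms(1) by (simp add: far_def)
qed

lemma finite_property:
  assumes "finite \<Sigma>" "input_class \<Sigma> U" "property_of U P"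
  shows "finite (P n)"
proof -
  obtain S where "finite S" "\<And>n. U n \<subseteq> edges n \<rightarrow>\<^sub>E S"
    using input_class_colors[OF assms(1,2)] by blast
  moreover have "P n \<subseteq> U n" using assms(3) by (simp add: property_of_def)
  ultimately show ?thesis using finite_PiE[of "edges n" "\<lambda>_. S"] by (meson finite_edges finite_subset)
qed

lemma choose_two_ge: "n \<ge> 2 \<Longrightarrow> real (n choose 2) \<ge> real n * real n / 4"
proof -
  assume "n \<ge> 2"
  then have "2 * real n \<le> real n * real n" by simp
  moreover have "real (n choose 2) = real n * (real n - 1) / 2"
    using \<open>n \<ge> 2\<close> by (simp add: choose_two of_nat_diff real_of_nat_div)
  ultimately show ?thesis by (simp add: algebra_simps)
qed

text \<open>\<open>q\<close> is \<open>p\<close> with its crossings removed, so relabeling by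
  \<open>q\<close> stays in the class. At most
  \<open>\<beta> * n + 2 * d \<le> 3 * \<beta> * n\<close> vertices cross, hence \<open>q\<close>
  displaces at most \<open>4 * \<beta> * n\<close> vertices. Edges at crossing vertices are the only
  ones where the repaired graph can differ from the relabeling by \<open>q\<close>.\<close>

lemma sorted_relabeling_near_class:
  fixes \<phi> :: "nat set \<Rightarrow> 'c \<Rightarrow> 'c" and U :: "'c graph_family"
  assumes n: "n \<ge> 2" and p: "p permutes {1..n}" and \<beta>: "0 < \<beta>"
    and disp: "real (card (displaced n (nat \<lfloor>\<beta> * n\<rfloor>) p)) \<le> \<beta> * n"
    and \<phi>1: "\<And>G p. G \<in> U n \<Longrightarrow> p permutes {1..n} \<Longrightarrow> (\<And>u.
      u \<in> {1..n} \<Longrightarrow> p u \<le> M \<longleftrightarrow> u \<le> M) \<Longrightarrow>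
       relabel p G \<in> U n"
    and \<phi>3: "\<And>G p e. G \<in> U n \<Longrightarrow> p permutes {1..n} \<Longrightarrow> e \<in>
      edges n \<Longrightarrow> e \<inter> crossing n M p = {} \<Longrightarrow>
       \<phi> e (relabel p G e) = relabel p G e"
  obtains q where "q permutes {1..n}"
    "\<And>G. G \<in> U n \<Longrightarrow> relabel q G \<in> U n"
    "\<And>G. G \<in> U n \<Longrightarrow> relabel (inv q) G \<in> U n"
    "\<And>G :: 'c graph. earthmover_dist n G (relabel q G) \<le> ereal (40 * \<beta>)"
    "\<And>G :: 'c graph. earthmover_dist n G (relabel (inv q) G) \<le> ereal (40 * \<beta>)"
    "\<And>G. G \<in> U n \<Longrightarrow> hamming_dist n (\<lambda>e\<in>edges n. \<phi> e (relabel p G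
      e)) (relabel q G) \<le> 12 * \<beta>"
proof -
  let ?d = "nat \<lfloor>\<beta> * n\<rfloor>" and ?X = "crossing n M p"
  have d: "real ?d \<le> \<beta> * n" using \<beta> by simp
  have X: "real (card ?X) \<le> 3 * \<beta> * n"
    using card_crossing_le[of n M p ?d] disp d by linarith
  obtain q where q: "q permutes {1..n}" "\<And>u. u \<in> {1..n} \<Longrightarrow> q u \<le> M
    \<longleftrightarrow> u \<le> M"
    "\<And>u. u \<in> {1..n} - ?X \<Longrightarrow> q u = p u"
    using uncross_permutation[OF p, of M] by blast
  have c2: "real n * real n / 4 \<le> real (n choose 2)" using choose_two_ge[OF n] .
  have c2': "real (n choose 2) > 0" using n by simp
  have "displaced n ?d q \<subseteq> displaced n ?d p \<union> ?X"
  proof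
    fix u assume u: "u \<in> displaced n ?d q"
    then have "u \<in> {1..n}" by (simp add: displaced_def)
    then show "u \<in> displaced n ?d p \<union> ?X" using u q(3)[of u]
      by (cases "u \<in> ?X") (auto simp: displaced_def)
  qed
  then have "card (displaced n ?d q) \<le> card (displaced n ?d p) + card ?X"
    by (meson card_mono card_Un_le finite_UnI finite_crossing finite_displaced le_trans)
  then have dq: "real (card (displaced n ?d q)) \<le> 4 * \<beta> * n" using X disp by linarith
  \<comment> \<open>Only the number of displaced vertices of \<open>r\<close> enters, so the bound
    serves \<open>q\<close> and \<open>inv q\<close> alike. There are at most
    \<open>10 * \<beta> * n^2\<close> inversions, and \<open>choose_two_ge\<close> turns
    \<open>10\<close> into \<open>40\<close>.\<close>
  have inv_bound: "real (card (inversions n r)) / (n choose 2) \<le> 40 * \<beta>"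
    if "card (displaced n ?d r) = card (displaced n ?d q)" for r
  proof -
    have "real (card (inversions n r)) \<le> real (2 * n * card (displaced n ?d r) + 2 * ?d * n)"
      using card_inversions_le by (simp only: of_nat_le_iff)
    also have "\<dots> = 2 * n * real (card (displaced n ?d r)) + 2 * n * real ?d" by simp
    also have "\<dots> \<le> 2 * n * (4 * \<beta> * n) + 2 * n * (\<beta> * n)"
      using dq d that by (intro add_mono mult_left_mono) auto
    also have "\<dots> = 40 * \<beta> * (real n * real n / 4)" by simp
    also have "\<dots> \<le> 40 * \<beta> * real (n choose 2)" using c2 \<beta> by (intro mult_left_mono) auto
    finally show ?thesis using c2' by (simp add: divide_le_eq)
  qed
  show ?thesis
  proof (rule that[OF q(1)])
    note qi = permutes_inv[OF q(1)]
    have M: "inv q u \<le> M \<longleftrightarrow> u \<le> M" if "u \<in> {1..n}" for u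
      using q(2)[of "inv q u"] permutes_in_image[OF qi, of u] that permutes_inverses[OF q(1)] by simp
    show "relabel q G \<in> U n" "relabel (inv q) G \<in> U n" if "G \<in> U n" for G
      using \<phi>1[OF that q(1,2)] \<phi>1[OF that qi M] by blast+
    show "earthmover_dist n G (relabel q G) \<le> ereal (40 * \<beta>)" for G :: "'c graph"
      using earthmover_dist_relabel[OF q(1) n, of G] inv_bound[OF refl]
        by (metis ereal_less_eq(3) order_trans)
    show "earthmover_dist n G (relabel (inv q) G) \<le> ereal (40 * \<beta>)" for G :: "'c graph"
      using earthmover_dist_relabel[OF qi n, of G] inv_bound[OF card_displaced_inv[OF q(1)]]
      by (metis ereal_less_eq(3) order_trans)
    fix G assume G: "G \<in> U n"
    let ?D = "{e\<in>edges n. (\<lambda>e\<in>edges n. \<phi> e (relabel p G e)) e \<noteq> relabel q G e}"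
    \<comment> \<open>Away from the crossing vertices \<open>q\<close> agrees with \<open>p\<close>
      and the repair is idle. So every differing edge meets \<open>?X\<close>, which costs at most
      \<open>3 * \<beta> * n\<close> times \<open>n\<close> edges.\<close>
    have "?D \<subseteq> (\<lambda>(u, v). {u, v}) ` (?X \<times> {1..n})"
    proof
      fix e assume e: "e \<in> ?D"
      have "e \<inter> ?X \<noteq> {}"
      proof
        assume *: "e \<inter> ?X = {}"
        have "q u = p u" if "u \<in> e" for u
        proof -
          have "u \<in> {1..n}" using e that by (auto simp: edges_iff)
          then show ?thesis using * q(3) that by blast
        qed
        then have "q ` e = p ` e" by (rule image_cong[OF refl])
        moreover have "e \<in> edges n" using e by simp
        ultimately show False using \<phi>3[OF G p _ *] e by (simp add: relabel_def)
      qed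
      then obtain u where u: "u \<in> e" "u \<in> ?X" by blast
      obtain a b where ab: "e = {a, b}" "a \<in> {1..n}" "b \<in> {1..n}" using e by (auto simp: edges_iff)
      then have "e = {u, a} \<or> e = {u, b}" using u by auto
      then obtain w where "e = {u, w}" "w \<in> {1..n}" using ab by blast
      then show "e \<in> (\<lambda>(u, v). {u, v}) ` (?X \<times> {1..n})" using u(2)
        by (intro image_eqI[of _ _ "(u, w)"]) simp_all
    qed
    then have "card ?D \<le> card ((\<lambda>(u, v). {u, v}) ` (?X \<times> {1..n}))"
      by (intro card_mono) simp_all
    also have "\<dots> \<le> card (?X \<times> {1..n})" by (intro card_image_le) simp
    finally have "card ?D \<le> card (?X \<times> {1..n})" .
    then have "real (card ?D) \<le> real (card ?X) * n"
      by (simp add: card_cartesian_product flip: of_nat_mult)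
    also have "\<dots> \<le> 3 * \<beta> * n * n" using X by (intro mult_right_mono) auto
    also have "\<dots> = 12 * \<beta> * (real n * real n / 4)" by simp
    also have "\<dots> \<le> 12 * \<beta> * real (n choose 2)" using c2 \<beta> by (intro mult_left_mono) auto
    finally show "hamming_dist n (\<lambda>e\<in>edges n. \<phi> e (relabel p G e)) (relabel q G) \<le>
      12 * \<beta>"
      unfolding hamming_dist_def using c2' by (simp add: divide_le_eq)
  qed
qed


section \<open>Majority votes and locality of query trees\<close>

definition maj :: "bool \<Rightarrow> bool \<Rightarrow> bool \<Rightarrow> bool" where
  "maj a b c \<longleftrightarrow> a \<and> b \<or> a \<and> c \<or> b \<and> c"

definition maj_pmf :: "bool pmf \<Rightarrow> bool pmf" where
  "maj_pmf A = bind_pmf A (\<lambda>a. bind_pmf A (\<lambda>b. map_pmf (maj a b) A))"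

lemma pmf_bind_bool:
  "pmf (bind_pmf A f) x = pmf A True * pmf (f True) x + pmf A False * pmf (f False) x"
  unfolding pmf_bind by (subst integral_measure_pmf[of UNIV]) (auto simp: UNIV_bool)

lemma pmf_maj_pmf: "pmf (maj_pmf A) x = pmf A x ^ 2 * (3 - 2 * pmf A x)"
proof -
  have maj: "maj True True = (\<lambda>_. True)" "maj False False = (\<lambda>_. False)"
    "maj True False = id" "maj False True = id" by (auto simp: maj_def)
  have F: "pmf A False = 1 - pmf A True" by (rule pmf_False_conv_True)
  show ?thesis
    by (cases x) (simp_all add: maj_pmf_def pmf_bind_bool maj pmf.map_id F power2_eq_square algebra_simps)
qed

text \<open>Both constants are chosen for slack: \<open>13/20\<close> is \<open>2/3 - 1/60\<close>,
  the loss allowed when the input is perturbed, and \<open>7/10\<close> still exceeds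
  \<open>2/3\<close> after multiplication by \<open>97/100\<close>.\<close>

lemma pmf_maj_pmf_ge:
  assumes "pmf A x \<ge> 13 / 20"
  shows "pmf (maj_pmf A) x \<ge> 7 / 10"
proof -
  have mono: "b ^ 2 * (3 - 2 * b) \<le> p ^ 2 * (3 - 2 * p)" if "0 \<le> b" "b \<le> p" "p \<le> 1"
    for b p :: real
  proof -
    \<comment> \<open>The difference of the two values of \<open>t^2 * (3 - 2 * t)\<close>, factored
      so that each summand is nonnegative on the unit interval.\<close>
    have "0 \<le> (p - b) * (2 * p * (1 - p) + 2 * b * (1 - b) + p * (1 - b) + b * (1 - p))"
      using that by (intro mult_nonneg_nonneg add_nonneg_nonneg) auto
    then show ?thesis by (simp add: power2_eq_square algebra_simps)
  qed
  have "7 / 10 \<le> (13 / 20 :: real) ^ 2 * (3 - 2 * (13 / 20))" by (simp add: power2_eq_square)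
  also have "\<dots> \<le> pmf A x ^ 2 * (3 - 2 * pmf A x)" using assms pmf_le_1 by (intro mono) auto
  finally show ?thesis unfolding pmf_maj_pmf .
qed

section \<open>Sequential composition of query trees\<close>

primrec bind_tree :: "'c query_tree \<Rightarrow> (bool \<Rightarrow> 'c query_tree) \<Rightarrow> 'c
  query_tree" where
  "bind_tree (Decide b) k = k b"
| "bind_tree (Query e f) k = Query e (\<lambda>c. bind_tree (f c) k)"

lemma run_bind_tree: "run_tree G (bind_tree t k) = run_tree G (k (run_tree G t))"
  by (induction t) auto

lemma queries_at_most_mono: "queries_at_most t q \<Longrightarrow> q \<le> q' \<Longrightarrow>
  queries_at_most t q'"
proof (induction t arbitrary: q q')
  case (Query e k)
  have "queries_at_most (k c) (q' - 1)" for c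
    by (rule Query.IH[of "k c" "q - 1"]) (use Query.prems in auto)
  then show ?case using Query.prems by auto
qed simp

lemma queries_at_most_bind_tree:
  "queries_at_most t q \<Longrightarrow> (\<And>b. queries_at_most (k b) q') \<Longrightarrow>
    queries_at_most (bind_tree t k) (q + q')"
proof (induction t arbitrary: q)
  case (Decide b)
  then have "queries_at_most (k b) q'" by blast
  then show ?case by (simp add: queries_at_most_mono)
next
  case (Query e f)
  have "queries_at_most (bind_tree (f c) k) (q + q' - 1)" for c
    using Query.IH[of "f c" "q - 1"] Query.prems by simp
  then show ?case using Query.prems by simp
qed

lemma queries_exactly_bind_tree:
  "queries_exactly t es \<Longrightarrow> (\<And>b. queries_exactly (k b) es') \<Longrightarrow>
    queries_exactly (bind_tree t k) (es @ es')"
  by (induction t arbitrary: es) auto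

definition maj_tree :: "'c query_tree \<Rightarrow> 'c query_tree \<Rightarrow> 'c query_tree
  \<Rightarrow> 'c query_tree" where
  "maj_tree t1 t2 t3 =
     bind_tree t1 (\<lambda>a. bind_tree t2 (\<lambda>b. bind_tree t3 (\<lambda>c. Decide (maj a b c))))"

text \<open>The majority vote on the level of trees instead of output distributions, so that query
  bounds and nonadaptivity can be traced through it.\<close>

definition tree_majority :: "(nat \<Rightarrow> 'c query_tree pmf) \<Rightarrow> nat \<Rightarrow> 'c
  query_tree pmf" where
  "tree_majority T n =
     bind_pmf (T n) (\<lambda>t1. bind_pmf (T n) (\<lambda>t2. map_pmf (\<lambda>t3. maj_tree t1 t2 t3)
       (T n)))"

lemma run_tree_majority: "run (tree_majority T) n G = maj_pmf (run T n G)"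
  by (simp add: run_def tree_majority_def maj_pmf_def map_bind_pmf bind_map_pmf pmf.map_comp o_def
      maj_tree_def run_bind_tree)

lemma query_bound_majority:
  assumes "query_bound T q"
  shows "query_bound (tree_majority T) (3 * q)"
proof -
  have "queries_at_most (maj_tree t1 t2 t3) (3 * q)"
    if "queries_at_most t1 q" "queries_at_most t2 q" "queries_at_most t3 q" for t1 t2 t3 :: "'a query_tree"
  proof -
    have "queries_at_most (maj_tree t1 t2 t3) (q + (q + (q + 0)))"
      unfolding maj_tree_def using that by (intro queries_at_most_bind_tree) auto
    then show ?thesis by (simp add: numeral_3_eq_3)
  qed
  then show ?thesis using assms by (auto simp: query_bound_def tree_majority_def)
qed

lemma nonadaptive_majority:
  assumes "nonadaptive T"
  shows "nonadaptive (tree_majority T)"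
proof -
  have "queries_exactly (maj_tree t1 t2 t3) (es1 @ es2 @ es3 @ [])"
    if "queries_exactly t1 es1" "queries_exactly t2 es2" "queries_exactly t3 es3"
    for t1 t2 t3 :: "'a query_tree" and es1 es2 es3
    unfolding maj_tree_def using that by (intro queries_exactly_bind_tree) auto
  note exactly = this
  show ?thesis
    unfolding nonadaptive_def
  proof (intro allI ballI)
    fix n t assume "t \<in> set_pmf (tree_majority T n)"
    then obtain t1 t2 t3 where t: "t = maj_tree t1 t2 t3"
      and "t1 \<in> set_pmf (T n)" "t2 \<in> set_pmf (T n)" "t3 \<in> set_pmf (T n)"
      by (auto simp: tree_majority_def)
    then obtain es1 es2 es3 where "queries_exactly t1 es1" "queries_exactly t2 es2" "queries_exactly t3 es3"
      using assms unfolding nonadaptive_def by meson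
    then show "\<exists>es. queries_exactly t es" using exactly t by blast
  qed
qed

text \<open>The common interface of adaptive and nonadaptive algorithms for the simulation.
  Comparing only colorings by \<open>S\<close> matters for adaptive trees: they branch over all of
  the color type, but only finitely many branches occur.\<close>

definition depends_on :: "nat \<Rightarrow> 'c set \<Rightarrow> nat set \<Rightarrow> 'c query_tree
  \<Rightarrow> bool" where
  "depends_on n S V t \<longleftrightarrow> (\<forall>G\<in>edges n \<rightarrow>\<^sub>E S.
    \<forall>H\<in>edges n \<rightarrow>\<^sub>E S.
     (\<forall>e\<in>edges n. e \<subseteq> V \<longrightarrow> G e = H e) \<longrightarrow> run_tree G t
       = run_tree H t)"

text \<open>The ends of the queried edges suffice, and queries outside \<open>edges n\<close> return
  \<open>undefined\<close> on both graphs. That the bound is linear in \<open>q\<close> is what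
  preserves polynomial growth.\<close>

lemma depends_on_nonadaptive:
  assumes "queries_exactly t es" "queries_at_most t q"
  shows "\<exists>V\<subseteq>{1..n}. card V \<le> 2 * q \<and> depends_on n S V t"
proof -
  have len: "queries_exactly t es \<Longrightarrow> queries_at_most t q \<Longrightarrow> length es \<le>
    q" for t :: "'a query_tree" and es q
  proof (induction t arbitrary: es q)
    case (Query e k)
    then obtain es' where es: "es = e # es'" "\<And>c. queries_exactly (k c) es'" by auto
    have "length es' \<le> q - 1"
      by (rule Query.IH[OF _ es(2)[of undefined]]) (use Query.prems in auto)
    moreover have "q > 0" using Query.prems by simp
    ultimately show ?case using es by simp
  qed simp
  have agree: "queries_exactly t es \<Longrightarrow> (\<And>e. e \<in> set es \<Longrightarrow> G e = H
    e) \<Longrightarrow> run_tree G t = run_tree H t"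
    for t :: "'a query_tree" and es G H
  proof (induction t arbitrary: es)
    case (Query e k)
    then obtain es' where es: "es = e # es'" "\<And>c. queries_exactly (k c) es'" by auto
    have "run_tree G (k (G e)) = run_tree H (k (G e))"
      by (rule Query.IH[OF _ es(2)]) (use Query.prems es in auto)
    then show ?case using Query.prems es by simp
  qed simp
  let ?V = "\<Union>(set es \<inter> edges n)"
  have "card ?V \<le> sum card (set es \<inter> edges n)"
    by (rule card_Union_le_sum_card)
  also have "\<dots> = (\<Sum>e\<in>set es \<inter> edges n. 2)"
    by (rule sum.cong) (auto simp: edges_def nsets_def)
  also have "\<dots> \<le> 2 * card (set es)" by (simp add: card_mono)
  also have "\<dots> \<le> 2 * q" using card_length[of es] len[OF assms] by simp
  finally have "card ?V \<le> 2 * q" .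
  moreover have "?V \<subseteq> {1..n}" by (auto simp: edges_def nsets_def)
  moreover have "depends_on n S ?V t"
    unfolding depends_on_def
  proof (intro ballI impI)
    fix G H assume GH: "G \<in> edges n \<rightarrow>\<^sub>E S" "H \<in> edges n \<rightarrow>\<^sub>E
      S" and eq: "\<forall>e\<in>edges n. e \<subseteq> ?V \<longrightarrow> G e = H e"
    show "run_tree G t = run_tree H t"
    proof (rule agree[OF assms(1)])
      fix e assume e: "e \<in> set es"
      show "G e = H e"
      proof (cases "e \<in> edges n")
        case True
        then have "e \<subseteq> ?V" using e by (intro Union_upper) simp
        then show ?thesis by (rule eq[rule_format, OF True])
      next
        case False
        then show ?thesis using PiE_arb[OF GH(1)] PiE_arb[OF GH(2)] by simp
      qed
    qed
  qed
  ultimately show ?thesis by blast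
qed

text \<open>Vertices are collected along all branches that can occur. The base
  \<open>card S + 2\<close> counts the colors, the answer \<open>undefined\<close>, and one unit
  that pays for the current query.\<close>

lemma depends_on_adaptive:
  assumes "finite S"
  shows "queries_at_most t q \<Longrightarrow> \<exists>V\<subseteq>{1..n}. card V \<le> 2 * (card S + 2)
    ^ q \<and> depends_on n S V t"
proof (induction t arbitrary: q)
  case (Decide b)
  then show ?case by (intro exI[of _ "{}"]) (auto simp: depends_on_def)
next
  case (Query e k)
  let ?N = "card S + 2"
  have "\<exists>V\<subseteq>{1..n}. card V \<le> 2 * ?N ^ (q - 1) \<and> depends_on n S V (k c)" for c
    by (rule Query.IH) (use Query.prems in auto)
  then obtain W where W: "\<And>c. W c \<subseteq> {1..n}" "\<And>c. card (W c) \<le> 2 * ?N ^ (q - 1)"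
    "\<And>c. depends_on n S (W c) (k c)" by metis
  \<comment> \<open>Querying a set that is not an edge adds no vertex, but it is answered by
    \<open>undefined\<close>, so that branch must be followed too.\<close>
  let ?e = "if e \<in> edges n then e else {}" and ?S = "insert undefined S"
  let ?V = "?e \<union> (\<Union>c\<in>?S. W c)"
  have "card ?V \<le> card ?e + card (\<Union>c\<in>?S. W c)" by (rule card_Un_le)
  also have "card ?e \<le> 2" by (auto simp: edges_def nsets_def)
  also have "card (\<Union>c\<in>?S. W c) \<le> (\<Sum>c\<in>?S. card (W c))" using assms
    by (intro card_UN_le) simp
  also have "\<dots> \<le> (\<Sum>c\<in>?S. 2 * ?N ^ (q - 1))" using W(2) by (intro sum_mono)
  also have "\<dots> = card ?S * (2 * ?N ^ (q - 1))" by simp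
  also have "\<dots> \<le> (card S + 1) * (2 * ?N ^ (q - 1))"
    using assms by (intro mult_le_mono1) (simp add: card_insert_if)
  finally have "card ?V \<le> 2 + (card S + 1) * (2 * ?N ^ (q - 1))" by simp
  also have "\<dots> \<le> 2 * ?N ^ (q - 1) + (card S + 1) * (2 * ?N ^ (q - 1))" by simp
  also have "\<dots> = 2 * ?N ^ Suc (q - 1)" by (simp add: algebra_simps)
  also have "Suc (q - 1) = q" using Query.prems by simp
  finally have "card ?V \<le> 2 * ?N ^ q" .
  moreover have "?V \<subseteq> {1..n}" using W(1) by (auto simp: edges_def nsets_def)
  moreover have "depends_on n S ?V (Query e k)"
    unfolding depends_on_def
  proof (intro ballI impI)
    fix G H assume GH: "G \<in> edges n \<rightarrow>\<^sub>E S" "H \<in> edges n \<rightarrow>\<^sub>E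
      S" and eq: "\<forall>e\<in>edges n. e \<subseteq> ?V \<longrightarrow> G e = H e"
    have "G e = H e"
    proof (cases "e \<in> edges n")
      case True
      then have "e \<subseteq> ?V" by simp
      then show ?thesis by (rule eq[rule_format, OF True])
    next
      case False
      then show ?thesis using PiE_arb[OF GH(1)] PiE_arb[OF GH(2)] by simp
    qed
    moreover have Ge: "G e \<in> ?S"
    proof (cases "e \<in> edges n")
      case True
      then show ?thesis using PiE_mem[OF GH(1)] by simp
    next
      case False
      then show ?thesis using PiE_arb[OF GH(1)] by simp
    qed
    have "G e' = H e'" if "e' \<in> edges n" "e' \<subseteq> W (G e)" for e'
      by (rule eq[rule_format, OF that(1)]) (use that(2) Ge in blast)
    then have "run_tree G (k (G e)) = run_tree H (k (G e))"
      using W(3)[unfolded depends_on_def, rule_format, OF GH] by blast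
    ultimately show "run_tree G (Query e k) = run_tree H (Query e k)" by simp
  qed
  ultimately show ?case by blast
qed


section \<open>Exact simulation by canonical tests\<close>

text \<open>The increasing enumeration of \<open>V\<close>, extended to a permutation of all
  vertices so that it can be composed with other permutations. How it acts beyond
  \<open>{1..card V}\<close> is left to choice.\<close>

definition enum_perm :: "nat \<Rightarrow> nat set \<Rightarrow> nat \<Rightarrow> nat" where
  "enum_perm n V = (SOME k. k permutes {1..n} \<and> (\<forall>i\<in>{1..card V}. k i =
    sorted_list_of_set V ! (i - 1)))"

lemma enum_perm:
  assumes "V \<subseteq> {1..n}"
  shows "enum_perm n V permutes {1..n}"
    "i \<in> {1..card V} \<Longrightarrow> enum_perm n V i = sorted_list_of_set V ! (i - 1)"
    "strict_mono_on {1..card V} (enum_perm n V)"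
    "enum_perm n V ` {1..card V} = V"
proof -
  let ?l = "sorted_list_of_set V"
  have fin: "finite V" using assms finite_subset by blast
  have less: "?l ! (i - 1) < ?l ! (j - 1)" if "i \<in> {1..card V}" "j \<in> {1..card V}" "i < j" for i j
    using that sorted_wrt_nth_less[of "(<)" ?l "i - 1" "j - 1"] by simp
  have inj: "inj_on (\<lambda>i. ?l ! (i - 1)) {1..card V}"
    by (rule linorder_inj_onI) (use less in \<open>auto dest: less_imp_neq\<close>)
  have img: "(\<lambda>i. ?l ! (i - 1)) ` {1..card V} \<subseteq> V"
    using sorted_list_nth(1)[OF fin] by fastforce
  have cV: "card V \<le> n" using card_mono[OF _ assms] by simp
  obtain k where "k permutes {1..n}" "\<And>i. i \<in> {1..card V} \<Longrightarrow> k i = ?l ! (i - 1)"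
    by (rule extend_to_permutation[of "{1..n}" "\<lambda>i. ?l ! (i - 1)" "{1..card V}"])
       (use inj img assms cV in auto)
  then have "\<exists>k. k permutes {1..n} \<and> (\<forall>i\<in>{1..card V}. k i = ?l ! (i - 1))" by blast
  from someI_ex[OF this] show perm: "enum_perm n V permutes {1..n}"
    and eq: "i \<in> {1..card V} \<Longrightarrow> enum_perm n V i = ?l ! (i - 1)" for i
    by (simp_all add: enum_perm_def)
  show "strict_mono_on {1..card V} (enum_perm n V)"
    by (rule strict_mono_onI) (use less eq in simp)
  have "enum_perm n V ` {1..card V} = (\<lambda>i. ?l ! (i - 1)) ` {1..card V}"
    by (rule image_cong) (use eq in auto)
  also have "\<dots> = V"
    using card_subset_eq[OF fin img] card_image[OF inj] by simp
  finally show "enum_perm n V ` {1..card V} = V" .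
qed

text \<open>What remains of a permutation when the set onto which it maps \<open>R\<close> is
  forgotten: its order pattern on \<open>R\<close> and its behavior elsewhere.\<close>

definition perms_onto :: "nat \<Rightarrow> nat set \<Rightarrow> (nat \<Rightarrow> nat) set" where
  "perms_onto n R = {p\<in>perms n. p ` R = {1..card R}}"

lemma finite_perms_onto [simp]: "finite (perms_onto n R)"
  unfolding perms_onto_def by (rule finite_subset[of _ "perms n"]) auto

text \<open>The independence of image set and order pattern. Each permutation factors uniquely as
  \<open>enum_perm n V \<circ> p\<close>: the set \<open>V\<close> is the image of \<open>R\<close>,
  and \<open>p\<close> follows by cancelling the enumeration.\<close>

lemma pmf_of_set_perms_decompose:
  assumes R: "R \<subseteq> {1..n}"
  shows "pmf_of_set (perms n) = bind_pmf (pmf_of_set (nsets {1..n} (card R)))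
    (\<lambda>V. map_pmf (\<lambda>p. enum_perm n V \<circ> p) (pmf_of_set (perms_onto n R)))"
proof -
  let ?Q = "card R" and ?N = "nsets {1..n} (card R)" and ?P = "perms_onto n R"
  let ?f = "\<lambda>(V, p). enum_perm n V \<circ> p"
  have fin: "finite ?N" "finite ?P"
    by (auto simp: finite_imp_finite_nsets)
  have V: "V \<subseteq> {1..n}" "card V = ?Q" if "V \<in> ?N" for V using that by (auto simp: nsets_def)
  have imgR: "(enum_perm n V \<circ> p) ` R = V" if "V \<in> ?N" "p \<in> ?P" for V p
  proof -
    have "p ` R = {1..?Q}" using that(2) by (simp add: perms_onto_def)
    then have "(enum_perm n V \<circ> p) ` R = enum_perm n V ` {1..?Q}" by (simp only: image_comp[symmetric])
    then show ?thesis using V[OF that(1)] enum_perm(4)[OF V(1)[OF that(1)]] by simp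
  qed
  have inj: "inj_on ?f (?N \<times> ?P)"
  proof (rule inj_onI)
    fix a b assume a: "a \<in> ?N \<times> ?P" and b: "b \<in> ?N \<times> ?P" and eq: "?f a = ?f b"
    obtain V p W q where ab: "a = (V, p)" "b = (W, q)" by (cases a, cases b) auto
    have mem: "V \<in> ?N" "p \<in> ?P" "W \<in> ?N" "q \<in> ?P" using a b unfolding ab by simp_all
    have eq: "enum_perm n V \<circ> p = enum_perm n W \<circ> q" using eq unfolding ab by simp
    have VW: "V = W" using imgR[OF mem(1,2)] imgR[OF mem(3,4)] unfolding eq by (rule trans[OF sym])
    have "inj (enum_perm n W)" using enum_perm(1)[OF V(1)[OF mem(3)]] by (rule permutes_inj)
    then have "p = q" using eq unfolding VW by (auto simp: fun_eq_iff inj_eq)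
    then show "a = b" using VW ab by simp
  qed
  moreover have "?f ` (?N \<times> ?P) = perms n"
  proof (intro equalityI subsetI)
    fix r assume "r \<in> ?f ` (?N \<times> ?P)"
    then show "r \<in> perms n"
      using enum_perm(1)[OF V(1)] by (auto simp: perms_onto_def intro!: permutes_compose)
  next
    fix r assume r: "r \<in> perms n"
    define W where "W = r ` R"
    have W: "W \<in> ?N"
      using r R permutes_image[of r "{1..n}"] card_image[OF permutes_inj_on[of r "{1..n}" R]]
      by (auto simp: nsets_def W_def intro: finite_subset)
    note k = enum_perm[OF V(1)[OF W]]
    have "inv (enum_perm n W) ` W = {1..?Q}"
      using k(4) V(2)[OF W] by (metis (no_types) image_inv_f_f k(1) permutes_inj)
    then have "(inv (enum_perm n W) \<circ> r) ` R = {1..?Q}" by (simp only: image_comp[symmetric] W_def)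
    moreover have "inv (enum_perm n W) \<circ> r permutes {1..n}"
      using r k(1) by (intro permutes_compose permutes_inv) simp_all
    ultimately have "inv (enum_perm n W) \<circ> r \<in> ?P" by (simp add: perms_onto_def)
    moreover have "r = ?f (W, inv (enum_perm n W) \<circ> r)"
      by (simp add: o_assoc permutes_inv_o[OF k(1)])
    ultimately show "r \<in> ?f ` (?N \<times> ?P)" using W by blast
  qed
  ultimately have bij: "bij_betw ?f (?N \<times> ?P) (perms n)" by (simp add: bij_betw_def)
  have ne: "?N \<times> ?P \<noteq> {}" using bij perms_nonempty[of n]
    by (metis bij_betw_empty1 bij_betw_imp_surj_on image_empty)
  have "pmf_of_set (perms n) = map_pmf ?f (pmf_of_set (?N \<times> ?P))"
    using bij ne fin by (intro map_pmf_of_set_bij_betw[symmetric]) auto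
  also have "pmf_of_set (?N \<times> ?P) = pair_pmf (pmf_of_set ?N) (pmf_of_set ?P)"
  proof (rule pmf_eqI)
    fix z
    have "?N \<noteq> {}" "?P \<noteq> {}" "finite (?N \<times> ?P)" using ne fin by auto
    then show "pmf (pmf_of_set (?N \<times> ?P)) z = pmf (pair_pmf (pmf_of_set ?N) (pmf_of_set ?P)) z"
      using ne fin by (cases z) (simp add: pmf_pair indicator_def card_cartesian_product)
  qed
  finally show ?thesis
    by (simp add: pair_pmf_def map_bind_pmf map_pmf_def bind_assoc_pmf bind_return_pmf o_def)
qed

lemma induced_tuple_enum_perm:
  assumes "V \<subseteq> {1..n}" "e \<in> edges (card V)"
  shows "induced_tuple V G e = G (enum_perm n V ` e)"
proof -
  have "(\<lambda>i. sorted_list_of_set V ! (i - 1)) ` e = enum_perm n V ` e"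
    by (rule image_cong[OF refl], rule enum_perm(2)[OF assms(1), symmetric])
       (use assms(2) in \<open>auto simp: edges_def nsets_def\<close>)
  then show ?thesis using assms(2) by (simp add: induced_tuple_def)
qed

text \<open>A tree reading at most \<open>s\<close> vertices needs the random permutation only on
  their residue classes, at most \<open>s * c\<close> vertices in all. A sample of size
  \<open>Q\<close> plays the role of the image of these classes, and the remaining randomness is
  tossed by the decision rule.\<close>

lemma canonical_simulation:
  fixes T :: "'c query_tree pmf" and \<phi> :: "nat set \<Rightarrow> 'c \<Rightarrow> 'c"
  assumes UA: "A \<subseteq> edges n \<rightarrow>\<^sub>E S"
    and \<phi>: "\<And>G p. G \<in> A \<Longrightarrow> p permutes {1..n} \<Longrightarrow>
      (\<lambda>e\<in>edges n. \<phi> e (relabel p G e)) \<in> A"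
    and T: "\<And>t. t \<in> set_pmf T \<Longrightarrow> \<exists>W\<subseteq>{1..n}. card W \<le> s
      \<and> depends_on n S W t"
    and c: "\<And>u. u \<in> {1..n} \<Longrightarrow> card (residue_class n m u) \<le> c"
    and Q: "s * c \<le> Q" "Q \<le> n"
  shows "\<exists>D. \<forall>G\<in>A. bind_pmf (pmf_of_set (nsets {1..n} Q)) (\<lambda>V. D
    (induced_tuple V G)) =
    bind_pmf (pmf_of_set (perms n))
      (\<lambda>p. map_pmf (run_tree (\<lambda>e\<in>edges n. \<phi> e (relabel (sort_residues n m p) G
        e))) T)"
proof -
  \<comment> \<open>All sets \<open>R\<close> are padded to the same size \<open>Q\<close>, so that
    a single sample drawn independently of the tree serves every tree.\<close>
  have "\<exists>W R. W \<subseteq> {1..n} \<and> depends_on n S W t \<and> (\<Union>u\<in>W.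
    residue_class n m u) \<subseteq> R \<and> R \<subseteq> {1..n} \<and> card R = Q"
    if t: "t \<in> set_pmf T" for t
  proof -
    obtain W where W: "W \<subseteq> {1..n}" "card W \<le> s" "depends_on n S W t" using T[OF t] by blast
    have finW: "finite W" using W(1) finite_subset by blast
    have "card (\<Union>u\<in>W. residue_class n m u) \<le> (\<Sum>u\<in>W. card (residue_class n m u))"
      by (rule card_UN_le[OF finW])
    also have "\<dots> \<le> (\<Sum>u\<in>W. c)" using c W(1) by (intro sum_mono) blast
    also have "\<dots> \<le> s * c" using W(2) by simp
    also note Q(1)
    finally have "card (\<Union>u\<in>W. residue_class n m u) \<le> Q" .
    moreover have "(\<Union>u\<in>W. residue_class n m u) \<subseteq> {1..n}"
      by (auto simp: residue_class_def)
    ultimately obtain R where "(\<Union>u\<in>W. residue_class n m u) \<subseteq> R" "R \<subseteq>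
      {1..n}" "card R = Q"
      using exists_subset_between[of "\<Union>u\<in>W. residue_class n m u" Q "{1..n}"] Q(2) by auto
    then show ?thesis using W by blast
  qed
  then obtain W R where WR: "\<And>t. t \<in> set_pmf T \<Longrightarrow> W t \<subseteq> {1..n}"
    "\<And>t. t \<in> set_pmf T \<Longrightarrow> depends_on n S (W t) t"
    "\<And>t. t \<in> set_pmf T \<Longrightarrow> (\<Union>u\<in>W t. residue_class n m u) \<subseteq> R t"
    "\<And>t. t \<in> set_pmf T \<Longrightarrow> R t \<subseteq> {1..n}"
    "\<And>t. t \<in> set_pmf T \<Longrightarrow> card (R t) = Q" by metis
  let ?s = "sort_residues n m"
  let ?N = "pmf_of_set (nsets {1..n} Q)"
  \<comment> \<open>The part of the relabeled graph that the sample reveals. Outside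
    \<open>W t\<close> any color of \<open>S\<close> does, because the tree ignores it; it must lie
    in \<open>S\<close> for \<open>depends_on\<close> to apply.\<close>
  define view where "view t p H = (\<lambda>e\<in>edges n. if e \<subseteq> W t then \<phi> e (H (?s p `
    e)) else (SOME c. c \<in> S))" for t p H
  define D where "D H = bind_pmf T (\<lambda>t. map_pmf (\<lambda>p. run_tree (view t p H) t) (pmf_of_set
    (perms_onto n (R t))))" for H
  \<comment> \<open>The verdict in the process to be simulated. The coupling \<open>sim\<close>
    makes it agree with the simulated verdict for each choice of \<open>t\<close>, \<open>V\<close>
    and \<open>p\<close>.\<close>
  define F where "F G t p = run_tree (\<lambda>e\<in>edges n. \<phi> e (relabel (?s p) G e)) t" for G t p
  have sim: "F G t (enum_perm n V \<circ> p) = run_tree (view t p (induced_tuple V G)) t"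
    if G: "G \<in> A" and t: "t \<in> set_pmf T" and V: "V \<in> nsets {1..n} Q" and p: "p \<in>
      perms_onto n (R t)" for G t V p
  proof -
    let ?k = "enum_perm n V"
    have V': "V \<subseteq> {1..n}" "card V = Q" using V by (auto simp: nsets_def)
    have p': "p permutes {1..n}" "p ` R t = {1..Q}" using p WR(5)[OF t] by (auto simp: perms_onto_def)
    have kp: "?k \<circ> p permutes {1..n}" using p'(1) enum_perm(1)[OF V'(1)] by (rule permutes_compose)
    note skp = sort_residues_permutes[OF kp, of m]
    \<comment> \<open>For vertices in \<open>W t\<close> the image of the class lies in
      \<open>{1..Q}\<close>, where the enumeration of \<open>V\<close> is increasing, so sorting
      before and after the enumeration agree.\<close>
    have vertex: "?s (?k \<circ> p) u = ?k (?s p u)" "?s p u \<in> {1..Q}" if u: "u \<in> W t" for u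
    proof -
      have un: "u \<in> {1..n}" using u WR(1)[OF t] by blast
      have sub: "p ` residue_class n m u \<subseteq> {1..Q}"
        unfolding p'(2)[symmetric] using u WR(3)[OF t] by (intro image_mono) blast
      then show "?s p u \<in> {1..Q}" using sort_residues_rank(1)[OF permutes_inj[OF p'(1)] un] by blast
      have "strict_mono_on (p ` residue_class n m u) ?k"
        using enum_perm(3)[OF V'(1)] sub V'(2) by (auto simp: strict_mono_on_def subset_iff)
      then show "?s (?k \<circ> p) u = ?k (?s p u)"
        by (rule sort_residues_compose[OF permutes_inj[OF p'(1)] un])
    qed
    have edge: "relabel (?s (?k \<circ> p)) G e = induced_tuple V G (?s p ` e)"
      if e: "e \<in> edges n" "e \<subseteq> W t" for e
    proof -
      have "?s p ` e \<in> edges Q"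
        by (rule edges_image[OF permutes_inj_on[OF sort_residues_permutes[OF p'(1)]] _ e(2) e(1)])
           (use vertex(2) in blast)
      then have "induced_tuple V G (?s p ` e) = G (?k ` ?s p ` e)"
        using induced_tuple_enum_perm[OF V'(1)] V'(2) by simp
      also have "?k ` ?s p ` e = ?s (?k \<circ> p) ` e"
        using vertex(1) e(2) by (auto simp: image_image intro!: image_cong)
      finally show ?thesis by (simp add: relabel_def)
    qed
    let ?G = "\<lambda>e\<in>edges n. \<phi> e (relabel (?s (?k \<circ> p)) G e)"
    have GS: "?G \<in> edges n \<rightarrow>\<^sub>E S" using \<phi>[OF G skp] UA by blast
    have "view t p (induced_tuple V G) \<in> edges n \<rightarrow>\<^sub>E S"
    proof (rule PiE_I)
      fix e assume e: "e \<in> edges n"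
      then have ex: "?G e \<in> S" using GS by blast
      \<comment> \<open>An edge forces \<open>S\<close> to be nonempty, which legitimates the
        default color.\<close>
      then have "(SOME c. c \<in> S) \<in> S" by (rule someI)
      then show "view t p (induced_tuple V G) e \<in> S" using e ex edge[OF e] by (auto simp: view_def)
    qed (simp add: view_def)
    moreover have "\<forall>e\<in>edges n. e \<subseteq> W t \<longrightarrow> ?G e = view t p
      (induced_tuple V G) e"
      using edge by (simp add: view_def)
    ultimately show ?thesis using WR(2)[OF t] GS unfolding F_def depends_on_def by blast
  qed
  have "bind_pmf ?N (\<lambda>V. D (induced_tuple V G)) =
    bind_pmf (pmf_of_set (perms n)) (\<lambda>p. map_pmf (\<lambda>t. F G t p) T)" if G: "G \<in> A" for G
  proof -
    have ne: "nsets {1..n} Q \<noteq> {}" using Q(2) by (simp add: nsets_eq_empty_iff)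
    have fin: "finite (nsets {1..n} Q)" by (simp add: finite_imp_finite_nsets)
    \<comment> \<open>Drawing the tree first makes \<open>R t\<close> available for decomposing the
      permutation; the sample is moved back to the front at the end.\<close>
    have "bind_pmf (pmf_of_set (perms n)) (\<lambda>p. map_pmf (\<lambda>t. F G t p) T) =
        bind_pmf T (\<lambda>t. map_pmf (F G t) (pmf_of_set (perms n)))"
      unfolding map_pmf_def by (rule bind_commute_pmf)
    also have "\<dots> = bind_pmf T (\<lambda>t. bind_pmf ?N (\<lambda>V.
        map_pmf (\<lambda>p. run_tree (view t p (induced_tuple V G)) t) (pmf_of_set (perms_onto n (R t)))))"
    proof (rule bind_pmf_cong[OF refl])
      fix t assume t: "t \<in> set_pmf T"
      \<comment> \<open>\<open>pmf_of_set\<close> is meaningful only on nonempty sets. A bijection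
        of \<open>R t\<close> with an initial segment extends to a permutation.\<close>
      have ne': "perms_onto n (R t) \<noteq> {}"
      proof -
        obtain p where "p permutes {1..n}" "p ` R t = {1..card (R t)}"
        proof -
          have finR: "finite (R t)" using WR(4)[OF t] finite_subset by blast
          then obtain f where f: "bij_betw f (R t) {1..card (R t)}"
            using finite_same_card_bij[of "R t" "{1..card (R t)}"] by auto
          have "{1..card (R t)} \<subseteq> {1..n}" using WR(5)[OF t] Q(2) by auto
          then obtain p where "p permutes {1..n}" "\<And>a. a \<in> R t \<Longrightarrow> p a = f a"
            using extend_to_permutation[of "{1..n}" f "R t"] f WR(4)[OF t] by (auto simp: bij_betw_def)
          moreover have "p ` R t = f ` R t" using calculation(2) by (intro image_cong) auto
          ultimately show ?thesis using that f by (simp add: bij_betw_def)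
        qed
        then show ?thesis by (auto simp: perms_onto_def)
      qed
      have fin': "finite (perms_onto n (R t))" by simp
      have "map_pmf (F G t) (pmf_of_set (perms n)) = bind_pmf ?N (\<lambda>V.
          map_pmf (F G t \<circ> (\<lambda>p. enum_perm n V \<circ> p)) (pmf_of_set (perms_onto n (R t))))"
        using pmf_of_set_perms_decompose[OF WR(4)[OF t]] WR(5)[OF t]
        by (simp only: map_bind_pmf pmf.map_comp)
      also have "\<dots> = bind_pmf ?N (\<lambda>V.
          map_pmf (\<lambda>p. run_tree (view t p (induced_tuple V G)) t) (pmf_of_set (perms_onto n (R t))))"
      proof (intro bind_pmf_cong map_pmf_cong refl)
        fix V p assume "V \<in> set_pmf ?N" "p \<in> set_pmf (pmf_of_set (perms_onto n (R t)))"
        then have "V \<in> nsets {1..n} Q" "p \<in> perms_onto n (R t)"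
          using set_pmf_of_set[OF ne fin] set_pmf_of_set[OF ne' fin'] by auto
        then show "(F G t \<circ> (\<lambda>p. enum_perm n V \<circ> p)) p = run_tree (view t p
          (induced_tuple V G)) t"
          using sim[OF G t] by simp
      qed
      finally show "map_pmf (F G t) (pmf_of_set (perms n)) = bind_pmf ?N (\<lambda>V.
          map_pmf (\<lambda>p. run_tree (view t p (induced_tuple V G)) t) (pmf_of_set (perms_onto n (R
            t))))" .
    qed
    also have "\<dots> = bind_pmf ?N (\<lambda>V. D (induced_tuple V G))"
      unfolding D_def by (rule bind_commute_pmf)
    finally show ?thesis by simp
  qed
  then show ?thesis unfolding F_def by blast
qed


section \<open>Stability of canonical tests\<close>

lemma induced_tuple_in_PiE:
  assumes "V \<subseteq> {1..n}" "G \<in> edges n \<rightarrow>\<^sub>E S"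
  shows "induced_tuple V G \<in> edges (card V) \<rightarrow>\<^sub>E S"
proof (rule PiE_I)
  fix e assume e: "e \<in> edges (card V)"
  have "enum_perm n V ` e \<in> edges n"
    by (rule edges_image[OF permutes_inj_on[OF enum_perm(1)[OF assms(1)]] _ subset_refl e])
       (use e enum_perm(4)[OF assms(1)] assms(1) in \<open>force simp: edges_def nsets_def\<close>)
  then show "induced_tuple V G e \<in> S"
    using assms(2) by (auto simp: induced_tuple_enum_perm[OF assms(1) e])
qed (simp add: induced_tuple_def)

lemma induced_tuple_cong:
  assumes "V \<subseteq> {1..n}" "\<And>e. e \<in> edges n \<Longrightarrow> e \<subseteq> V
    \<Longrightarrow> G e = H e"
  shows "induced_tuple V G = induced_tuple V H"
proof
  fix e
  show "induced_tuple V G e = induced_tuple V H e"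
  proof (cases "e \<in> edges (card V)")
    case True
    have "e \<subseteq> {1..card V}" using True by (simp add: edges_def nsets_def)
    then have sub: "enum_perm n V ` e \<subseteq> V" using enum_perm(4)[OF assms(1)] by blast
    have "enum_perm n V ` e \<in> edges n"
      by (rule edges_image[OF permutes_inj_on[OF enum_perm(1)[OF assms(1)]] _ subset_refl True])
         (use sub assms(1) in blast)
    then show ?thesis
      using assms(2) sub by (simp add: induced_tuple_enum_perm[OF assms(1) True])
  qed (simp add: induced_tuple_def)
qed

lemma pmf_canonical_algorithm:
  "pmf (canonical_algorithm q D n G) x =
    (\<Sum>V\<in>nsets {1..n} (min q n). pmf (D n (induced_tuple V G)) x) / (n choose min q n)"
proof -
  have ne: "nsets {1..n} (min q n) \<noteq> {}" by (simp add: nsets_eq_empty_iff)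
  have "card (nsets {1..n} (min q n)) = n choose min q n"
  proof -
    have "nsets {1..n} (min q n) = {V. V \<subseteq> {1..n} \<and> card V = min q n}"
      by (auto simp: nsets_def intro: finite_subset)
    then show ?thesis by (simp add: n_subsets)
  qed
  then show ?thesis
    unfolding canonical_algorithm_def
    by (subst pmf_bind_pmf_of_set) (use ne in \<open>simp_all add: finite_imp_finite_nsets\<close>)
qed

text \<open>Double counting of a pair inside an \<open>r\<close>-set. Divided out, it is the
  probability that a random \<open>r\<close>-set contains a fixed pair.\<close>

lemma card_nsets_containing_edge:
  assumes e: "e \<in> edges n" and r: "r \<le> n"
  shows "card {V\<in>nsets {1..n} r. e \<subseteq> V} * (n choose 2) = (n choose r) * (r choose 2)"
proof -
  have e': "e \<subseteq> {1..n}" "finite e" "card e = 2" using e by (auto simp: edges_def nsets_def)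
  show ?thesis
  proof (cases "r < 2")
    case True
    have "\<not> e \<subseteq> V" if "V \<in> nsets {1..n} r" for V
    proof
      assume "e \<subseteq> V"
      then have "card e \<le> card V" using that by (intro card_mono) (auto simp: nsets_def)
      then show False using that True e'(3) by (simp add: nsets_def)
    qed
    then have "{V\<in>nsets {1..n} r. e \<subseteq> V} = {}" by blast
    then show ?thesis using True by (simp only: card.empty) simp
  next
    case False
    have "bij_betw (\<lambda>V. V - e) {V\<in>nsets {1..n} r. e \<subseteq> V} {W. W \<subseteq> {1..n} -
      e \<and> card W = r - 2}"
    proof (rule bij_betwI[where g = "\<lambda>W. W \<union> e"])
      show "(\<lambda>V. V - e) \<in> {V\<in>nsets {1..n} r. e \<subseteq> V} \<rightarrow> {W. W
        \<subseteq> {1..n} - e \<and> card W = r - 2}"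
        using e' by (auto simp: nsets_def card_Diff_subset)
      show "(\<lambda>W. W \<union> e) \<in> {W. W \<subseteq> {1..n} - e \<and> card W = r - 2}
        \<rightarrow> {V\<in>nsets {1..n} r. e \<subseteq> V}"
      proof
        fix W assume W: "W \<in> {W. W \<subseteq> {1..n} - e \<and> card W = r - 2}"
        then have finW: "finite W" using finite_subset[of W "{1..n}"] by auto
        have "card (W \<union> e) = card W + card e" using W finW e' by (intro card_Un_disjoint) auto
        then show "W \<union> e \<in> {V\<in>nsets {1..n} r. e \<subseteq> V}" using W finW e' False
          by (auto simp: nsets_def)
      qed
    qed auto
    then have "card {V\<in>nsets {1..n} r. e \<subseteq> V} = card {W. W \<subseteq> {1..n} - e \<and>
      card W = r - 2}"
      by (rule bij_betw_same_card)
    also have "\<dots> = card ({1..n} - e) choose (r - 2)" by (intro n_subsets) simp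
    also have "card ({1..n} - e) = n - 2" using e' by (simp add: card_Diff_subset)
    finally show ?thesis using choose_mult[of 2 r n] False r by (simp add: mult.commute)
  qed
qed

text \<open>A union bound over the event that the sample contains some edge of \<open>B\<close>. It
  serves both kinds of perturbation: changed colors, and a single edge for a basic move.\<close>

lemma canonical_acceptance_diff:
  fixes f g :: "nat set \<Rightarrow> real"
  assumes fg: "\<And>V. 0 \<le> f V" "\<And>V. f V \<le> 1" "\<And>V. 0 \<le> g V" "\<And>V. g V \<le> 1"
    and eq: "\<And>V. V \<in> nsets {1..n} r \<Longrightarrow> (\<And>e. e \<in> B \<Longrightarrow>
      \<not> e \<subseteq> V) \<Longrightarrow> f V = g V"
    and B: "B \<subseteq> edges n" and r: "r \<le> n"
  shows "\<bar>(\<Sum>V\<in>nsets {1..n} r. f V) / (n choose r) - (\<Sum>V\<in>nsets {1..n} r. g V) / (n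
    choose r)\<bar>
    \<le> real (card B) * real (r choose 2) / real (n choose 2)"
proof -
  let ?N = "nsets {1..n} r"
  let ?bad = "\<Union>e\<in>B. {V\<in>?N. e \<subseteq> V}"
  have finN: "finite ?N" by (simp add: finite_imp_finite_nsets)
  have finB: "finite B" using B finite_edges finite_subset by blast
  have "\<bar>(\<Sum>V\<in>?N. f V) - (\<Sum>V\<in>?N. g V)\<bar> = \<bar>\<Sum>V\<in>?N. f V - g
    V\<bar>" by (simp add: sum_subtractf)
  also have "\<dots> \<le> (\<Sum>V\<in>?N. \<bar>f V - g V\<bar>)" by (rule sum_abs)
  also have "\<dots> \<le> (\<Sum>V\<in>?N. if V \<in> ?bad then 1 else 0)"
  proof (rule sum_mono)
    fix V assume V: "V \<in> ?N"
    show "\<bar>f V - g V\<bar> \<le> (if V \<in> ?bad then 1 else 0)"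
    proof (cases "V \<in> ?bad")
      case True
      then show ?thesis using fg(1,2)[of V] fg(3,4)[of V] by (simp add: abs_le_iff)
    next
      case False
      then have "f V = g V" using eq[OF V] V by blast
      then show ?thesis by simp
    qed
  qed
  also have "\<dots> = real (card {V\<in>?N. V \<in> ?bad})" using finN by (simp add: sum.If_cases Int_def)
  also have "{V\<in>?N. V \<in> ?bad} = ?bad" by blast
  also have "real (card ?bad) \<le> real (\<Sum>e\<in>B. card {V\<in>?N. e \<subseteq> V})"
    using card_UN_le[OF finB] by (simp only: of_nat_le_iff)
  finally have 1: "\<bar>(\<Sum>V\<in>?N. f V) - (\<Sum>V\<in>?N. g V)\<bar> \<le> (\<Sum>e\<in>B. real
    (card {V\<in>?N. e \<subseteq> V}))" by simp
  show ?thesis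
  proof (cases "n choose 2 = 0")
    case True
    then have "card (edges n) = 0" by (simp only: card_edges)
    then have "edges n = {}" by simp
    then have "B = {}" using B by blast
    then show ?thesis using 1 by simp
  next
    case False
    have pos: "real (n choose 2) > 0" "real (n choose r) > 0" using False r by simp_all
    have "real (card {V\<in>?N. e \<subseteq> V}) = real (n choose r) * real (r choose 2) / real (n
      choose 2)" if "e \<in> B" for e
    proof -
      have "real (card {V\<in>?N. e \<subseteq> V} * (n choose 2)) = real ((n choose r) * (r choose 2))"
        using card_nsets_containing_edge[OF subsetD[OF B that] r] by simp
      then show ?thesis using pos by (simp add: field_simps)
    qed
    then have "\<bar>(\<Sum>V\<in>?N. f V) - (\<Sum>V\<in>?N. g V)\<bar> \<le> (\<Sum>e\<in>B. real (n
      choose r) * real (r choose 2) / real (n choose 2))"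
      using 1 by simp
    also have "\<dots> = real (card B) * real (r choose 2) / real (n choose 2) * real (n choose r)" by simp
    finally have "\<bar>(\<Sum>V\<in>?N. f V) - (\<Sum>V\<in>?N. g V)\<bar> / real (n choose r) \<le>
        real (card B) * real (r choose 2) / real (n choose 2)"
      using pos(2) by (simp add: pos_divide_le_eq)
    then show ?thesis using pos(2) by (simp add: abs_divide flip: diff_divide_distrib)
  qed
qed

lemma canonical_hamming_stable:
  "\<bar>pmf (canonical_algorithm q D n G) x - pmf (canonical_algorithm q D n H) x\<bar>
    \<le> hamming_dist n G H * real (min q n choose 2)"
proof -
  let ?B = "{e\<in>edges n. G e \<noteq> H e}"
  have "\<bar>pmf (canonical_algorithm q D n G) x - pmf (canonical_algorithm q D n H) x\<bar>
      \<le> real (card ?B) * real (min q n choose 2) / real (n choose 2)"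
    unfolding pmf_canonical_algorithm
  proof (rule canonical_acceptance_diff)
    fix V assume "V \<in> nsets {1..n} (min q n)" "\<And>e. e \<in> ?B \<Longrightarrow> \<not> e
      \<subseteq> V"
    then have "induced_tuple V G = induced_tuple V H"
      by (intro induced_tuple_cong[of V n]) (auto simp: nsets_def)
    then show "pmf (D n (induced_tuple V G)) x = pmf (D n (induced_tuple V H)) x" by simp
  qed (auto simp: pmf_le_1)
  then show ?thesis by (simp add: hamming_dist_def)
qed

text \<open>The sample \<open>V\<close> in \<open>G'\<close> is paired with its image under the
  transposition in \<open>G\<close>, which is again uniform. The two tuples agree unless
  \<open>V\<close> contains both swapped vertices.\<close>

lemma canonical_move_stable:
  assumes "basic_move n G G'"
  shows "\<bar>pmf (canonical_algorithm q D n G') x - pmf (canonical_algorithm q D n G) x\<bar>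
    \<le> real (min q n choose 2) / real (n choose 2)"
proof -
  let ?r = "min q n"
  obtain y where y: "y \<in> {1..<n}" "G' = (\<lambda>e. G (Transposition.transpose y (y + 1) ` e))"
    using assms by (auto simp: basic_move_def)
  let ?s = "Transposition.transpose y (y + 1)"
  have s: "?s permutes {1..n}" using y by (intro permutes_swap_id) auto
  have edge: "{{y, y + 1}} \<subseteq> edges n" using y by (simp add: edges_def)
  have "bij_betw ((`) ?s) (nsets {1..n} ?r) (nsets {1..n} ?r)"
    by (rule bij_betw_nsets[OF permutes_imp_bij[OF s]])
  then have "(\<Sum>V\<in>nsets {1..n} ?r. pmf (D n (induced_tuple V G)) x) =
      (\<Sum>V\<in>nsets {1..n} ?r. pmf (D n (induced_tuple (?s ` V) G)) x)"
    by (rule sum.reindex_bij_betw[symmetric])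
  then have "\<bar>pmf (canonical_algorithm q D n G') x - pmf (canonical_algorithm q D n G) x\<bar> =
     \<bar>(\<Sum>V\<in>nsets {1..n} ?r. pmf (D n (induced_tuple V G')) x) / (n choose ?r) -
      (\<Sum>V\<in>nsets {1..n} ?r. pmf (D n (induced_tuple (?s ` V) G)) x) / (n choose ?r)\<bar>"
    by (simp add: pmf_canonical_algorithm)
  also have "\<dots> \<le> real (card {{y, y + 1}}) * real (?r choose 2) / real (n choose 2)"
  proof (rule canonical_acceptance_diff[OF _ _ _ _ _ edge])
    fix V assume V: "V \<in> nsets {1..n} ?r" and "\<And>e. e \<in> {{y, y + 1}} \<Longrightarrow> \<not>
      e \<subseteq> V"
    then have nV: "\<not> (y \<in> V \<and> y + 1 \<in> V)" by simp
    have finV: "finite V" using V by (simp add: nsets_def)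
    \<comment> \<open>Swapping neighbors preserves the order of a set that misses one of them, so
      positions in the two tuples correspond.\<close>
    have mono: "strict_mono_on V ?s"
    proof (rule strict_mono_onI)
      fix a b assume "a \<in> V" "b \<in> V" "a < b"
      moreover from this have "\<not> (a = y \<and> b = y + 1)" using nV by blast
      ultimately show "?s a < ?s b" unfolding Transposition.transpose_def by (auto split: if_splits)
    qed
    have cV: "card (?s ` V) = card V" using permutes_inj_on[OF s] by (intro card_image)
    have "induced_tuple V G' = induced_tuple (?s ` V) G"
    proof
      fix e
      show "induced_tuple V G' e = induced_tuple (?s ` V) G e"
      proof (cases "e \<in> edges (card V)")
        case True
        have "(\<lambda>i. sorted_list_of_set (?s ` V) ! (i - 1)) ` e = (\<lambda>i. ?s
          (sorted_list_of_set V ! (i - 1))) ` e"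
        proof (rule image_cong[OF refl])
          fix i assume "i \<in> e"
          then have "i \<in> {1..card V}" using True by (auto simp: edges_def nsets_def)
          then have "i - 1 < card V" by auto
          then show "sorted_list_of_set (?s ` V) ! (i - 1) = ?s (sorted_list_of_set V ! (i - 1))"
            by (rule sorted_list_nth_image[OF finV mono])
        qed
        then show ?thesis using True cV by (simp add: induced_tuple_def y(2) image_image)
      qed (use cV in \<open>simp add: induced_tuple_def\<close>)
    qed
    then show "pmf (D n (induced_tuple V G')) x = pmf (D n (induced_tuple (?s ` V) G)) x" by simp
  qed (auto simp: pmf_le_1)
  finally show ?thesis by simp
qed

lemma canonical_moves_stable:
  "(basic_move n ^^ k) G G' \<Longrightarrow>
    \<bar>pmf (canonical_algorithm q D n G') x - pmf (canonical_algorithm q D n G) x\<bar>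
    \<le> real k * (real (min q n choose 2) / real (n choose 2))"
proof (induction k arbitrary: G')
  case (Suc k)
  then obtain K where K: "(basic_move n ^^ k) G K" "basic_move n K G'" by auto
  let ?z = "real (min q n choose 2) / real (n choose 2)"
  have "real (Suc k) * ?z = real k * ?z + ?z" by (simp add: distrib_right add_divide_distrib)
  then show ?case using Suc.IH[OF K(1)] canonical_move_stable[OF K(2), of q D x] by linarith
qed simp

text \<open>A finite distance excludes an empty set of move counts, and a nonempty set of natural
  numbers attains its infimum.\<close>

lemma earthmover_dist_leE:
  assumes "earthmover_dist n G G' \<le> ereal d" "0 \<le> d"
  obtains k where "(basic_move n ^^ k) G G'" "real k \<le> d * real (n choose 2)"
proof -
  let ?K = "{k. (basic_move n ^^ k) G G'}"
  have "?K \<noteq> {}"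
  proof
    assume "?K = {}"
    then have "min_moves n G G' = \<infinity>" unfolding min_moves_def by (simp add: top_enat_def)
    then have "earthmover_dist n G G' = \<infinity>"
      by (cases "n choose 2 = 0") (simp_all add: earthmover_dist_def divide_ereal_def)
    then show False using assms(1) by simp
  qed
  then obtain k0 where "k0 \<in> ?K" by blast
  then have "min_moves n G G' \<in> enat ` ?K"
    unfolding min_moves_def by (intro wellorder_InfI[of "enat k0"]) blast
  then obtain k where k: "(basic_move n ^^ k) G G'" "min_moves n G G' = enat k" by blast
  have "real k \<le> d * real (n choose 2)"
  \<comment> \<open>With fewer than two vertices there are no basic moves, so \<open>k = 0\<close>
    regardless of the division by zero.\<close>
  proof (cases "n choose 2 = 0")
    case True
    then have "\<not> basic_move n A B" for A B :: "'a graph" by (auto simp: basic_move_def)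
    then have "k = 0" using k(1) by (cases k) auto
    then show ?thesis using assms(2) by simp
  next
    case False
    then have "ereal (real k / real (n choose 2)) \<le> ereal d" using assms(1) k(2)
      by (simp add: earthmover_dist_def)
    then show ?thesis using False by (simp add: divide_le_eq)
  qed
  then show ?thesis using that k(1) by blast
qed

lemma choose_two_le_square: "real (min q n choose 2) \<le> real q ^ 2"
proof -
  have "min q n choose 2 \<le> min q n ^ 2"
  proof (cases "min q n < 2")
    case True
    then have "min q n choose 2 = 0" by (rule binomial_eq_0)
    then show ?thesis by (simp only: zero_le)
  next
    case False
    then show ?thesis by (intro binomial_le_pow) (simp only: not_less)
  qed
  also have "\<dots> \<le> q ^ 2" by (intro power_mono) auto
  finally show ?thesis by (simp flip: of_nat_power)
qed

section \<open>Canonical tests as query trees\<close>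

primrec read_tree :: "nat set list \<Rightarrow> 'c graph \<Rightarrow> ('c graph \<Rightarrow> bool)
  \<Rightarrow> 'c query_tree" where
  "read_tree [] h k = Decide (k h)"
| "read_tree (e # es) h k = Query e (\<lambda>c. read_tree es (h(e := c)) k)"

lemma run_read_tree: "run_tree G (read_tree es h k) = k (\<lambda>e. if e \<in> set es then G e else h e)"
proof (induction es arbitrary: h)
  case (Cons e es)
  have "(\<lambda>e'. if e' \<in> set es then G e' else (h(e := G e)) e') = (\<lambda>e'. if e' \<in> set
    (e # es) then G e' else h e')"
    by auto
  then show ?case using Cons by simp
qed simp

lemma queries_read_tree: "queries_at_most (read_tree es h k) (length es)"
  by (induction es arbitrary: h) auto

text \<open>A distribution over trees fixes all randomness before any answer, whereas
  \<open>D\<close> tosses coins after seeing the tuple. So a table of independent verdicts for all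
  possible tuples is drawn in advance, and the tree looks up one entry. Finiteness of
  \<open>S\<close> keeps the table finite.\<close>

lemma canonical_algorithm_as_trees:
  fixes D :: "nat \<Rightarrow> 'c graph \<Rightarrow> bool pmf"
  assumes "finite S" "\<And>n. U n \<subseteq> edges n \<rightarrow>\<^sub>E S"
  obtains T where "query_bound T (q choose 2)"
    "\<And>n G. G \<in> U n \<Longrightarrow> run T n G = canonical_algorithm q D n G"
proof -
  define es where "es V = (SOME es. set es = nsets V 2 \<and> length es = card V choose 2)" for V :: "nat set"
  have es: "set (es V) = nsets V 2" "length (es V) = card V choose 2" if fin: "finite V" for V
  proof -
    obtain l where l: "set l = nsets V 2" "distinct l"
      using finite_distinct_list[OF finite_imp_finite_nsets[OF fin]] by blast
    have "nsets V 2 = {e. e \<subseteq> V \<and> card e = 2}" using fin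
      by (auto simp: nsets_def intro: finite_subset)
    then have "length l = card V choose 2" using l distinct_card[OF l(2)] n_subsets[OF fin] by simp
    then have "\<exists>l. set l = nsets V 2 \<and> length l = card V choose 2" using l by blast
    from someI_ex[OF this] show "set (es V) = nsets V 2" "length (es V) = card V choose 2"
      by (simp_all add: es_def)
  qed
  define tr where "tr V \<psi> = read_tree (es V) (\<lambda>_. undefined) (\<lambda>H :: 'c graph. \<psi>
    (induced_tuple V H))" for V \<psi>
  define T where "T n = bind_pmf (pmf_of_set (nsets {1..n} (min q n)))
    (\<lambda>V. map_pmf (tr V) (Pi_pmf (edges (min q n) \<rightarrow>\<^sub>E S) False (D n)))" for n
  have V: "V \<subseteq> {1..n}" "finite V" "card V = min q n"
    if "V \<in> set_pmf (pmf_of_set (nsets {1..n} (min q n)))" for V n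
  proof -
    have "nsets {1..n} (min q n) \<noteq> {}" by (simp add: nsets_eq_empty_iff)
    then have "V \<in> nsets {1..n} (min q n)"
      using that set_pmf_of_set[of "nsets {1..n} (min q n)"] by (simp add: finite_imp_finite_nsets)
    then show "V \<subseteq> {1..n}" "finite V" "card V = min q n" by (simp_all add: nsets_def)
  qed
  show ?thesis
  proof (rule that[of T])
    have "queries_at_most (tr V \<psi>) (q choose 2)"
      if "V \<in> set_pmf (pmf_of_set (nsets {1..n} (min q n)))" for n V \<psi>
    proof (rule queries_at_most_mono)
      show "queries_at_most (tr V \<psi>) (length (es V))" unfolding tr_def by (rule queries_read_tree)
      show "length (es V) \<le> q choose 2"
        using es(2)[OF V(2)[OF that]] V(3)[OF that] by (simp add: binomial_right_mono)
    qed
    then show "query_bound T (q choose 2)" by (auto simp: query_bound_def T_def)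
  next
    fix n G assume G: "G \<in> U n"
    have "run T n G = bind_pmf (pmf_of_set (nsets {1..n} (min q n))) (\<lambda>V.
        map_pmf (\<lambda>\<psi>. run_tree G (tr V \<psi>)) (Pi_pmf (edges (min q n)
          \<rightarrow>\<^sub>E S) False (D n)))"
      by (simp add: run_def T_def map_bind_pmf pmf.map_comp o_def)
    also have "\<dots> = canonical_algorithm q D n G"
      unfolding canonical_algorithm_def
    proof (rule bind_pmf_cong[OF refl])
      fix V assume V': "V \<in> set_pmf (pmf_of_set (nsets {1..n} (min q n)))"
      note V = V[OF V']
      have "induced_tuple V (\<lambda>e. if e \<in> set (es V) then G e else undefined) = induced_tuple V G"
        by (rule induced_tuple_cong[OF V(1)]) (auto simp: es(1)[OF V(2)] edges_def nsets_def)
      then have "run_tree G (tr V \<psi>) = \<psi> (induced_tuple V G)" for \<psi>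
        by (simp add: tr_def run_read_tree)
      moreover have "induced_tuple V G \<in> edges (min q n) \<rightarrow>\<^sub>E S"
        using induced_tuple_in_PiE[OF V(1) subsetD[OF assms(2) G]] V(3) by simp
      moreover have "finite (edges (min q n) \<rightarrow>\<^sub>E S)" using assms(1)
        by (intro finite_PiE) auto
      ultimately show "map_pmf (\<lambda>\<psi>. run_tree G (tr V \<psi>)) (Pi_pmf (edges (min q n)
        \<rightarrow>\<^sub>E S) False (D n)) =
          D n (induced_tuple V G)"
        by (simp add: Pi_pmf_component)
    qed
    finally show "run T n G = canonical_algorithm q D n G" .
  qed
qed

text \<open>The factor \<open>60\<close> limits the change in acceptance probability to
  \<open>1/60 = 2/3 - 13/20\<close>. For resilience this already contradicts rejection with
  probability \<open>2/3\<close>; for tolerance the majority restores \<open>2/3\<close>. The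
  \<open>+ 1\<close> covers \<open>q \<epsilon> = 0\<close>.\<close>

lemma canonical_resilient_and_tolerant:
  fixes q :: "real \<Rightarrow> nat"
  defines "\<delta>' \<equiv> \<lambda>\<epsilon>. 1 / (60 * (real (q \<epsilon>) ^ 2 + 1))"
  assumes "finite \<Sigma>" "input_class \<Sigma> U" "property_of U P" "canonically_testable_with U q P"
  shows "earthmover_resilient U \<delta>' P" "tolerantly_testable U \<delta>' P"
proof -
  have PU: "P n \<subseteq> U n" for n using assms(4) by (simp add: property_of_def)
  have small: "\<delta>' \<epsilon> * real (min (q \<epsilon>) n choose 2) \<le> 1 / 60" for \<epsilon> n
  proof -
    have "real (min (q \<epsilon>) n choose 2) \<le> real (q \<epsilon>) ^ 2 + 1"
      using choose_two_le_square[of "q \<epsilon>" n] by linarith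
    moreover have "real (q \<epsilon>) ^ 2 + 1 > 0" by (simp add: add_nonneg_pos)
    ultimately show ?thesis by (simp add: \<delta>'_def divide_le_eq)
  qed
  have pos: "0 \<le> \<delta>' \<epsilon>" for \<epsilon> by (simp add: \<delta>'_def)
  show "earthmover_resilient U \<delta>' P"
    unfolding earthmover_resilient_def
  proof (intro ballI allI impI)
    fix \<epsilon> :: real and n G G'
    assume \<epsilon>: "\<epsilon> \<in> {0<..<1}" and G: "G \<in> P n" "G' \<in> U n" and d:
      "earthmover_dist n G G' \<le> ereal (\<delta>' \<epsilon>)"
    have "0 < \<epsilon>" using \<epsilon> by simp
    then obtain D where D: "is_test U P \<epsilon> (canonical_algorithm (q \<epsilon>) D)"
      using assms(5) unfolding canonically_testable_with_def by blast
    let ?A = "canonical_algorithm (q \<epsilon>) D n"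
    obtain k where k: "(basic_move n ^^ k) G G'" "real k \<le> \<delta>' \<epsilon> * real (n choose 2)"
      using earthmover_dist_leE[OF d pos] .
    have "real k * (real (min (q \<epsilon>) n choose 2) / real (n choose 2)) \<le> \<delta>' \<epsilon>
      * real (min (q \<epsilon>) n choose 2)"
    proof (cases "n choose 2 = 0")
      case False
      have "real k * (real (min (q \<epsilon>) n choose 2) / real (n choose 2)) =
          real k / real (n choose 2) * real (min (q \<epsilon>) n choose 2)" by simp
      also have "\<dots> \<le> \<delta>' \<epsilon> * real (min (q \<epsilon>) n choose 2)"
        using k(2) False by (intro mult_right_mono) (simp_all add: divide_le_eq)
      finally show ?thesis .
    qed (use pos in \<open>simp del: binomial_eq_0_iff\<close>)
    then have "\<bar>pmf (?A G') True - pmf (?A G) True\<bar> \<le> 1 / 60"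
      using canonical_moves_stable[OF k(1), of "q \<epsilon>" D True] small[of \<epsilon> n] by linarith
    moreover have "pmf (?A G) True \<ge> 2 / 3" using D G PU by (auto simp: is_test_def)
    moreover have "pmf (?A G') False = 1 - pmf (?A G') True" by (rule pmf_False_conv_True)
    ultimately have "pmf (?A G') False < 2 / 3" by linarith
    moreover have "far \<epsilon> n G' P \<longrightarrow> pmf (?A G') False \<ge> 2 / 3"
      using D G(2) unfolding is_test_def by blast
    ultimately show "close \<epsilon> n G' P" by linarith
  qed
  show "tolerantly_testable U \<delta>' P"
    unfolding tolerantly_testable_def
  proof
    fix \<epsilon> :: real assume \<epsilon>: "\<epsilon> \<in> {0<..<1}"
    then have "0 < \<epsilon>" by simp
    then obtain D where D: "is_test U P \<epsilon> (canonical_algorithm (q \<epsilon>) D)"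
      using assms(5) unfolding canonically_testable_with_def by blast
    obtain S where S: "finite S" "\<And>n. U n \<subseteq> edges n \<rightarrow>\<^sub>E S"
      using input_class_colors[OF assms(2,3)] by blast
    obtain T where T: "query_bound T (q \<epsilon> choose 2)"
      "\<And>n G. G \<in> U n \<Longrightarrow> run T n G = canonical_algorithm (q \<epsilon>) D n G"
      using canonical_algorithm_as_trees[where U = U, OF S] by blast
    have "is_tolerant_test U P \<epsilon> \<delta>' (run (tree_majority T))"
      unfolding is_tolerant_test_def
    proof (intro allI ballI conjI impI)
      fix n G assume G: "G \<in> U n"
      let ?A = "canonical_algorithm (q \<epsilon>) D n"
      have maj: "pmf (run (tree_majority T) n G) x \<ge> 2 / 3" if "pmf (?A G) x \<ge> 13 / 20" for x
        using pmf_maj_pmf_ge[OF that] T(2)[OF G] by (simp add: run_tree_majority)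
      show "pmf (run (tree_majority T) n G) True \<ge> 2 / 3" if c: "close (\<delta>' \<epsilon>) n G P"
      proof (rule maj)
        obtain H where H: "H \<in> P n" "hamming_dist n G H \<le> \<delta>' \<epsilon>"
          using closeE[OF c finite_property[OF assms(2-4)]] .
        have "hamming_dist n G H * real (min (q \<epsilon>) n choose 2) \<le> \<delta>' \<epsilon> * real
          (min (q \<epsilon>) n choose 2)"
          using H(2) by (intro mult_right_mono) auto
        then have "\<bar>pmf (?A G) True - pmf (?A H) True\<bar> \<le> 1 / 60"
          using canonical_hamming_stable[of "q \<epsilon>" D n G True H] small[of \<epsilon> n] by linarith
        moreover have "pmf (?A H) True \<ge> 2 / 3" using D H(1) PU by (auto simp: is_test_def)
        ultimately show "pmf (?A G) True \<ge> 13 / 20" by linarith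
      qed
      show "pmf (run (tree_majority T) n G) False \<ge> 2 / 3" if f: "far \<epsilon> n G P"
      proof (rule maj)
        have "pmf (?A G) False \<ge> 2 / 3" using D G f by (auto simp: is_test_def)
        then show "pmf (?A G) False \<ge> 13 / 20" by linarith
      qed
    qed
    then show "\<exists>q T. query_bound T q \<and> is_tolerant_test U P \<epsilon> \<delta>' (run T)"
      using query_bound_majority[OF T(1)] by blast
  qed
qed

text \<open>A polynomial with coefficients of both signs need not be monotone. A nonnegative
  multiple of a power is, which allows substituting one bound into another.\<close>

lemma poly_bounded_powerE:
  assumes "poly_bounded_in_inverse f"
  obtains c k where "c \<ge> 0" "\<And>\<epsilon>. \<epsilon> \<in> {0<..<1} \<Longrightarrow> f
    \<epsilon> \<le> c * (1 / \<epsilon>) ^ k"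
proof -
  obtain p :: "real poly" where p: "\<And>\<epsilon>. \<epsilon> \<in> {0<..<1} \<Longrightarrow> f
    \<epsilon> \<le> poly p (1 / \<epsilon>)"
    using assms unfolding poly_bounded_in_inverse_def by blast
  show ?thesis
  proof (rule that)
    show "0 \<le> (\<Sum>i\<le>degree p. \<bar>coeff p i\<bar>)" by (intro sum_nonneg) auto
    fix \<epsilon> :: real assume \<epsilon>: "\<epsilon> \<in> {0<..<1}"
    then have x: "1 \<le> 1 / \<epsilon>" by simp
    then have x0: "0 \<le> 1 / \<epsilon>" by linarith
    have "f \<epsilon> \<le> poly p (1 / \<epsilon>)" using p[OF \<epsilon>] .
    also have "\<dots> = (\<Sum>i\<le>degree p. coeff p i * (1 / \<epsilon>) ^ i)" by (simp add: poly_altdef)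
    also have "\<dots> \<le> (\<Sum>i\<le>degree p. \<bar>coeff p i\<bar> * (1 / \<epsilon>) ^ degree p)"
    proof (rule sum_mono)
      fix i assume "i \<in> {..degree p}"
      then have "(1 / \<epsilon>) ^ i \<le> (1 / \<epsilon>) ^ degree p" using x
        by (intro power_increasing) auto
      moreover have "coeff p i * (1 / \<epsilon>) ^ i \<le> \<bar>coeff p i\<bar> * (1 / \<epsilon>) ^ i"
        using x0 by (intro mult_right_mono zero_le_power) auto
      ultimately show "coeff p i * (1 / \<epsilon>) ^ i \<le> \<bar>coeff p i\<bar> * (1 / \<epsilon>) ^
        degree p"
        by (meson abs_ge_zero mult_left_mono order_trans)
    qed
    finally show "f \<epsilon> \<le> (\<Sum>i\<le>degree p. \<bar>coeff p i\<bar>) * (1 / \<epsilon>) ^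
      degree p"
      by (simp add: sum_distrib_right)
  qed
qed


section \<open>Canonical tests from tolerant tests\<close>

lemma induced_tuple_all:
  assumes "G \<in> edges n \<rightarrow>\<^sub>E S"
  shows "induced_tuple {1..n} G = G"
proof
  fix e
  show "induced_tuple {1..n} G e = G e"
  proof (cases "e \<in> edges n")
    case True
    have "(\<lambda>i. sorted_list_of_set {1..n} ! (i - 1)) ` e = (\<lambda>i. i) ` e"
    proof (rule image_cong[OF refl])
      fix i assume "i \<in> e"
      then have i: "i \<in> {1..n}" using True by (auto simp: edges_def nsets_def)
      then have "{y\<in>{1..n}. y < i} = {1..<i}" by auto
      then have "card {y\<in>{1..n}. y < i} = i - 1" by simp
      then show "sorted_list_of_set {1..n} ! (i - 1) = i" using sorted_list_nth_rank[OF _ i] by simp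
    qed
    then have "(\<lambda>i. sorted_list_of_set {1..n} ! (i - 1)) ` e = e" by simp
    then show ?thesis using True by (simp add: induced_tuple_def)
  next
    case False
    then show ?thesis using PiE_arb[OF assms] by (simp add: induced_tuple_def)
  qed
qed

text \<open>\<open>K\<close> is the repaired graph. Completeness adds \<open>\<gamma> / 2\<close>
  from resilience to \<open>\<gamma> / 2\<close> from the repair. For soundness, a member
  \<open>H\<close> near \<open>K\<close> is pulled back by \<open>inv q\<close>; the errors
  \<open>\<epsilon> / 8\<close>, \<open>\<epsilon> / 2\<close> and \<open>\<epsilon> / 4\<close>
  stay below \<open>\<epsilon>\<close>.\<close>

lemma relabeling_near_property:
  fixes \<phi> :: "nat set \<Rightarrow> 'c \<Rightarrow> 'c" and U P :: "'c graph_family"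
  assumes fin: "finite (P n)" and PU: "P n \<subseteq> U n"
    and res: "earthmover_resilient U \<delta> P" and \<epsilon>: "\<epsilon> \<in> {0<..<1}" and
      \<gamma>: "0 < \<gamma>" "\<gamma> < 1"
    and \<beta>: "40 * \<beta> \<le> \<delta> (\<gamma> / 2)" "40 * \<beta> \<le> \<delta> (\<epsilon> /
      4)" "12 * \<beta> \<le> \<gamma> / 2" "12 * \<beta> \<le> \<epsilon> / 8"
    and q: "q permutes {1..n}"
      "\<And>G. G \<in> U n \<Longrightarrow> relabel q G \<in> U n"
      "\<And>G. G \<in> U n \<Longrightarrow> relabel (inv q) G \<in> U n"
      "\<And>G :: 'c graph. earthmover_dist n G (relabel q G) \<le> ereal (40 * \<beta>)"
      "\<And>G :: 'c graph. earthmover_dist n G (relabel (inv q) G) \<le> ereal (40 * \<beta>)"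
    and G: "G \<in> U n" and K: "hamming_dist n K (relabel q G) \<le> 12 * \<beta>"
  shows "G \<in> P n \<Longrightarrow> close \<gamma> n K P" and "far \<epsilon> n G P \<Longrightarrow>
    far (\<epsilon> / 2) n K P"
proof -
  have resD: "close \<epsilon>' n B P" if "\<epsilon>' \<in> {0<..<1}" "A \<in> P n" "B \<in> U n"
    "earthmover_dist n A B \<le> ereal (40 * \<beta>)" "40 * \<beta> \<le> \<delta> \<epsilon>'"
    for \<epsilon>' A B
  proof -
    have "earthmover_dist n A B \<le> ereal (\<delta> \<epsilon>')" using that(4,5)
      by (meson ereal_less_eq(3) order_trans)
    then show ?thesis using res that(1-3) unfolding earthmover_resilient_def by blast
  qed
  show "close \<gamma> n K P" if GP: "G \<in> P n"
  proof -
    have "\<gamma> / 2 \<in> {0<..<1}" using \<gamma> by auto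
    then have "close (\<gamma> / 2) n (relabel q G) P" using resD GP q(2)[OF G] q(4) \<beta>(1) by blast
    then obtain H where H: "H \<in> P n" "hamming_dist n (relabel q G) H \<le> \<gamma> / 2"
      using closeE fin by blast
    have "hamming_dist n K H \<le> \<gamma>"
      using hamming_dist_triangle[of n K H "relabel q G"] K H(2) \<beta>(3) by linarith
    with H(1) show ?thesis by (rule closeI)
  qed
  show "far (\<epsilon> / 2) n K P" if far: "far \<epsilon> n G P"
  proof (rule ccontr)
    assume "close (\<epsilon> / 2) n K P"
    then obtain H where H: "H \<in> P n" "hamming_dist n K H \<le> \<epsilon> / 2" using closeE fin by blast
    \<comment> \<open>Resilience must start from a member of the property, so it is applied to
      \<open>H\<close>, not to the far graph \<open>G\<close>.\<close>
    let ?H = "relabel (inv q) H"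
    have "\<epsilon> / 4 \<in> {0<..<1}" using \<epsilon> by auto
    moreover have "?H \<in> U n" using H(1) PU q(3) by blast
    ultimately have "close (\<epsilon> / 4) n ?H P" using resD H(1) q(5) \<beta>(2) by blast
    then obtain J where J: "J \<in> P n" "hamming_dist n ?H J \<le> \<epsilon> / 4" using closeE fin by blast
    have "relabel q ?H = H" by (simp add: relabel_comp permutes_inv_o[OF q(1)])
    then have "hamming_dist n G ?H = hamming_dist n (relabel q G) H"
      using hamming_dist_relabel[OF q(1), of G ?H] by simp
    also have "\<dots> \<le> hamming_dist n (relabel q G) K + hamming_dist n K H"
      by (rule hamming_dist_triangle)
    finally have "hamming_dist n G J \<le> \<epsilon>"
      using hamming_dist_triangle[of n G J ?H] K H(2) J(2) \<beta>(4) \<epsilon> hamming_dist_commute[of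
        n K "relabel q G"]
      by (auto simp: greaterThanLessThan_iff)
    with J(1) have "close \<epsilon> n G P" by (rule closeI)
    then show False using far by blast
  qed
qed

text \<open>The tolerant test runs at \<open>\<epsilon> / 2\<close>, leaving the other half to the
  displacement. Of the sample, \<open>s * (2 * k + 1)\<close> vertices cover the residue classes of
  all vertices read; the last \<open>k\<close> ensure \<open>n \<ge> k\<close> whenever the sample
  is not everything.\<close>

lemma canonical_test_of_tolerant_test:
  fixes \<Sigma> :: "'c set"
  assumes \<Sigma>: "finite \<Sigma>" "input_class \<Sigma> U" "property_of U P"
    and res: "earthmover_resilient U \<delta> P"
    and \<epsilon>: "\<epsilon> \<in> {0<..<1}" and \<gamma>: "\<gamma> = \<eta> (\<epsilon> / 2)" "0 <
      \<gamma>" "\<gamma> < 1"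
    and tol: "is_tolerant_test U P (\<epsilon> / 2) \<eta> (run T)"
    and S: "\<And>n. U n \<subseteq> edges n \<rightarrow>\<^sub>E S"
    and loc: "\<And>n t. t \<in> set_pmf (tree_majority T n) \<Longrightarrow>
      \<exists>W\<subseteq>{1..n}. card W \<le> s \<and> depends_on n S W t"
    and \<beta>: "0 < \<beta>" "\<beta> \<le> 1"
      "40 * \<beta> \<le> \<delta> (\<gamma> / 2)" "40 * \<beta> \<le> \<delta> (\<epsilon> / 4)" "12 *
        \<beta> \<le> \<gamma> / 2" "12 * \<beta> \<le> \<epsilon> / 8"
    and k: "real k \<ge> 600 / \<beta> ^ 3"
  shows "\<exists>D. is_test U P \<epsilon> (canonical_algorithm (s * (2 * k + 1) + k) D)"
proof -
  let ?Q = "s * (2 * k + 1) + k"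
  have finP: "finite (P n)" and PU: "P n \<subseteq> U n" for n
    using finite_property[OF \<Sigma>] \<Sigma>(3) by (simp_all add: property_of_def)
  have "1 \<le> 1 / \<beta> ^ 3" using \<beta> by (simp add: power_le_one)
  then have k600: "real k \<ge> 600" using k by simp
  have "\<exists>D. \<forall>G\<in>U n.
     (G \<in> P n \<longrightarrow> pmf (bind_pmf (pmf_of_set (nsets {1..n} (min ?Q n))) (\<lambda>V. D
       (induced_tuple V G))) True \<ge> 2 / 3) \<and>
     (far \<epsilon> n G P \<longrightarrow> pmf (bind_pmf (pmf_of_set (nsets {1..n} (min ?Q n)))
       (\<lambda>V. D (induced_tuple V G))) False \<ge> 2 / 3)"
    for n
  proof (cases "U n = {}")
    case True
    then show ?thesis by simp
  next
    case U: False
    show ?thesis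
    proof (cases "n \<le> ?Q")
      case True
      have "nsets {1..n} n = {{1..n}}"
      proof -
        have "V = {1..n}" if "V \<in> nsets {1..n} n" for V
          using card_subset_eq[of "{1..n}" V] that by (simp add: nsets_def)
        then show ?thesis by (auto simp: nsets_def)
      qed
      then have "pmf_of_set (nsets {1..n} (min ?Q n)) = return_pmf {1..n}"
        using True by (simp only: min_absorb2 pmf_of_set_singleton)
      moreover have "induced_tuple {1..n} G = G" if "G \<in> U n" for G
        by (rule induced_tuple_all[OF subsetD[OF S that]])
      moreover have "G \<notin> P n" if "far \<epsilon> n G P" for G
        using that closeI[of G P n G \<epsilon>] \<epsilon> by auto
      \<comment> \<open>For small \<open>n\<close> the sample is the whole graph, and membership is
        decided exactly.\<close>
      ultimately show ?thesis
        by (intro exI[of _ "\<lambda>H. return_pmf (H \<in> P n)"]) (simp add: bind_return_pmf)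
    next
      case nQ: False
      then have n: "n \<ge> 2" "k \<le> n" "n > ?Q" using k600 by simp_all
      have k0: "k > 0" using k600 by simp
      \<comment> \<open>This keeps \<open>n / m\<close> between \<open>k\<close> and
        \<open>2 * k\<close>: large enough for concentration, small enough to sample whole
        classes.\<close>
      define m where "m = n div k"
      have m: "m > 0" using n k0 by (simp add: m_def div_greater_zero_iff)
      have mk: "m * k \<le> n" "n < (m + 1) * k"
        using k0 by (simp_all add: m_def dividend_less_div_times)
      have nm: "real n / m \<ge> real k"
        using mk(1) m by (simp add: pos_le_divide_eq mult.commute flip: of_nat_mult)
      obtain M \<phi> where
        \<phi>: "\<And>G p. G \<in> U n \<Longrightarrow> p permutes {1..n} \<Longrightarrow> (\<And>u. u
          \<in> {1..n} \<Longrightarrow> p u \<le> M \<longleftrightarrow> u \<le> M) \<Longrightarrow>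
             relabel p G \<in> U n"
          "\<And>G p. G \<in> U n \<Longrightarrow> p permutes {1..n} \<Longrightarrow>
            (\<lambda>e\<in>edges n. \<phi> e (relabel p G e)) \<in> U n"
          "\<And>G p e. G \<in> U n \<Longrightarrow> p permutes {1..n} \<Longrightarrow> e \<in> edges n
            \<Longrightarrow> e \<inter> crossing n M p = {} \<Longrightarrow>
             \<phi> e (relabel p G e) = relabel p G e"
        using input_class_relabel[OF \<Sigma>(2) U] by blast
      have cls: "card (residue_class n m u) \<le> 2 * k + 1" for u
      proof -
        have "u mod m < m" using m by simp
        then have "real (card (residue_class n m u)) \<le> real n / m + 1"
          unfolding residue_class_def by (rule card_residue_class)
        moreover have "real n / m \<le> 2 * real k"
        proof -
          have "(m + 1) * k \<le> (2 * m) * k" using m by (intro mult_le_mono1) simp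
          then have "n \<le> (2 * m) * k" using mk(2) by (rule less_imp_le[OF less_le_trans, rotated])
          then have "real n \<le> real ((2 * m) * k)" by (simp only: of_nat_le_iff)
          then show ?thesis using m by (simp add: divide_le_eq mult_ac)
        qed
        ultimately have "real (card (residue_class n m u)) \<le> real (2 * k + 1)" by simp
        then show ?thesis by (simp only: of_nat_le_iff)
      qed
      let ?s = "sort_residues n m"
      define K where "K G p = (\<lambda>e\<in>edges n. \<phi> e (relabel (?s p) G e))" for G p
      have "\<exists>D. \<forall>G\<in>U n. bind_pmf (pmf_of_set (nsets {1..n} ?Q)) (\<lambda>V. D
        (induced_tuple V G)) =
          bind_pmf (pmf_of_set (perms n)) (\<lambda>p. map_pmf (run_tree (K G p)) (tree_majority T n))"
        unfolding K_def
        by (rule canonical_simulation[where S = S and s = s and c = "2 * k + 1"])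
           (use S \<phi>(2) loc cls n in simp_all)
      then obtain D where D: "\<And>G. G \<in> U n \<Longrightarrow>
          bind_pmf (pmf_of_set (nsets {1..n} ?Q)) (\<lambda>V. D (induced_tuple V G)) =
          bind_pmf (pmf_of_set (perms n)) (\<lambda>p. run (tree_majority T) n (K G p))"
        unfolding run_def by blast
      define bad where "bad = {p\<in>perms n. \<beta> * n < real (card (displaced n (nat \<lfloor>\<beta>
        * n\<rfloor>) (?s p)))}"
      have bad: "real (card bad) \<le> 3 / 100 * fact n"
        unfolding bad_def using \<beta>(1,2) m nm k by (intro card_bad_perms) linarith+
      \<comment> \<open>At least \<open>97/100\<close> of the permutations contribute
        \<open>7/10\<close> each, which is more than \<open>2/3\<close> in total.\<close>
      have good: "pmf (bind_pmf (pmf_of_set (perms n)) (\<lambda>p. run (tree_majority T) n (K G p))) x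
        \<ge> 2 / 3"
        if *: "\<And>p. p \<in> perms n - bad \<Longrightarrow> pmf (run T n (K G p)) x \<ge> 2 / 3" for G x
      proof -
        let ?f = "\<lambda>p. pmf (run (tree_majority T) n (K G p)) x"
        have "real (card (perms n - bad)) = fact n - real (card bad)"
        proof -
          have "bad \<subseteq> perms n" by (auto simp: bad_def)
          then have "card (perms n - bad) = card (perms n) - card bad" "card bad \<le> card (perms n)"
            by (simp_all add: card_Diff_subset finite_subset card_mono)
          then show ?thesis by (simp add: of_nat_diff card_perms)
        qed
        then have "2 / 3 * fact n \<le> real (card (perms n - bad)) * (7 / 10)" using bad by linarith
        also have "\<dots> = (\<Sum>p\<in>perms n - bad. 7 / 10)" by simp
        also have "\<dots> \<le> (\<Sum>p\<in>perms n - bad. ?f p)"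
        proof (rule sum_mono)
          fix p assume "p \<in> perms n - bad"
          then have "pmf (run T n (K G p)) x \<ge> 13 / 20" using *[of p] by linarith
          then show "7 / 10 \<le> ?f p" unfolding run_tree_majority by (rule pmf_maj_pmf_ge)
        qed
        also have "\<dots> \<le> (\<Sum>p\<in>perms n. ?f p)" by (intro sum_mono2) auto
        finally have "2 / 3 \<le> (\<Sum>p\<in>perms n. ?f p) / fact n" by (simp add: le_divide_eq)
        then show ?thesis by (subst pmf_bind_pmf_of_set) (simp_all add: card_perms)
      qed
      have near: "(G \<in> P n \<longrightarrow> close \<gamma> n (K G p) P) \<and> (far \<epsilon> n G P
        \<longrightarrow> far (\<epsilon> / 2) n (K G p) P) \<and> K G p \<in> U n"
        if G: "G \<in> U n" and p: "p \<in> perms n - bad" for G p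
      proof -
        have sp: "?s p permutes {1..n}" using p by (intro sort_residues_permutes) simp
        have disp: "real (card (displaced n (nat \<lfloor>\<beta> * n\<rfloor>) (?s p))) \<le> \<beta> *
          n" using p by (auto simp: bad_def)
        obtain q where q: "q permutes {1..n}"
          "\<And>G. G \<in> U n \<Longrightarrow> relabel q G \<in> U n"
          "\<And>G. G \<in> U n \<Longrightarrow> relabel (inv q) G \<in> U n"
          "\<And>G :: 'c graph. earthmover_dist n G (relabel q G) \<le> ereal (40 * \<beta>)"
          "\<And>G :: 'c graph. earthmover_dist n G (relabel (inv q) G) \<le> ereal (40 * \<beta>)"
          "\<And>G. G \<in> U n \<Longrightarrow> hamming_dist n (\<lambda>e\<in>edges n. \<phi> e
            (relabel (?s p) G e)) (relabel q G) \<le> 12 * \<beta>"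
          using sorted_relabeling_near_class[OF n(1) sp \<beta>(1) disp, of U M \<phi>, OF \<phi>(1)
            \<phi>(3)] by blast
        have KG: "hamming_dist n (K G p) (relabel q G) \<le> 12 * \<beta>" using q(6)[OF G]
          by (simp add: K_def)
        note near = relabeling_near_property[OF finP PU res \<epsilon> \<gamma>(2,3) \<beta>(3-6) q(1-5) G KG]
        have "K G p \<in> U n" using \<phi>(2)[OF G sp] by (simp add: K_def)
        then show ?thesis using near by blast
      qed
      have "min ?Q n = ?Q" using n(3) by simp
      show ?thesis
        unfolding \<open>min ?Q n = ?Q\<close>
      proof (intro exI[of _ D] ballI conjI impI)
        fix G assume G: "G \<in> U n"
        show "pmf (bind_pmf (pmf_of_set (nsets {1..n} ?Q)) (\<lambda>V. D (induced_tuple V G))) True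
          \<ge> 2 / 3" if "G \<in> P n"
          unfolding D[OF G]
          using near[OF G] that tol \<gamma>(1) by (intro good) (auto simp: is_tolerant_test_def)
        show "pmf (bind_pmf (pmf_of_set (nsets {1..n} ?Q)) (\<lambda>V. D (induced_tuple V G))) False
          \<ge> 2 / 3" if "far \<epsilon> n G P"
          unfolding D[OF G]
          using near[OF G] that tol by (intro good) (auto simp: is_tolerant_test_def)
      qed
    qed
  qed
  \<comment> \<open>The decision rules may vary with \<open>n\<close>; only the sample size has to
    be uniform.\<close>
  then obtain D where "\<And>n. \<forall>G\<in>U n.
     (G \<in> P n \<longrightarrow> pmf (bind_pmf (pmf_of_set (nsets {1..n} (min ?Q n))) (\<lambda>V. D n
       (induced_tuple V G))) True \<ge> 2 / 3) \<and>
     (far \<epsilon> n G P \<longrightarrow> pmf (bind_pmf (pmf_of_set (nsets {1..n} (min ?Q n)))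
       (\<lambda>V. D n (induced_tuple V G))) False \<ge> 2 / 3)"
    by metis
  then show ?thesis unfolding is_test_def canonical_algorithm_def by blast
qed

text \<open>Canonical testability ranges over all positive parameters, while \<open>\<delta>\<close>
  and \<open>\<eta>\<close> are controlled only on the unit interval. From \<open>1\<close> on,
  farness occurs only for an empty property, which is decided without looking at the graph.\<close>

lemma canonical_test_trivial:
  assumes "\<epsilon> \<ge> 1"
  shows "\<exists>D. is_test U P \<epsilon> (canonical_algorithm q D)"
proof -
  have "P n = {}" if far: "far \<epsilon> n G P" for n G
  proof (rule ccontr)
    assume "P n \<noteq> {}"
    then obtain H where "H \<in> P n" by blast
    moreover have "hamming_dist n G H \<le> \<epsilon>" using hamming_dist_le_1[of n G H] assms by linarith
    ultimately show False using closeI far by blast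
  qed
  then have "is_test U P \<epsilon> (canonical_algorithm q (\<lambda>n _. return_pmf (P n \<noteq> {})))"
    by (auto simp: is_test_def canonical_algorithm_def indicator_def)
  then show ?thesis by blast
qed

text \<open>The largest \<open>\<beta>\<close> with \<open>40 * \<beta> \<le> a\<close>,
  \<open>40 * \<beta> \<le> b\<close>, \<open>12 * \<beta> \<le> \<gamma> / 2\<close> and
  \<open>12 * \<beta> \<le> \<epsilon> / 8\<close>. Here \<open>a\<close> and \<open>b\<close> stand
  for the resilience at \<open>\<gamma> / 2\<close> and at \<open>\<epsilon> / 4\<close>.\<close>

definition displacement_bound :: "real \<Rightarrow> real \<Rightarrow> real \<Rightarrow> real
  \<Rightarrow> real" where
  "displacement_bound \<epsilon> \<gamma> a b = min (min (a / 40) (b / 40)) (min (\<gamma> / 24)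
    (\<epsilon> / 96))"

definition canonical_queries :: "(real \<Rightarrow> real) \<Rightarrow> (real \<Rightarrow> real)
  \<Rightarrow> (real \<Rightarrow> nat) \<Rightarrow> real \<Rightarrow> nat" where
  "canonical_queries \<delta> \<eta> s \<epsilon> =
    (let \<gamma> = \<eta> (\<epsilon> / 2); \<beta> = displacement_bound \<epsilon> \<gamma> (\<delta>
      (\<gamma> / 2)) (\<delta> (\<epsilon> / 4)); k = nat \<lceil>600 / \<beta> ^ 3\<rceil>
     in s (\<epsilon> / 2) * (2 * k + 1) + k)"

text \<open>Abstracting the number \<open>s \<epsilon>\<close> of vertices read treats adaptive and
  nonadaptive tests together.\<close>

lemma canonically_testable_with_queries:
  fixes \<Sigma> :: "'c set"
  assumes \<Sigma>: "finite \<Sigma>" "input_class \<Sigma> U" "property_of U P"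
    and u: "maps_unit_interval \<delta>" "maps_unit_interval \<eta>"
    and res: "earthmover_resilient U \<delta> P"
    and S: "\<And>n. U n \<subseteq> edges n \<rightarrow>\<^sub>E S"
    and T: "\<And>\<epsilon>. \<epsilon> \<in> {0<..<1} \<Longrightarrow> \<exists>T. is_tolerant_test U
      P \<epsilon> \<eta> (run T) \<and>
      (\<forall>n. \<forall>t\<in>set_pmf (tree_majority T n). \<exists>W\<subseteq>{1..n}. card W \<le>
        s \<epsilon> \<and> depends_on n S W t)"
  shows "canonically_testable_with U (canonical_queries \<delta> \<eta> s) P"
  unfolding canonically_testable_with_def
proof (intro allI impI)
  fix \<epsilon> :: real assume "0 < \<epsilon>"
  show "\<exists>D. is_test U P \<epsilon> (canonical_algorithm (canonical_queries \<delta> \<eta> s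
    \<epsilon>) D)"
  proof (cases "\<epsilon> < 1")
    case False
    then show ?thesis by (intro canonical_test_trivial) simp
  next
    case True
    have \<epsilon>: "\<epsilon> \<in> {0<..<1}" "\<epsilon> / 2 \<in> {0<..<1}" "\<epsilon> / 4 \<in>
      {0<..<1}" using \<open>0 < \<epsilon>\<close> True by auto
    define \<gamma> where "\<gamma> = \<eta> (\<epsilon> / 2)"
    have \<gamma>: "\<gamma> \<in> {0<..<1}" using u(2) \<epsilon>(2)
      unfolding maps_unit_interval_def \<gamma>_def by blast
    then have \<gamma>2: "\<gamma> / 2 \<in> {0<..<1}" by auto
    have \<delta>: "\<delta> (\<gamma> / 2) \<in> {0<..<1}" "\<delta> (\<epsilon> / 4) \<in> {0<..<1}"
      using u(1) \<gamma>2 \<epsilon>(3) unfolding maps_unit_interval_def by blast+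
    define \<beta> where "\<beta> = displacement_bound \<epsilon> \<gamma> (\<delta> (\<gamma> / 2))
      (\<delta> (\<epsilon> / 4))"
    define k where "k = nat \<lceil>600 / \<beta> ^ 3\<rceil>"
    obtain T where T': "is_tolerant_test U P (\<epsilon> / 2) \<eta> (run T)"
      "\<And>n t. t \<in> set_pmf (tree_majority T n) \<Longrightarrow> \<exists>W\<subseteq>{1..n}. card
        W \<le> s (\<epsilon> / 2) \<and> depends_on n S W t"
      using T[OF \<epsilon>(2)] by blast
    have \<beta>: "0 < \<beta>" "\<beta> \<le> 1" "40 * \<beta> \<le> \<delta> (\<gamma> / 2)" "40 *
      \<beta> \<le> \<delta> (\<epsilon> / 4)" "12 * \<beta> \<le> \<gamma> / 2" "12 * \<beta> \<le>
      \<epsilon> / 8"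
      using \<epsilon> \<gamma> \<delta> unfolding \<beta>_def displacement_bound_def by (auto simp: min_def)
    have k: "real k \<ge> 600 / \<beta> ^ 3" unfolding k_def by linarith
    have \<gamma>': "0 < \<gamma>" "\<gamma> < 1" using \<gamma> by auto
    have "\<exists>D. is_test U P \<epsilon> (canonical_algorithm (s (\<epsilon> / 2) * (2 * k + 1) + k) D)"
      by (rule canonical_test_of_tolerant_test[OF \<Sigma> res \<epsilon>(1) \<gamma>_def \<gamma>' T'(1)
        S T'(2) \<beta> k])
    then show ?thesis by (simp add: canonical_queries_def Let_def \<gamma>_def \<beta>_def k_def)
  qed
qed

text \<open>The reciprocal of a minimum is one of the reciprocals; a sum replaces the maximum
  because it stays polynomial.\<close>

lemma inverse_displacement_bound_le:
  assumes "\<epsilon> > 0" "\<gamma> > 0" "a > 0" "b > 0"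
  shows "1 / displacement_bound \<epsilon> \<gamma> a b \<le> 40 * (1 / a) + 40 * (1 / b) + 24 * (1 /
    \<gamma>) + 96 * (1 / \<epsilon>)"
proof -
  have "1 / a > 0" "1 / b > 0" "1 / \<gamma> > 0" "1 / \<epsilon> > 0" using assms by simp_all
  then show ?thesis unfolding displacement_bound_def min_def by auto
qed

lemma poly_bounded_canonical_queries:
  assumes u: "maps_unit_interval \<delta>" "maps_unit_interval \<eta>"
    and "poly_bounded_in_inverse (\<lambda>\<epsilon>. real (s \<epsilon>))"
    and "poly_bounded_in_inverse (\<lambda>\<epsilon>. 1 / \<eta> \<epsilon>)"
    and "poly_bounded_in_inverse (\<lambda>\<epsilon>. 1 / \<delta> \<epsilon>)"
  shows "poly_bounded_in_inverse (\<lambda>\<epsilon>. real (canonical_queries \<delta> \<eta> s \<epsilon>))"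
proof -
  obtain cs ks where s: "cs \<ge> 0" "\<And>\<epsilon>. \<epsilon> \<in> {0<..<1} \<Longrightarrow> real
    (s \<epsilon>) \<le> cs * (1 / \<epsilon>) ^ ks"
    using poly_bounded_powerE[OF assms(3)] by blast
  obtain ce ke where e: "ce \<ge> 0" "\<And>\<epsilon>. \<epsilon> \<in> {0<..<1} \<Longrightarrow> 1 /
    \<eta> \<epsilon> \<le> ce * (1 / \<epsilon>) ^ ke"
    using poly_bounded_powerE[OF assms(4)] by blast
  obtain cd kd where d: "cd \<ge> 0" "\<And>\<epsilon>. \<epsilon> \<in> {0<..<1} \<Longrightarrow> 1 /
    \<delta> \<epsilon> \<le> cd * (1 / \<epsilon>) ^ kd"
    using poly_bounded_powerE[OF assms(5)] by blast
  \<comment> \<open>At \<open>x = 1 / \<epsilon>\<close> the functions \<open>py\<close>,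
    \<open>pb\<close> and \<open>pk\<close> bound \<open>1 / \<gamma>\<close>,
    \<open>1 / \<beta>\<close> and \<open>k\<close>. The polynomials \<open>Y\<close>,
    \<open>B\<close> and \<open>K\<close> below are their formal counterparts.\<close>
  define py where "py x = ce * (2 * x) ^ ke" for x :: real
  define pb where "pb x = 40 * (cd * (2 * py x) ^ kd) + 40 * (cd * (4 * x) ^ kd) + 24 * py x + 96 * x"
    for x :: real
  define pk where "pk x = 600 * pb x ^ 3 + 1" for x :: real
  define X where "X = [:0, 1::real:]"
  define Y where "Y = smult ce ((2 * X) ^ ke)"
  define B where "B = smult (40 * cd) ((2 * Y) ^ kd) + smult (40 * cd) ((4 * X) ^ kd) + 24 * Y + 96 * X"
  define K where "K = 600 * B ^ 3 + 1"
  have polys: "poly X x = x" "poly Y x = py x" "poly B x = pb x" "poly K x = pk x" for x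
  proof -
    show X: "poly X x = x" by (simp add: X_def)
    show Y: "poly Y x = py x"
      by (simp only: Y_def py_def X poly_smult poly_power poly_mult poly_numeral)
    show B: "poly B x = pb x"
      by (simp only: B_def pb_def X Y poly_smult poly_power poly_mult poly_add poly_numeral mult.assoc)
    show "poly K x = pk x"
      by (simp only: K_def pk_def B poly_power poly_mult poly_add poly_numeral poly_1)
  qed
  show ?thesis
    unfolding poly_bounded_in_inverse_def
  proof (intro exI ballI)
    fix \<epsilon> :: real assume \<epsilon>: "\<epsilon> \<in> {0<..<1}"
    let ?x = "1 / \<epsilon>"
    have \<epsilon>': "\<epsilon> / 2 \<in> {0<..<1}" "\<epsilon> / 4 \<in> {0<..<1}" using \<epsilon> by auto
    have x: "?x \<ge> 0" using \<epsilon> by simp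
    define \<gamma> where "\<gamma> = \<eta> (\<epsilon> / 2)"
    have \<gamma>: "\<gamma> \<in> {0<..<1}" using u(2) \<epsilon>'(1)
      unfolding maps_unit_interval_def \<gamma>_def by blast
    then have \<gamma>2: "\<gamma> / 2 \<in> {0<..<1}" by auto
    have \<delta>: "\<delta> (\<gamma> / 2) \<in> {0<..<1}" "\<delta> (\<epsilon> / 4) \<in> {0<..<1}"
      using u(1) \<gamma>2 \<epsilon>'(2) unfolding maps_unit_interval_def by blast+
    define \<beta> where "\<beta> = displacement_bound \<epsilon> \<gamma> (\<delta> (\<gamma> / 2))
      (\<delta> (\<epsilon> / 4))"
    define k where "k = nat \<lceil>600 / \<beta> ^ 3\<rceil>"
    have \<gamma>x: "1 / \<gamma> \<le> py ?x" using e(2)[OF \<epsilon>'(1)]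
      by (simp add: py_def \<gamma>_def)
    have "1 / \<delta> (\<gamma> / 2) \<le> cd * (1 / (\<gamma> / 2)) ^ kd" by (rule d(2)[OF \<gamma>2])
    also have "1 / (\<gamma> / 2) = 2 * (1 / \<gamma>)" by simp
    also have "cd * (2 * (1 / \<gamma>)) ^ kd \<le> cd * (2 * py ?x) ^ kd"
      using \<gamma>x \<gamma> d(1) by (intro mult_left_mono power_mono) auto
    finally have d1: "1 / \<delta> (\<gamma> / 2) \<le> cd * (2 * py ?x) ^ kd" .
    have d2: "1 / \<delta> (\<epsilon> / 4) \<le> cd * (4 * ?x) ^ kd" using d(2)[OF \<epsilon>'(2)] by simp
    have \<beta>0: "\<beta> > 0" using \<epsilon> \<gamma> \<delta>
      by (simp add: \<beta>_def displacement_bound_def)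
    have "1 / \<beta> \<le> 40 * (1 / \<delta> (\<gamma> / 2)) + 40 * (1 / \<delta> (\<epsilon> / 4)) +
      24 * (1 / \<gamma>) + 96 * ?x"
      unfolding \<beta>_def using \<epsilon> \<gamma> \<delta> by (intro inverse_displacement_bound_le) auto
    also have "\<dots> \<le> pb ?x" using d1 d2 \<gamma>x unfolding pb_def by linarith
    finally have "1 / \<beta> \<le> pb ?x" .
    then have "(1 / \<beta>) ^ 3 \<le> pb ?x ^ 3" using \<beta>0 by (intro power_mono) auto
    moreover have "600 / \<beta> ^ 3 = 600 * (1 / \<beta>) ^ 3" by (simp add: power_one_over)
    moreover have "real k \<le> 600 / \<beta> ^ 3 + 1" using \<beta>0 unfolding k_def
      by (simp add: of_nat_nat)
    ultimately have k: "real k \<le> pk ?x" unfolding pk_def by linarith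
    have s2: "real (s (\<epsilon> / 2)) \<le> cs * (2 * ?x) ^ ks" using s(2)[OF \<epsilon>'(1)] by simp
    have "real (canonical_queries \<delta> \<eta> s \<epsilon>) = real (s (\<epsilon> / 2)) * (2 * real k
      + 1) + real k"
      by (simp only: canonical_queries_def Let_def \<gamma>_def \<beta>_def k_def of_nat_add of_nat_mult
        of_nat_numeral of_nat_1)
    also have "\<dots> \<le> (cs * (2 * ?x) ^ ks) * (2 * pk ?x + 1) + pk ?x"
      using s2 k s(1) x by (intro add_mono mult_mono) (auto intro!: mult_nonneg_nonneg)
    also have "\<dots> = poly (smult cs ((2 * X) ^ ks) * (2 * K + 1) + K) ?x"
      by (simp only: polys poly_smult poly_power poly_mult poly_add poly_numeral poly_1)
    finally show "real (canonical_queries \<delta> \<eta> s \<epsilon>) \<le> poly (smult cs ((2 * X) ^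
      ks) * (2 * K + 1) + K) ?x" .
  qed
qed

text \<open>Independence of \<open>n\<close> is all that is claimed here, so the exponential vertex
  count of adaptive trees is affordable.\<close>

lemma canonically_testable_of_tolerantly_testable:
  fixes \<Sigma> :: "'c set"
  assumes \<Sigma>: "finite \<Sigma>" "input_class \<Sigma> U" "property_of U P"
    and u: "maps_unit_interval \<delta>" "maps_unit_interval \<eta>"
    and res: "earthmover_resilient U \<delta> P" and tol: "tolerantly_testable U \<eta> P"
  shows "canonically_testable U P"
proof -
  obtain S where S: "finite S" "\<And>n. U n \<subseteq> edges n \<rightarrow>\<^sub>E S"
    using input_class_colors[OF \<Sigma>(1,2)] by blast
  have "\<forall>\<epsilon>\<in>{0<..<1}. \<exists>q T. query_bound T q \<and> is_tolerant_test U P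
    \<epsilon> \<eta> (run T)"
    using tol by (simp add: tolerantly_testable_def)
  then obtain q where q: "\<And>\<epsilon>. \<epsilon> \<in> {0<..<1} \<Longrightarrow> \<exists>T.
    query_bound T (q \<epsilon>) \<and> is_tolerant_test U P \<epsilon> \<eta> (run T)"
    by metis
  have "canonically_testable_with U (canonical_queries \<delta> \<eta> (\<lambda>\<epsilon>. 2 * (card S
    + 2) ^ (3 * q \<epsilon>))) P"
  proof (rule canonically_testable_with_queries[OF \<Sigma> u res S(2)])
    fix \<epsilon> :: real assume "\<epsilon> \<in> {0<..<1}"
    then obtain T where T: "query_bound T (q \<epsilon>)" "is_tolerant_test U P \<epsilon> \<eta> (run
      T)" using q by blast
    have "\<forall>n. \<forall>t\<in>set_pmf (tree_majority T n). queries_at_most t (3 * q \<epsilon>)"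
      using query_bound_majority[OF T(1)] by (simp add: query_bound_def)
    then show "\<exists>T. is_tolerant_test U P \<epsilon> \<eta> (run T) \<and> (\<forall>n.
      \<forall>t\<in>set_pmf (tree_majority T n).
        \<exists>W\<subseteq>{1..n}. card W \<le> 2 * (card S + 2) ^ (3 * q \<epsilon>) \<and> depends_on
          n S W t)"
      using depends_on_adaptive[OF S(1)] T(2) by blast
  qed
  then show ?thesis unfolding canonically_testable_def by blast
qed

text \<open>The factor \<open>2 * 3\<close> stands for two ends per query and three runs of the
  test.\<close>

lemma canonically_testable_of_nonadaptively_tolerantly_testable:
  fixes \<Sigma> :: "'c set"
  assumes \<Sigma>: "finite \<Sigma>" "input_class \<Sigma> U" "property_of U P"
    and u: "maps_unit_interval \<delta>" "maps_unit_interval \<eta>"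
    and res: "earthmover_resilient U \<delta> P"
    and tol: "nonadaptively_tolerantly_testable_with U \<eta> q P"
  shows "canonically_testable_with U (canonical_queries \<delta> \<eta> (\<lambda>\<epsilon>. 2 * (3 * q
    \<epsilon>))) P"
proof -
  obtain S where S: "finite S" "\<And>n. U n \<subseteq> edges n \<rightarrow>\<^sub>E S"
    using input_class_colors[OF \<Sigma>(1,2)] by blast
  show ?thesis
  proof (rule canonically_testable_with_queries[OF \<Sigma> u res S(2)])
    fix \<epsilon> :: real assume "\<epsilon> \<in> {0<..<1}"
    then obtain T where T: "nonadaptive T" "query_bound T (q \<epsilon>)" "is_tolerant_test U P
      \<epsilon> \<eta> (run T)"
      using tol unfolding nonadaptively_tolerantly_testable_with_def by blast
    have "\<exists>W\<subseteq>{1..n}. card W \<le> 2 * (3 * q \<epsilon>) \<and> depends_on n S W t"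
      if t: "t \<in> set_pmf (tree_majority T n)" for n t
    proof -
      obtain es where "queries_exactly t es"
        using nonadaptive_majority[OF T(1)] t unfolding nonadaptive_def by blast
      moreover have "queries_at_most t (3 * q \<epsilon>)"
        using query_bound_majority[OF T(2)] t unfolding query_bound_def by blast
      ultimately show ?thesis by (rule depends_on_nonadaptive)
    qed
    then show "\<exists>T. is_tolerant_test U P \<epsilon> \<eta> (run T) \<and> (\<forall>n.
      \<forall>t\<in>set_pmf (tree_majority T n).
        \<exists>W\<subseteq>{1..n}. card W \<le> 2 * (3 * q \<epsilon>) \<and> depends_on n S W t)"
      using T(3) by blast
  qed
qed

lemma poly_bounded_tolerance:
  assumes "poly_bounded_in_inverse (\<lambda>\<epsilon>. real (q \<epsilon>))"
  shows "poly_bounded_in_inverse (\<lambda>\<epsilon>. 1 / (1 / (60 * (real (q \<epsilon>) ^ 2 + 1))))"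
proof -
  obtain p :: "real poly" where p: "\<And>\<epsilon>. \<epsilon> \<in> {0<..<1} \<Longrightarrow> real (q
    \<epsilon>) \<le> poly p (1 / \<epsilon>)"
    using assms unfolding poly_bounded_in_inverse_def by blast
  have "1 / (1 / (60 * (real (q \<epsilon>) ^ 2 + 1))) \<le> poly (60 * (p ^ 2 + 1)) (1 / \<epsilon>)"
    if "\<epsilon> \<in> {0<..<1}" for \<epsilon>
    using power_mono[OF p[OF that], of 2] by simp
  then show ?thesis unfolding poly_bounded_in_inverse_def by blast
qed

theorem theorem6:
  shows
    "(\<forall>(\<Sigma> :: 'c set) U P \<delta> \<eta>.
        finite \<Sigma> \<and> input_class \<Sigma> U \<and> property_of U P \<and>
        maps_unit_interval \<delta> \<and> maps_unit_interval \<eta> \<and> (\<forall>\<epsilon>\<in>{0<..<1}. \<eta> \<epsilon> < \<epsilon>) \<and>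
        earthmover_resilient U \<delta> P \<and> tolerantly_testable U \<eta> P \<longrightarrow>
          canonically_testable U P \<and>
          (\<forall>q. nonadaptively_tolerantly_testable_with U \<eta> q P \<and>
               poly_bounded_in_inverse (\<lambda>\<epsilon>. real (q \<epsilon>)) \<and>
               poly_bounded_in_inverse (\<lambda>\<epsilon>. 1 / \<eta> \<epsilon>) \<and>
               poly_bounded_in_inverse (\<lambda>\<epsilon>. 1 / \<delta> \<epsilon>) \<longrightarrow>
               (\<exists>q'. canonically_testable_with U q' P \<and>
                     poly_bounded_in_inverse (\<lambda>\<epsilon>. real (q' \<epsilon>)))))
     \<and>
     (\<forall>q' :: real \<Rightarrow> nat. \<exists>\<delta>'.
        maps_unit_interval \<delta>' \<and>
        (\<forall>(\<Sigma> :: 'c set) U P.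
           finite \<Sigma> \<and> input_class \<Sigma> U \<and> property_of U P \<and> canonically_testable_with U q' P \<longrightarrow>
             earthmover_resilient U \<delta>' P \<and> tolerantly_testable U \<delta>' P) \<and>
        (poly_bounded_in_inverse (\<lambda>\<epsilon>. real (q' \<epsilon>)) \<longrightarrow>
           poly_bounded_in_inverse (\<lambda>\<epsilon>. 1 / \<delta>' \<epsilon>)))"
proof (intro conjI allI impI)
  fix \<Sigma> :: "'c set" and U P \<delta> \<eta>
  assume "finite \<Sigma> \<and> input_class \<Sigma> U \<and> property_of U P \<and>
        maps_unit_interval \<delta> \<and> maps_unit_interval \<eta> \<and> (\<forall>\<epsilon>\<in>{0<..<1}. \<eta> \<epsilon> < \<epsilon>) \<and>
        earthmover_resilient U \<delta> P \<and> tolerantly_testable U \<eta> P"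
  then have \<Sigma>: "finite \<Sigma>" "input_class \<Sigma> U" "property_of U P"
    and u: "maps_unit_interval \<delta>" "maps_unit_interval \<eta>"
    and res: "earthmover_resilient U \<delta> P" and tol: "tolerantly_testable U \<eta> P" by blast+
  show "canonically_testable U P" by (rule canonically_testable_of_tolerantly_testable[OF \<Sigma> u res tol])
  fix q
  assume q: "nonadaptively_tolerantly_testable_with U \<eta> q P \<and>
               poly_bounded_in_inverse (\<lambda>\<epsilon>. real (q \<epsilon>)) \<and>
               poly_bounded_in_inverse (\<lambda>\<epsilon>. 1 / \<eta> \<epsilon>) \<and>
               poly_bounded_in_inverse (\<lambda>\<epsilon>. 1 / \<delta> \<epsilon>)"
  then obtain p :: "real poly" where "\<And>\<epsilon>. \<epsilon> \<in> {0<..<1} \<Longrightarrow> real (q \<epsilon>) \<le> poly p (1 / \<epsilon>)"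
    unfolding poly_bounded_in_inverse_def by blast
  then have "\<forall>\<epsilon>\<in>{0<..<1}. real (2 * (3 * q \<epsilon>)) \<le> poly (6 * p) (1 / \<epsilon>)" by simp
  then have "poly_bounded_in_inverse (\<lambda>\<epsilon>. real (2 * (3 * q \<epsilon>)))"
    unfolding poly_bounded_in_inverse_def by blast
  then have "poly_bounded_in_inverse (\<lambda>\<epsilon>. real (canonical_queries \<delta> \<eta> (\<lambda>\<epsilon>. 2 * (3 * q \<epsilon>)) \<epsilon>))"
    using q by (intro poly_bounded_canonical_queries[OF u]) simp_all
  moreover have "canonically_testable_with U (canonical_queries \<delta> \<eta> (\<lambda>\<epsilon>. 2 * (3 * q \<epsilon>))) P"
    using q by (intro canonically_testable_of_nonadaptively_tolerantly_testable[OF \<Sigma> u res]) simp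
  ultimately show "\<exists>q'. canonically_testable_with U q' P \<and> poly_bounded_in_inverse (\<lambda>\<epsilon>. real (q' \<epsilon>))"
    by blast
next
  fix q' :: "real \<Rightarrow> nat"
  \<comment> \<open>The witness is built from \<open>q'\<close> alone, before
    \<open>\<Sigma>\<close>, \<open>U\<close> and \<open>P\<close> are introduced, so one function
    serves all properties with this query count.\<close>
  let ?\<delta> = "\<lambda>\<epsilon>. 1 / (60 * (real (q' \<epsilon>) ^ 2 + 1))"
  have "maps_unit_interval ?\<delta>"
    unfolding maps_unit_interval_def
  proof
    fix \<epsilon> :: real
    have "(1 :: real) < 60 * (0 + 1)" by simp
    also have "\<dots> \<le> 60 * (real (q' \<epsilon>) ^ 2 + 1)" by (intro mult_left_mono add_right_mono) simp_all
    finally have "1 < 60 * (real (q' \<epsilon>) ^ 2 + 1)" .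
    then show "?\<delta> \<epsilon> \<in> {0<..<1}" by simp
  qed
  moreover have "\<forall>(\<Sigma> :: 'c set) U P.
           finite \<Sigma> \<and> input_class \<Sigma> U \<and> property_of U P \<and> canonically_testable_with U q' P \<longrightarrow>
             earthmover_resilient U ?\<delta> P \<and> tolerantly_testable U ?\<delta> P"
    by (intro allI impI conjI; elim conjE; rule canonical_resilient_and_tolerant)
  ultimately show "\<exists>\<delta>'. maps_unit_interval \<delta>' \<and>
        (\<forall>(\<Sigma> :: 'c set) U P.
           finite \<Sigma> \<and> input_class \<Sigma> U \<and> property_of U P \<and> canonically_testable_with U q' P \<longrightarrow>
             earthmover_resilient U \<delta>' P \<and> tolerantly_testable U \<delta>' P) \<and>
        (poly_bounded_in_inverse (\<lambda>\<epsilon>. real (q' \<epsilon>)) \<longrightarrow>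
           poly_bounded_in_inverse (\<lambda>\<epsilon>. 1 / \<delta>' \<epsilon>))"
    using poly_bounded_tolerance[of q'] by (intro exI[of _ ?\<delta>]) blast
qed

end
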